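(* Let $n\geq 2$ be an integer and let $\alpha$ be a real number with $n-1\leq\alpha<n$. Let $V$ be a measurable function on $\mathbb{R}^n$ belonging to the class $\mathcal{K}_\alpha$, i.e. $$\lim_{r\rightarrow 0}\ \sup_{x\in\mathbb{R}^n}\int_{|x-y|<r}\frac{|V(y)|}{|x-y|^{n-\alpha}}\,dy=0.$$ Let $u$ be a nonzero function (i.e. not identically zero as an element of $L^1(\mathbb{R}^n)$) such that $$u\in L^1(\mathbb{R}^n)\quad\text{and}\quad(-\Delta)^{\alpha/2}u\in L^1(\mathbb{R}^n),$$ and which satisfies the differential inequality $$|(-\Delta)^{\alpha/2}u|\leq|Vu|\quad\text{(almost everywhere) on }\mathbb{R}^n.$$ Then $u$ cannot vanish in any non-empty open subset of $\mathbb{R}^n$; that is, there is no non-empty open set $\Omega\subset\mathbb{R}^n$ such that $u=0$ almost everywhere on $\Omega$.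
   Context: The operator $(-\Delta)^{\alpha/2}$ is defined by means of the Fourier transform: $\mathcal{F}[(-\Delta)^{\alpha/2}f](\xi)=|\xi|^\alpha\widehat{f}(\xi)$, where $\widehat f=\mathcal{F}f$ is the Fourier transform, normalized so that $f(x)=\int_{\mathbb{R}^n}e^{2\pi i x\cdot\xi}\widehat f(\xi)\,d\xi$. For $u\in L^1(\mathbb{R}^n)$, $\widehat u$ is bounded and continuous, so $|\xi|^\alpha\widehat u(\xi)$ is a tempered distribution and $(-\Delta)^{\alpha/2}u$ is the tempered distribution whose Fourier transform it is; the condition $(-\Delta)^{\alpha/2}u\in L^1(\mathbb{R}^n)$ means that this distribution is given by an $L^1$ function. Functions in $L^1(\mathbb{R}^n)$ are identified when they agree almost everywhere. *)

theory Defs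
  imports "HOL-Analysis.Analysis"
begin

text \<open>
  Integrals are taken with respect to Lebesgue measure on \<open>real ^ 'n\<close>, and functions are complex
  valued.
\<close>

definition partial_deriv :: "'n \<Rightarrow> (real ^ 'n \<Rightarrow> complex) \<Rightarrow> real ^ 'n \<Rightarrow> complex" where
  "partial_deriv i f x = frechet_derivative f (at x) (axis i 1)"

text \<open>
  Multi-indices are represented by lists of coordinate directions; for smooth functions the order
  in the list is irrelevant.
\<close>

definition iterated_partial :: "'n list \<Rightarrow> (real ^ 'n \<Rightarrow> complex) \<Rightarrow> real ^ 'n \<Rightarrow> complex" where
  "iterated_partial is f = foldr partial_deriv is f"

definition schwartz_weighted ::
  "nat \<Rightarrow> 'n list \<Rightarrow> (real ^ 'n \<Rightarrow> complex) \<Rightarrow> real ^ 'n \<Rightarrow> real" where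
  "schwartz_weighted k is \<phi> x = norm x ^ k * norm (iterated_partial is \<phi> x)"

definition schwartz_space :: "(real ^ 'n \<Rightarrow> complex) set" where
  "schwartz_space = {\<phi>.
     (\<forall>is x. iterated_partial is \<phi> differentiable (at x)) \<and>
     (\<forall>k is. bounded (range (schwartz_weighted k is \<phi>)))}"

definition schwartz_seminorm :: "nat \<Rightarrow> 'n list \<Rightarrow> (real ^ 'n \<Rightarrow> complex) \<Rightarrow> real" where
  "schwartz_seminorm k is \<phi> = (SUP x. schwartz_weighted k is \<phi> x)"

text \<open>
  A distribution is a functional on all functions of which only the values on the Schwartz space
  matter. Continuity is stated as domination by finitely many of the Schwartz seminorms.
\<close>

definition tempered_distribution :: "((real ^ 'n \<Rightarrow> complex) \<Rightarrow> complex) \<Rightarrow> bool" where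
  "tempered_distribution T \<longleftrightarrow>
     (\<forall>\<phi>\<in>schwartz_space. \<forall>\<psi>\<in>schwartz_space. T (\<lambda>x. \<phi> x + \<psi> x) = T \<phi> + T \<psi>) \<and>
     (\<forall>c. \<forall>\<phi>\<in>schwartz_space. T (\<lambda>x. c * \<phi> x) = c * T \<phi>) \<and>
     (\<exists>C N. \<forall>\<phi>\<in>schwartz_space.
        norm (T \<phi>) \<le> C * (\<Sum>k\<le>N. \<Sum>is | length is \<le> N. schwartz_seminorm k is \<phi>))"

definition distribution_of :: "(real ^ 'n \<Rightarrow> complex) \<Rightarrow> (real ^ 'n \<Rightarrow> complex) \<Rightarrow> complex" where
  "distribution_of f \<phi> = (LINT x|lebesgue. f x * \<phi> x)"

definition fourier :: "(real ^ 'n \<Rightarrow> complex) \<Rightarrow> real ^ 'n \<Rightarrow> complex" where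
  "fourier f \<xi> = (LINT x|lebesgue. exp (- (2 * of_real pi * \<i> * of_real (x \<bullet> \<xi>))) * f x)"

definition fourier_distribution ::
  "((real ^ 'n \<Rightarrow> complex) \<Rightarrow> complex) \<Rightarrow> (real ^ 'n \<Rightarrow> complex) \<Rightarrow> complex" where
  "fourier_distribution T \<phi> = T (fourier \<phi>)"

text \<open>
  \<open>is_frac_laplacian \<alpha> u T\<close>: the tempered distribution \<open>T\<close> is $(-\Delta)^{\alpha/2}u$, i.e. its
  Fourier transform is $|\xi|^\alpha\widehat u(\xi)$. Intended for integrable \<open>u\<close> and \<open>\<alpha> > 0\<close>
  (for \<open>\<alpha> = 0\<close> the convention \<open>0 powr 0 = 0\<close> only affects the null set \<open>{0}\<close>).
\<close>

definition is_frac_laplacian ::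
  "real \<Rightarrow> (real ^ 'n \<Rightarrow> complex) \<Rightarrow> ((real ^ 'n \<Rightarrow> complex) \<Rightarrow> complex) \<Rightarrow> bool" where
  "is_frac_laplacian \<alpha> u T \<longleftrightarrow>
     tempered_distribution T \<and>
     (\<forall>\<phi>\<in>schwartz_space. fourier_distribution T \<phi> =
        distribution_of (\<lambda>\<xi>. of_real (norm \<xi> powr \<alpha>) * fourier u \<xi>) \<phi>)"

text \<open>
  The supremum and the limit are taken in \<open>ennreal\<close>, so that the integrals may be infinite for
  large \<open>r\<close>. At \<open>y = x\<close> the integrand is \<open>0\<close> by the convention for division, which is immaterial.
\<close>

definition kato_class :: "real \<Rightarrow> (real ^ 'n \<Rightarrow> complex) set" where
  "kato_class \<alpha> = {V. V \<in> borel_measurable lebesgue \<and>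
     ((\<lambda>r. SUP x. \<integral>\<^sup>+y\<in>ball x r.
         ennreal (norm (V y) / norm (x - y) powr (real CARD('n) - \<alpha>)) \<partial>lebesgue)
       \<longlongrightarrow> 0) (at_right 0)}"

end

(*
  Put beta = n - alpha, so 0 < beta <= 1, and let g = (-Delta)^(alpha/2) u. Testing the equation
  against modulated Gaussians and integrating in the heat parameter shows u = c |.|^(-beta) * g
  almost everywhere. If u vanishes near p, then so does g, because |g| <= |V u|. Expanding
  |x - y|^(-beta) around p in Gegenbauer polynomials, vanishing of u near p kills every moment of
  g, so any partial sum of the expansion may be subtracted from the kernel. For beta <= 1 the
  remainder of order m is at most C (|x - p| / |y - p|)^m |x - y|^(-beta) with C independent of m.
  Hence |x - p|^(-m) |u(x)| is bounded by the Riesz potential of |y - p|^(-m) |g(y)|. Multiplying by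
  |V| and integrating over a ball B(p, r), with r so small that the Kato condition makes the
  constant at most 1/2, the part inside the ball is absorbed and
    integral over B(p, r) of (r / |x - p|)^m |g|  <=  ||g||_1   for all m.
  Letting m tend to infinity gives g = 0 and then u = 0 on B(p, r). Since r does not depend on p,
  the set of points near which u vanishes is open and closed.
*)

theory Submission
  imports Defs "HOL-Probability.Probability" "HOL-Computational_Algebra.Formal_Power_Series"
begin

section \<open>Gegenbauer polynomials and their generating function\<close>

text \<open>Everything turns on the constant C being independent of m: the radius r is fixed by C
  through the Kato condition before m tends to infinity, so growth of C in m would destroy the
  absorption. This is where \<beta> \<le> 1 enters. On the ray through y the relative remainder is 1
  - |1 - s|^\<beta> times a partial sum of the series of (1 - s)^(-\<beta>); its derivative has size
  m^\<beta> |1 - s|^(\<beta> - 1) s^(m - 1). Within 1/m of s = 1 the singular part has bounded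
  integral, and further away m^\<beta> |1 - s|^(\<beta> - 1) \<le> m because |1 - s|^(\<beta> - 1)
  decreases with the distance to 1; for \<beta> > 1 it would increase. Off the ray a cancellation
  between consecutive Gegenbauer polynomials is required as well, and the complex factorization of
  the generating function provides it. The absorption also needs a finite weighted integral, which
  the vanishing of g near p guarantees.\<close>

text \<open>The coefficient of $X^j$ in $(1-X)^{-\mu}$.\<close>

definition neg_binom :: "real \<Rightarrow> nat \<Rightarrow> real" where
  "neg_binom \<mu> j = pochhammer \<mu> j / fact j"

lemma neg_binom_0 [simp]: "neg_binom \<mu> 0 = 1"
  by (simp add: neg_binom_def)

lemma neg_binom_Suc: "real (Suc j) * neg_binom \<mu> (Suc j) = (\<mu> + real j) * neg_binom \<mu> j"
  by (simp add: neg_binom_def pochhammer_Suc field_simps del: of_nat_Suc)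

lemma neg_binom_rec: "real (Suc j) * neg_binom \<mu> (Suc j) = \<mu> * neg_binom (\<mu> + 1) j"
  by (simp add: neg_binom_def pochhammer_rec field_simps del: of_nat_Suc)

lemma neg_binom_nonneg: "0 \<le> \<mu> \<Longrightarrow> 0 \<le> neg_binom \<mu> j"
  by (simp add: neg_binom_def pochhammer_prod prod_nonneg)

text \<open>Division by 1 - X turns (1 - X)^(-\<mu>) into (1 - X)^(-\<mu> - 1), so the coefficients
  for \<mu> + 1 are the partial sums of those for \<mu>. For \<mu> \<ge> 0 they therefore increase,
  which later permits summation by parts.\<close>

lemma neg_binom_add1_Suc:
  "neg_binom (\<mu> + 1) (Suc j) = neg_binom (\<mu> + 1) j + neg_binom \<mu> (Suc j)"
proof -
  have "real (Suc j) * neg_binom (\<mu> + 1) (Suc j) = real (Suc j) * neg_binom (\<mu> + 1) j + \<mu> * neg_binom (\<mu> + 1) j"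
    by (subst neg_binom_Suc) (simp add: algebra_simps)
  also have "\<mu> * neg_binom (\<mu> + 1) j = real (Suc j) * neg_binom \<mu> (Suc j)"
    by (rule neg_binom_rec[symmetric])
  finally have "real (Suc j) * neg_binom (\<mu> + 1) (Suc j) = real (Suc j) * (neg_binom (\<mu> + 1) j + neg_binom \<mu> (Suc j))"
    by (simp only: distrib_left)
  thus ?thesis by simp
qed

lemma neg_binom_add1_mono:
  assumes "0 \<le> \<mu>" "i \<le> j"
  shows "neg_binom (\<mu> + 1) i \<le> neg_binom (\<mu> + 1) j"
  using assms(2)
  by (rule lift_Suc_mono_le[rotated])
     (simp add: neg_binom_add1_Suc neg_binom_nonneg assms)

text \<open>The ratio of consecutive coefficients is 1 + \<mu>/(j + 1), at most ((j + 1)/j)^\<mu>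
  because 1 + t \<le> exp t and 1/(j + 1) \<le> ln ((j + 1)/j).\<close>

lemma neg_binom_add1_le_powr:
  assumes "0 \<le> \<mu>" "1 \<le> j"
  shows "neg_binom (\<mu> + 1) j \<le> (1 + \<mu>) * real j powr \<mu>"
  using assms(2)
proof (induction j rule: dec_induct)
  case base
  show ?case by (simp add: neg_binom_def)
next
  case (step j)
  define x where "x = real j"
  have x: "x \<ge> 1" using step by (simp add: x_def)
  have "1 + \<mu> / (x + 1) \<le> exp (\<mu> / (x + 1))"
    by (rule exp_ge_add_one_self)
  also have "\<dots> \<le> exp (\<mu> * (ln (x + 1) - ln x))"
  proof -
    have "ln (x / (x + 1)) \<le> x / (x + 1) - 1"
      using x by (intro ln_le_minus_one) auto
    hence "1 / (x + 1) \<le> ln (x + 1) - ln x"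
      using x by (simp add: ln_div field_simps)
    from mult_left_mono[OF this assms(1)] show ?thesis by simp
  qed
  also have "\<dots> = (x + 1) powr \<mu> / x powr \<mu>"
    using x by (simp add: powr_def exp_diff[symmetric] algebra_simps)
  finally have *: "(1 + \<mu> / (x + 1)) * x powr \<mu> \<le> (x + 1) powr \<mu>"
    using x by (simp add: pos_le_divide_eq)
  have "neg_binom (\<mu> + 1) (Suc j) = (1 + \<mu> / (x + 1)) * neg_binom (\<mu> + 1) j"
    using neg_binom_Suc[of j "\<mu> + 1"] by (simp add: x_def field_simps)
  also have "\<dots> \<le> (1 + \<mu> / (x + 1)) * ((1 + \<mu>) * x powr \<mu>)"
    using step.IH assms x by (intro mult_left_mono) (auto simp: x_def)
  also have "\<dots> = (1 + \<mu>) * ((1 + \<mu> / (x + 1)) * x powr \<mu>)" by simp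
  also have "\<dots> \<le> (1 + \<mu>) * (x + 1) powr \<mu>"
    using * assms by (intro mult_left_mono) auto
  finally show ?case by (simp add: x_def add.commute)
qed

text \<open>The ratio of consecutive coefficients is (\<mu> + j)/(j + 1) \<le> 1. Applied at
  \<open>2 * \<mu>\<close>, this bounds the Gegenbauer polynomials of index at most 1/2 by 1 on
  [-1, 1].\<close>

lemma neg_binom_le_1:
  assumes "0 \<le> \<mu>" "\<mu> \<le> 1" shows "neg_binom \<mu> j \<le> 1"
proof (induction j)
  case (Suc j)
  have "real (Suc j) * neg_binom \<mu> (Suc j) = (\<mu> + real j) * neg_binom \<mu> j"
    by (rule neg_binom_Suc)
  also have "\<dots> \<le> real (Suc j) * 1"
    using Suc assms neg_binom_nonneg[of \<mu> j] by (intro mult_mono) auto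
  finally show ?case using mult_le_cancel_left_pos[of "real (Suc j)"] by fastforce
qed simp

text \<open>Coefficients of (1 - X)^(-\<mu>) (1 - X)^(-\<nu>), that is, the Chu-Vandermonde identity
  for rising factorials.\<close>

lemma neg_binom_convolution:
  "(\<Sum>j\<le>m. neg_binom \<mu> j * neg_binom \<nu> (m - j)) = neg_binom (\<mu> + \<nu>) m"
proof -
  have "neg_binom (\<mu> + \<nu>) m = (\<Sum>k\<le>m. real (m choose k) * pochhammer \<mu> k * pochhammer \<nu> (m - k) / fact m)"
    by (simp add: neg_binom_def pochhammer_binomial_sum sum_divide_distrib)
  also have "\<dots> = (\<Sum>j\<le>m. neg_binom \<mu> j * neg_binom \<nu> (m - j))"
    by (intro sum.cong refl) (simp add: neg_binom_def binomial_fact)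
  finally show ?thesis by simp
qed

section \<open>Formal power series (1 - z X)^(-\<mu>) and the Gegenbauer generating function\<close>

definition neg_binom_fps :: "real \<Rightarrow> complex \<Rightarrow> complex fps" where
  "neg_binom_fps \<mu> z = Abs_fps (\<lambda>j. of_real (neg_binom \<mu> j) * z ^ j)"

lemma neg_binom_fps_deriv:
  "fps_deriv (neg_binom_fps \<mu> z) = fps_const (of_real \<mu> * z) * neg_binom_fps (\<mu> + 1) z"
proof (rule fps_ext)
  fix n
  have "complex_of_real (real (Suc n) * neg_binom \<mu> (Suc n)) = of_real (\<mu> * neg_binom (\<mu> + 1) n)"
    by (simp only: neg_binom_rec)
  thus "fps_nth (fps_deriv (neg_binom_fps \<mu> z)) n = fps_nth (fps_const (of_real \<mu> * z) * neg_binom_fps (\<mu> + 1) z) n"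
    by (simp add: neg_binom_fps_def algebra_simps del: of_nat_Suc)
qed

lemma neg_binom_fps_shift:
  "neg_binom_fps \<mu> z = (1 - fps_const z * fps_X) * neg_binom_fps (\<mu> + 1) z"
proof (rule fps_ext)
  fix n show "fps_nth (neg_binom_fps \<mu> z) n = fps_nth ((1 - fps_const z * fps_X) * neg_binom_fps (\<mu> + 1) z) n"
    by (cases n; simp add: neg_binom_fps_def neg_binom_add1_Suc left_diff_distrib mult.assoc)
       (simp add: algebra_simps)
qed

text \<open>The three-term recurrence of the classical C_k^\<mu>. Taking it as the definition makes
  the values real and continuous in c at once, and it is the form in which derivatives of partial
  sums telescope; the link with the generating function is
  \<open>gegenbauer_fps_nth\<close>.\<close>

fun gegenbauer :: "real \<Rightarrow> real \<Rightarrow> nat \<Rightarrow> real" where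
  "gegenbauer \<mu> c 0 = 1"
| "gegenbauer \<mu> c (Suc 0) = 2 * \<mu> * c"
| "gegenbauer \<mu> c (Suc (Suc k)) =
     (2 * (real k + 1 + \<mu>) * c * gegenbauer \<mu> c (Suc k) - (real k + 2 * \<mu>) * gegenbauer \<mu> c k)
       / (real k + 2)"

text \<open>Generating function $(1 - 2 X \cos\theta + X^2)^{-\mu}$ of the Gegenbauer polynomials, factored over the complex numbers.\<close>

definition gegenbauer_fps :: "real \<Rightarrow> real \<Rightarrow> complex fps" where
  "gegenbauer_fps \<mu> \<theta> = neg_binom_fps \<mu> (cis \<theta>) * neg_binom_fps \<mu> (cis (- \<theta>))"

lemma cis_add_cis_uminus: "cis \<theta> + cis (- \<theta>) = of_real (2 * cos \<theta>)"
  by (simp add: complex_eq_iff)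

lemma gegenbauer_fps_shift:
  "gegenbauer_fps \<mu> \<theta> =
     (1 - fps_const (of_real (2 * cos \<theta>)) * fps_X + fps_X\<^sup>2) * gegenbauer_fps (\<mu> + 1) \<theta>"
proof -
  have "(1 - fps_const (cis \<theta>) * fps_X) * (1 - fps_const (cis (- \<theta>)) * fps_X) =
        1 - (fps_const (cis \<theta>) + fps_const (cis (- \<theta>))) * fps_X 
          + fps_const (cis \<theta>) * fps_const (cis (- \<theta>)) * fps_X\<^sup>2"
    by (simp add: algebra_simps power2_eq_square del: fps_const_add fps_const_mult)
  hence *: "(1 - fps_const (cis \<theta>) * fps_X) * (1 - fps_const (cis (- \<theta>)) * fps_X) =
        1 - fps_const (of_real (2 * cos \<theta>)) * fps_X + fps_X\<^sup>2"
    by (simp only: fps_const_add fps_const_mult cis_add_cis_uminus cis_mult) simp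
  show ?thesis
    unfolding gegenbauer_fps_def * [symmetric]
    by (subst (1 2) neg_binom_fps_shift) (simp only: mult_ac)
qed

lemma gegenbauer_fps_deriv:
  "fps_deriv (gegenbauer_fps \<mu> \<theta>) =
     fps_const (of_real (2 * \<mu>)) * (fps_const (of_real (cos \<theta>)) - fps_X) * gegenbauer_fps (\<mu> + 1) \<theta>"
proof -
  let ?z = "cis \<theta>" and ?w = "cis (- \<theta>)"
  let ?A = "neg_binom_fps (\<mu> + 1) ?z" and ?B = "neg_binom_fps (\<mu> + 1) ?w"
  have "fps_deriv (gegenbauer_fps \<mu> \<theta>) =
      ((1 - fps_const ?z * fps_X) * ?A) * (fps_const (of_real \<mu> * ?w) * ?B)
       + (fps_const (of_real \<mu> * ?z) * ?A) * ((1 - fps_const ?w * fps_X) * ?B)"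
    unfolding gegenbauer_fps_def
    by (simp only: fps_deriv_mult neg_binom_fps_deriv neg_binom_fps_shift[symmetric])
  also have "\<dots> = fps_const (of_real \<mu>) * ((fps_const ?z + fps_const ?w) - 2 * (fps_const ?z * fps_const ?w) * fps_X) * (?A * ?B)"
    by (simp only: fps_const_mult[symmetric]) (simp add: algebra_simps del: fps_const_add fps_const_mult)
  also have "(fps_const ?z + fps_const ?w) = 2 * fps_const (of_real (cos \<theta>))"
    by (simp only: fps_const_add cis_add_cis_uminus) (simp add: numeral_fps_const)
  also have "fps_const ?z * fps_const ?w = 1" by (simp add: cis_mult)
  finally show ?thesis
    by (simp add: gegenbauer_fps_def algebra_simps numeral_fps_const)
qed

text \<open>The generating function G solves (1 - 2 c X + X^2) G' = 2 \<mu> (c - X) G with c = cos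
  \<theta>. Comparing coefficients gives the recurrence, so the two sequences agree by induction on
  pairs of neighbours.\<close>

lemma gegenbauer_fps_nth:
  "fps_nth (gegenbauer_fps \<mu> \<theta>) k = of_real (gegenbauer \<mu> (cos \<theta>) k)"
proof -
  let ?G = "gegenbauer_fps \<mu> \<theta>" and ?c = "complex_of_real (cos \<theta>)"
  have "(1 - fps_const (of_real (2 * cos \<theta>)) * fps_X + fps_X\<^sup>2) * fps_deriv ?G
      = fps_const (of_real (2 * \<mu>)) * (fps_const ?c - fps_X) * ?G"
    unfolding gegenbauer_fps_deriv by (subst gegenbauer_fps_shift[of \<mu>]) (simp only: mult_ac)
  hence eq: "fps_deriv ?G = fps_const (2 * ?c) * (fps_X * fps_deriv ?G) - fps_X * (fps_X * fps_deriv ?G)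
      + fps_const (2 * \<mu> * ?c) * ?G - fps_const (of_real (2 * \<mu>)) * (fps_X * ?G)"
    by (simp add: algebra_simps power2_eq_square flip: fps_const_mult)
  have G0: "fps_nth ?G 0 = 1" by (simp add: gegenbauer_fps_def neg_binom_fps_def)
  have G1: "fps_nth ?G (Suc 0) = 2 * \<mu> * ?c"
    using arg_cong[OF eq, of "\<lambda>F. fps_nth F 0"] by (simp add: G0)
  have GSS: "fps_nth ?G (Suc (Suc n)) = (2 * (of_nat n + 1 + \<mu>) * ?c * fps_nth ?G (Suc n)
       - (of_nat n + 2 * \<mu>) * fps_nth ?G n) / (of_nat n + 2)" for n
  proof -
    have "(of_nat n + 2) * fps_nth ?G (Suc (Suc n)) =
       2 * (of_nat n + 1 + \<mu>) * ?c * fps_nth ?G (Suc n) - (of_nat n + 2 * \<mu>) * fps_nth ?G n"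
      using arg_cong[OF eq, of "\<lambda>F. fps_nth F (Suc n)"]
      by (cases n) (simp_all add: algebra_simps)
    moreover have "of_nat n + (2::complex) \<noteq> 0"
      using of_nat_neq_0[of "Suc n", where 'a = complex] by (simp add: add.commute)
    ultimately show ?thesis by (simp add: field_simps)
  qed
  have "fps_nth ?G k = of_real (gegenbauer \<mu> (cos \<theta>) k) \<and>
        fps_nth ?G (Suc k) = of_real (gegenbauer \<mu> (cos \<theta>) (Suc k))"
    by (induction k) (simp_all add: G0 G1 GSS)
  thus ?thesis by simp
qed

section \<open>Bounds for Gegenbauer polynomials on [-1, 1]\<close>

lemma gegenbauer_eq_sum:
  "of_real (gegenbauer \<mu> (cos \<theta>) k) =
     (\<Sum>j\<le>k. of_real (neg_binom \<mu> j * neg_binom \<mu> (k - j)) * cis \<theta> ^ j * cis (- \<theta>) ^ (k - j))"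
  unfolding gegenbauer_fps_nth[symmetric]
  by (simp add: gegenbauer_fps_def neg_binom_fps_def fps_mult_nth atMost_atLeast0 mult_ac)

text \<open>In the double product the weights are nonnegative and the \<open>cis\<close> factors
  unimodular, so the triangle inequality leaves the convolution of the weights, which is the
  coefficient of (1 - X)^(-2 \<mu>).\<close>

lemma abs_gegenbauer_le:
  assumes "0 \<le> \<mu>" "\<bar>c\<bar> \<le> 1"
  shows "\<bar>gegenbauer \<mu> c k\<bar> \<le> neg_binom (2 * \<mu>) k"
proof -
  define \<theta> where "\<theta> = arccos c"
  have c: "c = cos \<theta>" using assms by (simp add: \<theta>_def cos_arccos_abs)
  have "\<bar>gegenbauer \<mu> c k\<bar> = norm (complex_of_real (gegenbauer \<mu> (cos \<theta>) k))"
    by (simp add: c)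
  also have "\<dots> \<le> (\<Sum>j\<le>k. neg_binom \<mu> j * neg_binom \<mu> (k - j))"
    unfolding gegenbauer_eq_sum
    by (rule sum_norm_le) (simp add: norm_mult norm_power neg_binom_nonneg assms)
  also have "\<dots> = neg_binom (2 * \<mu>) k" by (simp add: neg_binom_convolution)
  finally show ?thesis .
qed

text \<open>Summation by parts, the weights \<open>neg_binom (\<mu> + 1)\<close> being increasing.\<close>

lemma abs_gegenbauer_add1_le:
  assumes "0 \<le> \<mu>" "sin \<theta> > 0"
  shows "\<bar>gegenbauer (\<mu> + 1) (cos \<theta>) m\<bar> \<le> 2 * (neg_binom (\<mu> + 1) m)\<^sup>2 / sin \<theta>"
proof -
  let ?a = "neg_binom (\<mu> + 1)"
  define \<zeta> where "\<zeta> = cis (2 * \<theta>)"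
  define w where "w = (\<lambda>j. ?a j * ?a (m - j))"
  have a_ge0: "0 \<le> ?a j" for j using assms by (intro neg_binom_nonneg) auto
  have a_le: "?a j \<le> ?a m" if "j \<le> m" for j using neg_binom_add1_mono[OF assms(1) that] .
  have a_ge1: "1 \<le> ?a m" using neg_binom_add1_mono[OF assms(1), of 0 m] by simp
  have norm_\<zeta>: "norm (1 - \<zeta>) = 2 * sin \<theta>"
  proof -
    have "1 - \<zeta> = - 2 * \<i> * of_real (sin \<theta>) * cis \<theta>"
      by (simp add: \<zeta>_def complex_eq_iff cos_double sin_double power2_eq_square)
         (metis sin_squared_eq power2_eq_square add_diff_cancel_left' diff_add_cancel mult_2)
    thus ?thesis using assms by (simp add: norm_mult)
  qed
  \<comment> \<open>Pulling out a unimodular factor leaves a power sum in the single variable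
    \<open>\<zeta>\<close>, to which summation by parts applies.\<close>
  have eq: "complex_of_real (gegenbauer (\<mu> + 1) (cos \<theta>) m) = cis (- \<theta>) ^ m * (\<Sum>j\<le>m. of_real (w j) * \<zeta> ^ j)"
    unfolding gegenbauer_eq_sum sum_distrib_left
  proof (intro sum.cong refl)
    fix j assume "j \<in> {..m}"
    hence "cis (- \<theta>) ^ m = cis (-\<theta>) ^ (m - j) * cis (-\<theta>) ^ j" by (simp flip: power_add)
    moreover have "cis (-\<theta>) ^ j * \<zeta> ^ j = cis \<theta> ^ j"
      by (simp add: \<zeta>_def cis_mult flip: power_mult_distrib)
    ultimately show "complex_of_real (?a j * ?a (m - j)) * cis \<theta> ^ j * cis (- \<theta>) ^ (m - j) =
        cis (- \<theta>) ^ m * (complex_of_real (w j) * \<zeta> ^ j)"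
      by (simp add: w_def mult_ac)
  qed
  have abel: "(1 - \<zeta>) * (\<Sum>j\<le>k. of_real (w j) * \<zeta> ^ j) =
      of_real (w 0) + (\<Sum>j<k. of_real (w (Suc j) - w j) * \<zeta> ^ Suc j) - of_real (w k) * \<zeta> ^ Suc k" for k
    by (induction k) (simp_all add: algebra_simps)
  have "norm ((1 - \<zeta>) * (\<Sum>j\<le>m. of_real (w j) * \<zeta> ^ j)) \<le>
      \<bar>w 0\<bar> + (\<Sum>j<m. \<bar>w (Suc j) - w j\<bar>) + \<bar>w m\<bar>"
  proof -
    have "norm (\<Sum>j<m. complex_of_real (w (Suc j) - w j) * \<zeta> ^ Suc j) \<le> (\<Sum>j<m. \<bar>w (Suc j) - w j\<bar>)"
      by (rule sum_norm_le) (simp add: norm_mult norm_power \<zeta>_def flip: of_real_diff)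
    moreover have "norm (complex_of_real (w m) * \<zeta> ^ Suc m) = \<bar>w m\<bar>" "norm (complex_of_real (w 0)) = \<bar>w 0\<bar>"
      by (simp_all add: norm_mult norm_power \<zeta>_def del: power_Suc)
    ultimately show ?thesis unfolding abel
      by (intro order.trans[OF norm_triangle_ineq4] order.trans[OF add_right_mono[OF norm_triangle_ineq]]) auto
  qed
  \<comment> \<open>The weights \<open>w\<close> are products of an increasing and a decreasing
    sequence and need not be monotone. Each increment splits into one difference per factor, the
    other factor being at most \<open>?a m\<close>; both families of differences then
    telescope.\<close>
  also have "(\<Sum>j<m. \<bar>w (Suc j) - w j\<bar>) \<le>
      (\<Sum>j<m. ?a m * ((?a (Suc j) - ?a j) + (?a (m - j) - ?a (m - Suc j))))"
  proof (intro sum_mono)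
    fix j assume j: "j \<in> {..<m}"
    have inc: "?a j \<le> ?a (Suc j)" "?a (m - Suc j) \<le> ?a (m - j)"
      using assms by (auto intro!: neg_binom_add1_mono)
    have "w (Suc j) - w j = (?a (Suc j) - ?a j) * ?a (m - Suc j) - ?a j * (?a (m - j) - ?a (m - Suc j))"
      by (simp add: w_def algebra_simps)
    also have "\<bar>\<dots>\<bar> \<le> (?a (Suc j) - ?a j) * ?a (m - Suc j) + ?a j * (?a (m - j) - ?a (m - Suc j))"
      using inc a_ge0 by (intro order.trans[OF abs_triangle_ineq4]) (simp add: abs_mult)
    also have "\<dots> \<le> (?a (Suc j) - ?a j) * ?a m + ?a m * (?a (m - j) - ?a (m - Suc j))"
      using inc a_ge0 j by (intro add_mono mult_left_mono mult_right_mono a_le) auto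
    finally show "\<bar>w (Suc j) - w j\<bar> \<le> ?a m * ((?a (Suc j) - ?a j) + (?a (m - j) - ?a (m - Suc j)))"
      by (simp add: algebra_simps)
  qed
  also have "\<dots> = ?a m * ((\<Sum>j<m. ?a (Suc j) - ?a j) + (\<Sum>j<m. ?a (m - j) - ?a (m - Suc j)))"
    by (simp only: sum_distrib_left[symmetric] sum.distrib)
  also have "(\<Sum>j<m. ?a (Suc j) - ?a j) = ?a m - 1" by (subst sum_lessThan_telescope) simp
  also have "(\<Sum>j<m. ?a (m - j) - ?a (m - Suc j)) = ?a m - 1"
    by (subst sum_lessThan_telescope'[of "\<lambda>j. ?a (m - j)"]) simp
  also have "\<bar>w 0\<bar> + ?a m * (?a m - 1 + (?a m - 1)) + \<bar>w m\<bar> \<le> 4 * (?a m)\<^sup>2"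
    using a_ge1 by (simp add: w_def power2_eq_square algebra_simps)
  finally have "(2 * sin \<theta>) * norm (\<Sum>j\<le>m. of_real (w j) * \<zeta> ^ j) \<le> 4 * (?a m)\<^sup>2"
    by (simp add: norm_mult norm_\<zeta>)
  moreover have "norm (\<Sum>j\<le>m. of_real (w j) * \<zeta> ^ j) = \<bar>gegenbauer (\<mu> + 1) (cos \<theta>) m\<bar>"
    using arg_cong[OF eq, of norm] by (simp add: norm_mult norm_power)
  ultimately show ?thesis using assms by (simp add: field_simps)
qed

text \<open>Coefficients of (1 - X) G' - 2 \<mu> G = - 2 \<mu> (1 - cos \<theta>) (1 + X) H, where H
  is the generating function of index \<mu> + 1. At \<theta> = 0 the values obey a one-step
  recurrence and the left side vanishes; the identity makes this cancellation quantitative through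
  the factor 1 - cos \<theta>.\<close>

lemma gegenbauer_step_difference:
  "real (Suc m) * gegenbauer \<mu> (cos \<theta>) (Suc m) - (real m + 2 * \<mu>) * gegenbauer \<mu> (cos \<theta>) m =
     - (2 * \<mu> * (1 - cos \<theta>)) *
       (gegenbauer (\<mu> + 1) (cos \<theta>) m + (if m = 0 then 0 else gegenbauer (\<mu> + 1) (cos \<theta>) (m - 1)))"
proof -
  let ?G = "gegenbauer_fps \<mu> \<theta>" and ?B = "gegenbauer_fps (\<mu> + 1) \<theta>" and ?c = "complex_of_real (cos \<theta>)"
  define a where "a = fps_const ?c"
  define k where "k = fps_const (complex_of_real (2 * \<mu>))"
  have a2: "fps_const (complex_of_real (2 * cos \<theta>)) = a + a"
    by (simp only: a_def fps_const_add mult_2 of_real_add)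
  have "fps_deriv ?G - fps_X * fps_deriv ?G - k * ?G = - (k * (1 - a)) * (?B + fps_X * ?B)"
  proof -
    have "K * (A - X) * F - X * (K * (A - X) * F) - K * ((1 - (A + A) * X + X\<^sup>2) * F) =
        - (K * (1 - A)) * (F + X * F)" for K A X F :: "complex fps"
      by (simp add: algebra_simps power2_eq_square)
    thus ?thesis
      unfolding gegenbauer_fps_deriv
      by (subst gegenbauer_fps_shift[of \<mu>]) (simp only: a2 a_def[symmetric] k_def[symmetric])
  qed
  moreover have "- (k * (1 - a)) = fps_const (- (of_real (2 * \<mu>) * (1 - ?c)))"
    by (simp only: k_def a_def fps_const_neg[symmetric] fps_const_mult[symmetric] fps_const_sub[symmetric]
        fps_const_1_eq_1)
  ultimately have eq: "fps_deriv ?G - fps_X * fps_deriv ?G - k * ?G =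
      fps_const (- (of_real (2 * \<mu>) * (1 - ?c))) * (?B + fps_X * ?B)"
    by simp
  define g where "g = gegenbauer \<mu> (cos \<theta>)"
  define b where "b = gegenbauer (\<mu> + 1) (cos \<theta>)"
  define b' where "b' = (if m = 0 then 0 else b (m - 1))"
  have G: "fps_nth ?G i = of_real (g i)" and B: "fps_nth ?B i = of_real (b i)" for i
    by (simp_all only: gegenbauer_fps_nth g_def b_def)
  have XG: "fps_nth (fps_X * fps_deriv ?G) m = of_real (real m * g m)"
    by (cases m) (simp_all only: fps_X_mult_nth fps_deriv_nth G, simp_all)
  have XB: "fps_nth (fps_X * ?B) m = of_real b'"
    by (simp only: fps_X_mult_nth B b'_def if_distrib[of of_real] of_real_0)
  have "complex_of_real (real (Suc m) * g (Suc m) - real m * g m - 2 * \<mu> * g m) =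
      of_real (- (2 * \<mu> * (1 - cos \<theta>)) * (b m + b'))"
    using arg_cong[OF eq, of "\<lambda>F. fps_nth F m"]
    by (simp only: fps_sub_nth fps_add_nth k_def fps_mult_left_const_nth XG XB fps_deriv_nth G B Suc_eq_plus1
        of_real_add of_real_diff of_real_mult of_real_minus of_real_of_nat_eq of_real_numeral of_real_1)
  hence "real (Suc m) * g (Suc m) - real m * g m - 2 * \<mu> * g m = - (2 * \<mu> * (1 - cos \<theta>)) * (b m + b')"
    by (simp only: of_real_eq_iff)
  hence "real (Suc m) * g (Suc m) - (real m + 2 * \<mu>) * g m = - (2 * \<mu> * (1 - cos \<theta>)) * (b m + b')"
    by (simp only: algebra_simps)
  thus ?thesis by (simp only: g_def b_def b'_def)
qed

text \<open>With D = 1 - 2 s c + s^2, the full series D^(-\<mu>) is annihilated by 2 \<mu> (s - c) +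
  D d/ds. Truncation leaves only boundary terms of degrees m - 1 and m, since the recurrence cancels
  all coefficients below.\<close>

lemma gegenbauer_partial_sum_deriv:
  fixes \<mu> c s :: real
  assumes "m \<ge> 1"
  shows "2 * \<mu> * (s - c) * (\<Sum>k<m. gegenbauer \<mu> c k * s ^ k) +
         (1 - 2 * s * c + s\<^sup>2) * (\<Sum>k<m. real k * gegenbauer \<mu> c k * s ^ (k - 1)) =
         (real m - 1 + 2 * \<mu>) * gegenbauer \<mu> c (m - 1) * s ^ m - real m * gegenbauer \<mu> c m * s ^ (m - 1)"
  using assms
proof (induction m rule: dec_induct)
  case base
  show ?case by (simp add: algebra_simps)
next
  case (step m)
  let ?G = "gegenbauer \<mu> c" and ?S = "s ^ (m - 1)" and ?D = "1 - 2 * s * c + s\<^sup>2"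
  obtain n where n: "m = Suc n" using step by (cases m) auto
  have sm: "s ^ m = s * ?S" by (simp add: n)
  have rec: "(real m + 1) * ?G (Suc m) =
     2 * (real m + \<mu>) * c * ?G m - (real m - 1 + 2 * \<mu>) * ?G (m - 1)"
  proof -
    have "real n + 2 \<noteq> 0" by simp
    thus ?thesis by (simp add: n add.commute)
  qed
  have "2 * \<mu> * (s - c) * (\<Sum>k<Suc m. ?G k * s ^ k) + ?D * (\<Sum>k<Suc m. real k * ?G k * s ^ (k - 1)) =
      (2 * \<mu> * (s - c) * (\<Sum>k<m. ?G k * s ^ k) + ?D * (\<Sum>k<m. real k * ?G k * s ^ (k - 1)))
       + (2 * \<mu> * (s - c) * s + ?D * real m) * ?G m * ?S"
    by (simp add: sm algebra_simps)
  also have "\<dots> = (real m - 1 + 2 * \<mu>) * ?G (m - 1) * (s * ?S) - real m * ?G m * ?S +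
      (2 * \<mu> * (s - c) * s + ?D * real m) * ?G m * ?S"
    by (simp only: step.IH sm)
  also have "\<dots> = (real m + 2 * \<mu>) * ?G m * (s * (s * ?S)) -
      (2 * (real m + \<mu>) * c * ?G m - (real m - 1 + 2 * \<mu>) * ?G (m - 1)) * (s * ?S)"
    by (simp add: algebra_simps power2_eq_square)
  also have "\<dots> = (real (Suc m) - 1 + 2 * \<mu>) * ?G (Suc m - 1) * s ^ Suc m - real (Suc m) * ?G (Suc m) * s ^ (Suc m - 1)"
    by (simp only: rec[symmetric]) (simp add: sm algebra_simps)
  finally show ?case .
qed

text \<open>The polynomials of index \<mu> + 1 are bounded by m (sin \<theta>)^(-2 \<mu>) up to a
  constant, in two regimes: for m sin \<theta> \<le> 1 the triangle inequality gives m^(1 + 2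
  \<mu>), otherwise summation by parts gives m^(2 \<mu>) / sin \<theta>. The factor 1 - cos
  \<theta>, at most (sin \<theta>)^2 when the cosine is nonnegative, contributes the remaining
  power.\<close>

lemma gegenbauer_step_difference_bound:
  assumes "0 < \<mu>" "\<mu> \<le> 1 / 2" "m \<ge> 1" "0 \<le> cos \<theta>" "0 < sin \<theta>"
  shows "\<bar>real m * gegenbauer \<mu> (cos \<theta>) m - (real m - 1 + 2 * \<mu>) * gegenbauer \<mu> (cos \<theta>) (m - 1)\<bar>
     \<le> 8 * \<mu> * (1 + \<mu>)\<^sup>2 * real m * sin \<theta> powr (2 - 2 * \<mu>)"
proof -
  obtain n where n: "m = Suc n" using assms by (cases m) auto
  define \<sigma> where "\<sigma> = sin \<theta>"
  have \<sigma>: "0 < \<sigma>" "\<sigma> \<le> 1" using assms by (auto simp: \<sigma>_def)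
  let ?K = "2 * (1 + \<mu>)\<^sup>2 * real m * \<sigma> powr (- 2 * \<mu>)"
  have B: "\<bar>gegenbauer (\<mu> + 1) (cos \<theta>) k\<bar> \<le> ?K" if k: "k \<le> n" for k
  proof -
    let ?a = "neg_binom (\<mu> + 1)"
    have "?a k \<le> ?a m" using assms k n by (intro neg_binom_add1_mono) auto
    also have "?a m \<le> (1 + \<mu>) * real m powr \<mu>" using assms by (intro neg_binom_add1_le_powr) auto
    finally have "?a k \<le> (1 + \<mu>) * real m powr \<mu>" .
    moreover have a_ge0: "0 \<le> ?a k" using assms by (intro neg_binom_nonneg) auto
    ultimately have "(?a k)\<^sup>2 \<le> ((1 + \<mu>) * real m powr \<mu>)\<^sup>2" by (intro power_mono) auto
    hence a2: "(?a k)\<^sup>2 \<le> (1 + \<mu>)\<^sup>2 * real m powr (2 * \<mu>)"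
      by (simp only: power_mult_distrib power2_eq_square[of "real m powr \<mu>"] powr_add[symmetric] mult_2)
    show ?thesis
    proof (cases "real m * \<sigma> \<le> 1")
      case True
      have "\<bar>gegenbauer (\<mu> + 1) (cos \<theta>) k\<bar> \<le> (\<Sum>j\<le>k. ?a j * ?a (k - j))"
        using abs_gegenbauer_le[of "\<mu> + 1" "cos \<theta>" k] assms by (simp add: neg_binom_convolution)
      also have "\<dots> \<le> (\<Sum>j\<le>k. ?a k * ?a k)"
        using assms by (intro sum_mono mult_mono neg_binom_add1_mono neg_binom_nonneg) auto
      also have "\<dots> \<le> real m * (?a k)\<^sup>2"
        using k n by (simp add: power2_eq_square mult_right_mono)
      also have "\<dots> \<le> real m * ((1 + \<mu>)\<^sup>2 * real m powr (2 * \<mu>))"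
        by (intro mult_left_mono a2) auto
      also have "\<dots> \<le> real m * ((1 + \<mu>)\<^sup>2 * \<sigma> powr (- 2 * \<mu>))"
      proof (intro mult_left_mono)
        have "real m powr (2 * \<mu>) \<le> (1 / \<sigma>) powr (2 * \<mu>)"
          using True \<sigma> assms by (intro powr_mono2) (auto simp: field_simps)
        also have "(1 / \<sigma>) powr (2 * \<mu>) = \<sigma> powr (- 2 * \<mu>)"
          using \<sigma> by (simp add: powr_minus powr_divide divide_simps)
        finally show "real m powr (2 * \<mu>) \<le> \<sigma> powr (- 2 * \<mu>)" .
      qed auto
      also have "\<dots> \<le> 2 * (real m * ((1 + \<mu>)\<^sup>2 * \<sigma> powr (- 2 * \<mu>)))"
        using \<sigma> by simp
      also have "\<dots> = ?K" by (simp only: mult_ac)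
      finally show ?thesis .
    next
      case False
      have "\<bar>gegenbauer (\<mu> + 1) (cos \<theta>) k\<bar> \<le> 2 * (?a k)\<^sup>2 / \<sigma>"
        unfolding \<sigma>_def using assms by (intro abs_gegenbauer_add1_le) auto
      also have "\<dots> \<le> 2 * ((1 + \<mu>)\<^sup>2 * real m powr (2 * \<mu>)) / \<sigma>"
        using a2 \<sigma> by (intro divide_right_mono mult_left_mono) auto
      also have "\<dots> \<le> 2 * ((1 + \<mu>)\<^sup>2 * (real m * (\<sigma> * \<sigma> powr (- 2 * \<mu>)))) / \<sigma>"
      proof -
        have "real m powr (2 * \<mu>) = real m * real m powr (2 * \<mu> - 1)"
          using assms by (simp add: powr_diff)
        \<comment> \<open>This uses \<mu> \<le> 1/2: the exponent is nonpositive, so the lower bound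
          1/\<sigma> < m yields an upper bound for the power.\<close>
        also have "\<dots> \<le> real m * (1 / \<sigma>) powr (2 * \<mu> - 1)"
          using False \<sigma> assms by (intro mult_left_mono powr_mono2') (auto simp: field_simps)
        also have "(1 / \<sigma>) powr (2 * \<mu> - 1) = \<sigma> * \<sigma> powr (- 2 * \<mu>)"
          using \<sigma> by (simp add: powr_diff powr_minus powr_divide divide_simps)
        finally show ?thesis
          using \<sigma> by (intro divide_right_mono mult_left_mono) auto
      qed
      also have "\<dots> = ?K" using \<sigma> by simp
      finally show ?thesis .
    qed
  qed
  have c1: "1 - cos \<theta> \<le> \<sigma>\<^sup>2"
  proof -
    have "1 - cos \<theta> \<le> (1 - cos \<theta>) * (1 + cos \<theta>)"
      using assms by (simp add: algebra_simps mult_left_le)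
    also have "\<dots> = \<sigma>\<^sup>2" by (simp add: \<sigma>_def sin_squared_eq algebra_simps power2_eq_square)
    finally show ?thesis .
  qed
  let ?T = "gegenbauer (\<mu> + 1) (cos \<theta>) n + (if n = 0 then 0 else gegenbauer (\<mu> + 1) (cos \<theta>) (n - 1))"
  have "real m * gegenbauer \<mu> (cos \<theta>) m - (real m - 1 + 2 * \<mu>) * gegenbauer \<mu> (cos \<theta>) (m - 1) =
      - (2 * \<mu> * (1 - cos \<theta>)) * ?T"
  proof -
    have r: "real m - 1 = real n" "m - 1 = n" by (simp_all add: n)
    show ?thesis unfolding r unfolding n by (rule gegenbauer_step_difference)
  qed
  hence "\<bar>real m * gegenbauer \<mu> (cos \<theta>) m - (real m - 1 + 2 * \<mu>) * gegenbauer \<mu> (cos \<theta>) (m - 1)\<bar> =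
     2 * \<mu> * (1 - cos \<theta>) * \<bar>?T\<bar>"
    using assms by (simp only: abs_mult abs_minus_cancel) simp
  also have "\<dots> \<le> 2 * \<mu> * (1 - cos \<theta>) * (2 * ?K)"
  proof (intro mult_left_mono)
    have "0 \<le> ?K" using B[of n] by linarith
    moreover have "\<bar>if n = 0 then 0 else gegenbauer (\<mu> + 1) (cos \<theta>) (n - 1)\<bar> \<le> ?K"
      using B[of "n - 1"] \<open>0 \<le> ?K\<close> by (cases "n = 0") (simp_all only: if_True if_False, simp_all)
    ultimately show "\<bar>?T\<bar> \<le> 2 * ?K" using B[of n] by linarith
  qed (use assms in auto)
  also have "\<dots> \<le> 2 * \<mu> * \<sigma>\<^sup>2 * (2 * ?K)"
    using assms c1 by (intro mult_right_mono mult_left_mono) auto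
  also have "\<dots> = 8 * \<mu> * (1 + \<mu>)\<^sup>2 * real m * \<sigma> powr (2 - 2 * \<mu>)"
  proof -
    have "\<sigma>\<^sup>2 * \<sigma> powr (- 2 * \<mu>) = \<sigma> powr (2 - 2 * \<mu>)"
      using \<sigma> by (simp add: powr_diff powr_minus divide_simps)
    from arg_cong[OF this, of "\<lambda>x. 8 * \<mu> * (1 + \<mu>)\<^sup>2 * real m * x"] show ?thesis by simp
  qed
  finally show ?thesis unfolding \<sigma>_def .
qed

section \<open>The remainder of the Gegenbauer expansion\<close>

text \<open>The majorant used below has a cusp at 1 and corners on either side of it, so
  differentiability is required only off a finite set; continuity across that set excludes downward
  jumps.\<close>

lemma nondecreasing_of_deriv_nonneg_finite_exceptions:
  fixes \<phi> :: "real \<Rightarrow> real"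
  assumes "finite S" "a \<le> b" "continuous_on {a..b} \<phi>"
    and "\<And>x. x \<in> {a<..<b} - S \<Longrightarrow> \<exists>d\<ge>0. (\<phi> has_real_derivative d) (at x)"
  shows "\<phi> a \<le> \<phi> b"
proof -
  obtain d where d: "\<And>x. x \<in> {a<..<b} - S \<Longrightarrow> d x \<ge> 0 \<and> (\<phi> has_real_derivative d x) (at x)"
    using assms(4) by metis
  define d' where "d' = (\<lambda>x. if x \<in> {a<..<b} - S then d x else 0)"
  have "(d' has_integral (\<phi> b - \<phi> a)) {a..b}"
  proof (rule fundamental_theorem_of_calculus_interior_strong[OF assms(1,2) _ assms(3)])
    fix x assume "x \<in> {a<..<b} - S"
    thus "(\<phi> has_vector_derivative d' x) (at x)"
      using d[of x] by (simp add: d'_def has_real_derivative_iff_has_vector_derivative)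
  qed
  moreover have "0 \<le> d' x" for x using d by (auto simp: d'_def)
  ultimately have "0 \<le> \<phi> b - \<phi> a" using has_integral_nonneg by blast
  thus ?thesis by simp
qed

text \<open>The singular factor at $1$ has mass of order $m^{-2\mu}$ on an interval of length $1/m$, and
  away from this interval it is at most of order $m^{1-2\mu}$; so both contributions are $O(\rho^m)$
  uniformly in $m$.\<close>

lemma abs_le_of_deriv_bound_near_one:
  fixes f :: "real \<Rightarrow> real"
  assumes \<mu>: "0 < \<mu>" "\<mu> \<le> 1 / 2" and "m \<ge> 1" "0 \<le> \<rho>" "0 \<le> C"
    and "f 0 = 0" and cont: "continuous_on {0..\<rho>} f"
    and deriv: "\<And>s. 0 < s \<Longrightarrow> s \<noteq> 1 \<Longrightarrow> \<exists>d. (f has_real_derivative d) (at s) \<and>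
           \<bar>d\<bar> \<le> C * (s ^ (m - 1) * (real m + real m powr (2 * \<mu>) * \<bar>1 - s\<bar> powr (2 * \<mu> - 1)))"
  shows "\<bar>f \<rho>\<bar> \<le> C * (3 + 2 / \<mu>) * \<rho> ^ m"
proof -
  \<comment> \<open>The scale is 1/m; the factor 1/2 gives \<open>\<delta> \<le> 1 / 2\<close>,
    hence s > 1/2 in the near zone, where a missing power of \<rho> then costs at most a factor
    2.\<close>
  define \<delta> where "\<delta> = 1 / (2 * real m)"
  have \<delta>: "\<delta> > 0" "\<delta> \<le> 1 / 2" using assms by (auto simp: \<delta>_def field_simps)
  \<comment> \<open>\<open>p\<close> and \<open>q\<close> are the distances to 1 from the right and
    from the left, truncated at \<open>\<delta>\<close>. They make \<open>g\<close> a continuous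
    primitive of |1 - s|^(2 \<mu> - 1) restricted to |1 - s| < \<delta>.\<close>
  define p where "p = (\<lambda>s::real. max 0 (min (s - 1) \<delta>))"
  define q where "q = (\<lambda>s::real. max 0 (min (1 - s) \<delta>))"
  define g where "g = (\<lambda>s. (p s powr (2 * \<mu>) - q s powr (2 * \<mu>)) / (2 * \<mu>))"
  \<comment> \<open>The derivative of \<open>h\<close> dominates that of \<open>f\<close> up to
    \<open>C\<close>. Outside the near zone the singular term is at most 2 m s^(m - 1), which
    together with the regular term explains the 3; inside it the factor 2 \<rho>^m bounds s^(m -
    1).\<close>
  define h where "h = (\<lambda>s. 3 * s ^ m + 2 * \<rho> ^ m * real m powr (2 * \<mu>) * g s)"
  define S where "S = {1, 1 - \<delta>, 1 + \<delta>}"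
  have "continuous_on UNIV p" "continuous_on UNIV q"
    unfolding p_def q_def by (auto intro!: continuous_intros)
  hence cont_g: "continuous_on UNIV g"
    unfolding g_def using \<mu> by (intro continuous_intros continuous_on_powr') (auto simp: p_def q_def)
  have cont_h: "continuous_on {0..\<rho>} h"
    unfolding h_def using continuous_on_subset[OF cont_g] by (intro continuous_intros) auto
  have dg: "(g has_real_derivative (if \<bar>s - 1\<bar> < \<delta> then \<bar>1 - s\<bar> powr (2 * \<mu> - 1) else 0)) (at s)"
    if s: "s \<notin> S" for s
  proof -
    consider "s > 1 + \<delta>" | "s < 1 - \<delta>" | "1 < s" "s < 1 + \<delta>" | "1 - \<delta> < s" "s < 1"
      using s unfolding S_def by fastforce
    thus ?thesis
    proof cases
      case 1
      have "((\<lambda>s. \<delta> powr (2 * \<mu>) / (2 * \<mu>)) has_real_derivative 0) (at s)" by auto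
      hence "(g has_real_derivative 0) (at s)"
        by (rule has_field_derivative_transform_within_open[where S = "{1+\<delta><..}"])
           (use 1 \<delta> in \<open>auto simp: g_def p_def q_def\<close>)
      thus ?thesis using 1 \<delta> by auto
    next
      case 2
      have "((\<lambda>s. - (\<delta> powr (2 * \<mu>)) / (2 * \<mu>)) has_real_derivative 0) (at s)" by auto
      hence "(g has_real_derivative 0) (at s)"
        by (rule has_field_derivative_transform_within_open[where S = "{..<1-\<delta>}"])
           (use 2 \<delta> in \<open>auto simp: g_def p_def q_def\<close>)
      thus ?thesis using 2 \<delta> by auto
    next
      case 3
      have "((\<lambda>s. (s - 1) powr (2 * \<mu>) / (2 * \<mu>)) has_real_derivative (s - 1) powr (2 * \<mu> - 1)) (at s)"
        using 3 \<mu> by (auto intro!: derivative_eq_intros)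
      hence "(g has_real_derivative (s - 1) powr (2 * \<mu> - 1)) (at s)"
        by (rule has_field_derivative_transform_within_open[where S = "{1<..<1+\<delta>}"])
           (use 3 \<delta> in \<open>auto simp: g_def p_def q_def\<close>)
      thus ?thesis using 3 by auto
    next
      case 4
      have "((\<lambda>s. - ((1 - s) powr (2 * \<mu>)) / (2 * \<mu>)) has_real_derivative (1 - s) powr (2 * \<mu> - 1)) (at s)"
        using 4 \<mu> by (auto intro!: derivative_eq_intros)
      hence "(g has_real_derivative (1 - s) powr (2 * \<mu> - 1)) (at s)"
        by (rule has_field_derivative_transform_within_open[where S = "{1-\<delta><..<1}"])
           (use 4 \<delta> in \<open>auto simp: g_def p_def q_def\<close>)
      thus ?thesis using 4 by auto
    qed
  qed
  have key: "\<exists>d e. (f has_real_derivative d) (at s) \<and> (h has_real_derivative e) (at s) \<and> \<bar>d\<bar> \<le> C * e"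
    if s: "s \<in> {0<..<\<rho>} - S" for s
  proof -
    obtain d where d: "(f has_real_derivative d) (at s)"
      "\<bar>d\<bar> \<le> C * (s ^ (m - 1) * (real m + real m powr (2 * \<mu>) * \<bar>1 - s\<bar> powr (2 * \<mu> - 1)))"
      using deriv[of s] s by (auto simp: S_def)
    define e where "e = 3 * (real m * s ^ (m - 1)) + 2 * \<rho> ^ m * real m powr (2 * \<mu>) *
        (if \<bar>s - 1\<bar> < \<delta> then \<bar>1 - s\<bar> powr (2 * \<mu> - 1) else 0)"
    have "(h has_real_derivative e) (at s)"
      unfolding h_def e_def using s by (auto intro!: derivative_eq_intros dg)
    moreover have "s ^ (m - 1) * (real m + real m powr (2 * \<mu>) * \<bar>1 - s\<bar> powr (2 * \<mu> - 1)) \<le> e"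
    proof (cases "\<bar>s - 1\<bar> < \<delta>")
      case True
      hence "s > 1 / 2" using \<delta> by linarith
      have "s ^ (m - 1) \<le> \<rho> ^ (m - 1)" using s by (intro power_mono) auto
      also have "\<rho> ^ (m - 1) \<le> 2 * \<rho> * \<rho> ^ (m - 1)"
        using s \<open>s > 1 / 2\<close> by (simp add: mult_right_mono)
      also have "\<dots> = 2 * \<rho> ^ m" using assms(3) by (cases m) auto
      finally have "s ^ (m - 1) * (real m powr (2 * \<mu>) * \<bar>1 - s\<bar> powr (2 * \<mu> - 1)) \<le>
         2 * \<rho> ^ m * (real m powr (2 * \<mu>) * \<bar>1 - s\<bar> powr (2 * \<mu> - 1))"
        by (intro mult_right_mono) auto
      moreover have "0 \<le> real m * s ^ (m - 1)" using s by simp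
      ultimately show ?thesis using True by (simp add: e_def algebra_simps)
    next
      case False
      have "real m powr (2 * \<mu>) * \<bar>1 - s\<bar> powr (2 * \<mu> - 1) \<le> real m powr (2 * \<mu>) * \<delta> powr (2 * \<mu> - 1)"
        using False \<delta> \<mu> by (intro mult_left_mono powr_mono2') auto
      also have "\<dots> = real m powr (2 * \<mu>) * (2 * real m) powr (1 - 2 * \<mu>)"
        using \<mu> by (simp add: \<delta>_def powr_divide powr_diff powr_minus divide_simps)
      also have "\<dots> = real m * 2 powr (1 - 2 * \<mu>)"
        using assms(3) by (simp add: powr_mult powr_diff divide_simps)
      also have "\<dots> \<le> real m * 2 powr 1"
        using \<mu> by (intro mult_left_mono powr_mono) auto
      finally have "real m + real m powr (2 * \<mu>) * \<bar>1 - s\<bar> powr (2 * \<mu> - 1) \<le> 3 * real m" by simp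
      from mult_left_mono[OF this, of "s ^ (m - 1)"] show ?thesis
        using False s by (simp add: e_def algebra_simps)
    qed
    from mult_left_mono[OF this assms(5)] have "\<bar>d\<bar> \<le> C * e" using d(2) by linarith
    ultimately show ?thesis using d(1) by blast
  qed
  have fin: "finite S" by (simp add: S_def)
  \<comment> \<open>\<open>\<epsilon>\<close> is a sign: the two instances bound \<open>f\<close>
    from above and from below.\<close>
  have mono: "C * h 0 + \<epsilon> * f 0 \<le> C * h \<rho> + \<epsilon> * f \<rho>" if \<epsilon>: "\<bar>\<epsilon>\<bar> = 1" for \<epsilon>
  proof (rule nondecreasing_of_deriv_nonneg_finite_exceptions[OF fin assms(4), of "\<lambda>s. C * h s + \<epsilon> * f s"])
    show "continuous_on {0..\<rho>} (\<lambda>s. C * h s + \<epsilon> * f s)"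
      by (intro continuous_intros cont cont_h)
    fix s assume "s \<in> {0<..<\<rho>} - S"
    then obtain d e where de: "(f has_real_derivative d) (at s)" "(h has_real_derivative e) (at s)" "\<bar>d\<bar> \<le> C * e"
      using key by blast
    have "((\<lambda>s. C * h s + \<epsilon> * f s) has_real_derivative C * e + \<epsilon> * d) (at s)"
      by (intro DERIV_add DERIV_cmult de)
    moreover have "\<bar>\<epsilon> * d\<bar> \<le> C * e" using de(3) \<epsilon> by (simp add: abs_mult)
    hence "0 \<le> C * e + \<epsilon> * d" by linarith
    ultimately show "\<exists>d\<ge>0. ((\<lambda>s. C * h s + \<epsilon> * f s) has_real_derivative d) (at s)" by blast
  qed
  have "\<bar>f \<rho>\<bar> \<le> C * (h \<rho> - h 0)"
    using mono[of 1] mono[of "-1"] assms(6) by (simp add: right_diff_distrib)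
  also have "h \<rho> - h 0 \<le> (3 + 2 / \<mu>) * \<rho> ^ m"
  proof -
    have pq: "0 \<le> p s" "p s \<le> \<delta>" "0 \<le> q s" "q s \<le> \<delta>" for s using \<delta> by (auto simp: p_def q_def)
    have "p \<rho> powr (2 * \<mu>) \<le> \<delta> powr (2 * \<mu>)" "q 0 powr (2 * \<mu>) \<le> \<delta> powr (2 * \<mu>)"
      using pq \<mu> by (auto intro!: powr_mono2)
    moreover have "0 \<le> q \<rho> powr (2 * \<mu>)" "0 \<le> p 0 powr (2 * \<mu>)" by auto
    ultimately have "p \<rho> powr (2 * \<mu>) - q \<rho> powr (2 * \<mu>) - (p 0 powr (2 * \<mu>) - q 0 powr (2 * \<mu>)) \<le> 2 * \<delta> powr (2 * \<mu>)"
      by linarith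
    hence "g \<rho> - g 0 \<le> 2 * \<delta> powr (2 * \<mu>) / (2 * \<mu>)"
      using \<mu> unfolding g_def diff_divide_distrib[symmetric] by (intro divide_right_mono) auto
    hence "real m powr (2 * \<mu>) * (g \<rho> - g 0) \<le> real m powr (2 * \<mu>) * (2 * \<delta> powr (2 * \<mu>) / (2 * \<mu>))"
      by (intro mult_left_mono) auto
    also have "\<dots> = (real m * \<delta>) powr (2 * \<mu>) / \<mu>"
      using \<delta> by (simp add: powr_mult)
    also have "\<dots> \<le> 1 powr (2 * \<mu>) / \<mu>"
      using assms(3) \<mu> by (intro divide_right_mono powr_mono2) (auto simp: \<delta>_def)
    finally have "real m powr (2 * \<mu>) * (g \<rho> - g 0) \<le> 1 / \<mu>"
      using \<mu> by (simp add: divide_right_mono)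
    from mult_left_mono[OF this, of "2 * \<rho> ^ m"] show ?thesis
      using assms(3,4) by (simp add: h_def algebra_simps power_0_left)
  qed
  finally show ?thesis using assms(5) by (simp add: mult_left_mono mult.assoc)
qed

text \<open>Differentiate in $\rho$: by the three-term recurrence the derivative of the remainder only involves
  the last two Gegenbauer polynomials.\<close>

lemma gegenbauer_remainder_cos:
  assumes \<mu>: "0 < \<mu>" "\<mu> \<le> 1 / 2" and m: "m \<ge> 1" and \<rho>: "0 \<le> \<rho>" and sin: "0 < sin \<theta>"
  shows "\<bar>1 - (1 - 2 * \<rho> * cos \<theta> + \<rho>\<^sup>2) powr \<mu> * (\<Sum>k<m. gegenbauer \<mu> (cos \<theta>) k * \<rho> ^ k)\<bar>
     \<le> 20 * (3 + 2 / \<mu>) * \<rho> ^ m"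
proof -
  define c where "c = cos \<theta>"
  define \<sigma> where "\<sigma> = sin \<theta>"
  define D where "D = (\<lambda>s. 1 - 2 * s * c + s\<^sup>2)"
  define S where "S = (\<lambda>s. \<Sum>k<m. gegenbauer \<mu> c k * s ^ k)"
  define S' where "S' = (\<lambda>s. \<Sum>k<m. real k * gegenbauer \<mu> c k * s ^ (k - 1))"
  define f where "f = (\<lambda>s. 1 - D s powr \<mu> * S s)"
  define F where "F = (real m - 1 + 2 * \<mu>) * gegenbauer \<mu> c (m - 1)"
  \<comment> \<open>The derivative of the remainder will contain E + (1 - s) F. Here
    \<open>F\<close> is of order m^(2 \<mu>) but comes with 1 - s, while \<open>E\<close> has no
    such factor and must be small through the cancellation in
    \<open>gegenbauer_step_difference_bound\<close>.\<close>
  define E where "E = real m * gegenbauer \<mu> c m - F"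
  have c1: "\<bar>c\<bar> \<le> 1" by (simp add: c_def)
  have c\<sigma>: "c\<^sup>2 + \<sigma>\<^sup>2 = 1" by (simp add: c_def \<sigma>_def)
  have D_eq1: "D s = (s - c)\<^sup>2 + \<sigma>\<^sup>2" for s
    using c\<sigma> by (simp add: D_def power2_eq_square algebra_simps)
  have D_eq2: "D s = (1 - s)\<^sup>2 + 2 * s * (1 - c)" for s
    by (simp add: D_def power2_eq_square algebra_simps)
  have D_pos: "D s > 0" for s
    using sin unfolding D_eq1 \<sigma>_def by (simp add: add_nonneg_pos)
  have F_bound: "\<bar>F\<bar> \<le> 4 * real m powr (2 * \<mu>)"
  proof -
    obtain n where n: "m = Suc n" using m by (cases m) auto
    have "\<bar>F\<bar> = (real n + 2 * \<mu>) * \<bar>gegenbauer \<mu> c n\<bar>"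
      using \<mu> by (simp add: F_def n abs_mult)
    also have "\<dots> \<le> (real n + 2 * \<mu>) * neg_binom (2 * \<mu>) n"
      using \<mu> c1 by (intro mult_left_mono abs_gegenbauer_le) auto
    also have "\<dots> = 2 * \<mu> * neg_binom (2 * \<mu> + 1) n"
      using neg_binom_Suc[of n "2 * \<mu>"] neg_binom_rec[of n "2 * \<mu>"] by (simp add: add.commute)
    also have "\<dots> \<le> 1 * neg_binom (2 * \<mu> + 1) m"
      using \<mu> n by (intro mult_mono neg_binom_add1_mono neg_binom_nonneg) auto
    also have "\<dots> \<le> (1 + 2 * \<mu>) * real m powr (2 * \<mu>)"
      using neg_binom_add1_le_powr[of "2 * \<mu>" m] \<mu> m by simp
    also have "\<dots> \<le> 4 * real m powr (2 * \<mu>)"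
      using \<mu> by (intro mult_right_mono) auto
    finally show ?thesis .
  qed
  \<comment> \<open>For c \<ge> 0 the lower bound D \<ge> \<sigma>^2 produces \<sigma>^(2 \<mu> -
    2), exactly cancelling the power of sin \<theta> in the bound for \<open>E\<close>. For c < 0
    there is no singularity: D \<ge> 1 and the polynomials are bounded by 1.\<close>
  have E_bound: "\<bar>E\<bar> * D s powr (\<mu> - 1) \<le> 20 * real m" if s: "s > 0" for s
  proof (cases "c \<ge> 0")
    case True
    have "D s powr (\<mu> - 1) \<le> (\<sigma>\<^sup>2) powr (\<mu> - 1)"
      using \<mu> sin by (intro powr_mono2') (auto simp: D_eq1 \<sigma>_def)
    also have "\<dots> = \<sigma> powr (2 * \<mu> - 2)"
      using sin by (simp add: \<sigma>_def powr_powr flip: powr_numeral)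
    finally have "\<bar>E\<bar> * D s powr (\<mu> - 1) \<le>
      (8 * \<mu> * (1 + \<mu>)\<^sup>2 * real m * \<sigma> powr (2 - 2 * \<mu>)) * \<sigma> powr (2 * \<mu> - 2)"
      using gegenbauer_step_difference_bound[OF \<mu> m _ sin] True \<mu>
      by (intro mult_mono) (auto simp: E_def F_def c_def \<sigma>_def)
    also have "\<dots> = 8 * \<mu> * (1 + \<mu>)\<^sup>2 * real m"
      using sin by (simp add: \<sigma>_def powr_add[symmetric] mult.assoc)
    also have "\<dots> \<le> 20 * real m"
    proof (intro mult_right_mono)
      have "\<mu> * (1 + \<mu>)\<^sup>2 \<le> (1/2) * (1 + 1/2)\<^sup>2"
        using \<mu> by (intro mult_mono power_mono) auto
      thus "8 * \<mu> * (1 + \<mu>)\<^sup>2 \<le> 20" by (simp add: power2_eq_square)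
    qed auto
    finally show ?thesis .
  next
    case False
    have "0 \<le> s * (- c)" using False s by (intro mult_nonneg_nonneg) auto
    hence "2 * s * c \<le> 0" by (simp add: mult.commute)
    hence "D s \<ge> 1" using zero_le_power2[of s] unfolding D_def by linarith
    hence "D s powr (\<mu> - 1) \<le> 1 powr (\<mu> - 1)"
      using \<mu> by (intro powr_mono2') auto
    hence D1: "D s powr (\<mu> - 1) \<le> 1" by simp
    have G: "\<bar>gegenbauer \<mu> c k\<bar> \<le> 1" for k
      using abs_gegenbauer_le[of \<mu> c k] neg_binom_le_1[of "2 * \<mu>" k] \<mu> c1 by linarith
    have "\<bar>E\<bar> \<le> real m * \<bar>gegenbauer \<mu> c m\<bar> + (real m - 1 + 2 * \<mu>) * \<bar>gegenbauer \<mu> c (m - 1)\<bar>"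
      unfolding E_def F_def using \<mu> m by (intro order.trans[OF abs_triangle_ineq4]) (simp add: abs_mult)
    also have "\<dots> \<le> real m * 1 + real m * 1"
      using \<mu> m by (intro add_mono mult_mono G) auto
    finally have "\<bar>E\<bar> * D s powr (\<mu> - 1) \<le> (2 * real m) * 1"
      using D1 by (intro mult_mono) auto
    thus ?thesis by simp
  qed
  have deriv: "(f has_real_derivative D s powr (\<mu> - 1) * s ^ (m - 1) * (E + (1 - s) * F)) (at s)" for s
  proof -
    have dD: "(D has_real_derivative 2 * (s - c)) (at s)"
      unfolding D_def by (auto intro!: derivative_eq_intros)
    have dS: "(S has_real_derivative S' s) (at s)"
      unfolding S_def S'_def by (auto intro!: derivative_eq_intros sum.cong simp: mult_ac)
    have "((\<lambda>s. D s powr \<mu>) has_real_derivative \<mu> * D s powr (\<mu> - 1) * (2 * (s - c))) (at s)"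
      using DERIV_fun_powr[OF dD D_pos, of \<mu>] by simp
    hence "(f has_real_derivative 0 - (\<mu> * D s powr (\<mu> - 1) * (2 * (s - c)) * S s + S' s * D s powr \<mu>)) (at s)"
      unfolding f_def by (intro DERIV_diff DERIV_const DERIV_mult dS)
    also have "D s powr \<mu> = D s powr (\<mu> - 1) * D s"
      using D_pos[of s] by (simp add: powr_diff)
    also have "0 - (\<mu> * D s powr (\<mu> - 1) * (2 * (s - c)) * S s + S' s * (D s powr (\<mu> - 1) * D s)) =
        - (D s powr (\<mu> - 1) * (2 * \<mu> * (s - c) * S s + D s * S' s))"
      by (simp add: algebra_simps)
    also have "2 * \<mu> * (s - c) * S s + D s * S' s = F * s ^ m - real m * gegenbauer \<mu> c m * s ^ (m - 1)"
      unfolding S_def S'_def D_def F_def by (rule gegenbauer_partial_sum_deriv[OF m])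
    also have "- (D s powr (\<mu> - 1) * (F * s ^ m - real m * gegenbauer \<mu> c m * s ^ (m - 1))) =
        D s powr (\<mu> - 1) * s ^ (m - 1) * (E + (1 - s) * F)"
      using m by (cases m) (simp_all add: E_def algebra_simps del: gegenbauer.simps)
    finally show ?thesis .
  qed
  \<comment> \<open>The 20 is a round common majorant: 8 \<mu> (1 + \<mu>)^2 is at most 9, the case
    c < 0 gives 2, and \<open>F\<close> carries 4.\<close>
  have "\<bar>f \<rho>\<bar> \<le> 20 * (3 + 2 / \<mu>) * \<rho> ^ m"
  proof (rule abs_le_of_deriv_bound_near_one[OF \<mu> m \<rho>])
    show "f 0 = 0"
    proof -
      have "S 0 = (\<Sum>k\<in>{0}. gegenbauer \<mu> c k * 0 ^ k)"
        unfolding S_def using m by (intro sum.mono_neutral_right) (auto simp: power_0_left)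
      thus ?thesis by (simp add: f_def D_def)
    qed
    show "continuous_on {0..\<rho>} f"
      using deriv by (intro continuous_at_imp_continuous_on ballI) (blast intro: DERIV_isCont)
    fix s :: real assume s: "0 < s" "s \<noteq> 1"
    let ?d = "D s powr (\<mu> - 1) * s ^ (m - 1) * (E + (1 - s) * F)"
    have Ds: "D s powr (\<mu> - 1) \<le> \<bar>1 - s\<bar> powr (2 * \<mu> - 2)"
    proof -
      have "(1 - s)\<^sup>2 \<le> D s" unfolding D_eq2 using s c1 by simp
      hence "D s powr (\<mu> - 1) \<le> ((1 - s)\<^sup>2) powr (\<mu> - 1)"
        using s \<mu> by (intro powr_mono2') auto
      also have "((1 - s)\<^sup>2) powr (\<mu> - 1) = (\<bar>1 - s\<bar> powr 2) powr (\<mu> - 1)" using s by simp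
      also have "\<dots> = \<bar>1 - s\<bar> powr (2 * \<mu> - 2)" by (simp only: powr_powr right_diff_distrib mult_1_right)
      finally show ?thesis .
    qed
    have "\<bar>?d\<bar> = s ^ (m - 1) * (D s powr (\<mu> - 1) * \<bar>E + (1 - s) * F\<bar>)"
      using s by (simp add: abs_mult)
    also have "\<dots> \<le> s ^ (m - 1) * (20 * real m + \<bar>1 - s\<bar> powr (2 * \<mu> - 1) * (4 * real m powr (2 * \<mu>)))"
    proof (intro mult_left_mono)
      have "D s powr (\<mu> - 1) * \<bar>E + (1 - s) * F\<bar> \<le> D s powr (\<mu> - 1) * (\<bar>E\<bar> + \<bar>1 - s\<bar> * \<bar>F\<bar>)"
        using abs_triangle_ineq[of E "(1 - s) * F"] by (intro mult_left_mono) (auto simp: abs_mult)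
      also have "\<dots> = \<bar>E\<bar> * D s powr (\<mu> - 1) + (D s powr (\<mu> - 1) * \<bar>1 - s\<bar>) * \<bar>F\<bar>"
        by (simp add: algebra_simps)
      also have "\<dots> \<le> 20 * real m + (\<bar>1 - s\<bar> powr (2 * \<mu> - 2) * \<bar>1 - s\<bar>) * (4 * real m powr (2 * \<mu>))"
        by (intro add_mono mult_mono E_bound s F_bound Ds) auto
      also have "\<bar>1 - s\<bar> powr (2 * \<mu> - 2) * \<bar>1 - s\<bar> = \<bar>1 - s\<bar> powr (2 * \<mu> - 1)"
        using s powr_add[of "\<bar>1 - s\<bar>" "2 * \<mu> - 2" 1] by simp
      finally show "D s powr (\<mu> - 1) * \<bar>E + (1 - s) * F\<bar> \<le> 
          20 * real m + \<bar>1 - s\<bar> powr (2 * \<mu> - 1) * (4 * real m powr (2 * \<mu>))" .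
    qed (use s in auto)
    also have "\<dots> \<le> s ^ (m - 1) * (20 * real m + 20 * (real m powr (2 * \<mu>) * \<bar>1 - s\<bar> powr (2 * \<mu> - 1)))"
      using s by (intro mult_left_mono add_left_mono) (auto simp: mult.commute)
    also have "\<dots> = 20 * (s ^ (m - 1) * (real m + real m powr (2 * \<mu>) * \<bar>1 - s\<bar> powr (2 * \<mu> - 1)))"
      by (simp add: algebra_simps)
    finally show "\<exists>d. (f has_real_derivative d) (at s) \<and>
           \<bar>d\<bar> \<le> 20 * (s ^ (m - 1) * (real m + real m powr (2 * \<mu>) * \<bar>1 - s\<bar> powr (2 * \<mu> - 1)))"
      using deriv by blast
  qed auto
  thus ?thesis by (simp add: f_def D_def S_def c_def)
qed

lemma continuous_on_gegenbauer: "continuous_on UNIV (\<lambda>c. gegenbauer \<mu> c k)"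
proof (induction k rule: induct_nat_012)
  case (ge2 n)
  thus ?case by (auto intro!: continuous_intros)
qed (auto intro!: continuous_intros)

lemma borel_measurable_gegenbauer [measurable]:
  "(\<lambda>c. gegenbauer \<mu> c k) \<in> borel_measurable borel"
  by (rule borel_measurable_continuous_onI) (rule continuous_on_gegenbauer)

text \<open>The trigonometric version excludes c = 1 and c = -1, where sin \<theta> = 0. Its
  constant does not depend on \<theta> and the left side is continuous in c, so the estimate passes
  to the closed interval.\<close>

lemma gegenbauer_remainder:
  assumes \<mu>: "0 < \<mu>" "\<mu> \<le> 1 / 2" and \<rho>: "0 \<le> \<rho>" and c: "\<bar>c\<bar> \<le> 1"
  shows "\<bar>1 - (1 - 2 * \<rho> * c + \<rho>\<^sup>2) powr \<mu> * (\<Sum>k<m. gegenbauer \<mu> c k * \<rho> ^ k)\<bar>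
     \<le> 20 * (3 + 2 / \<mu>) * \<rho> ^ m"
proof (cases "m = 0")
  case True
  have "1 \<le> 20 * (3 + 2 / \<mu>)" using \<mu> by (simp add: field_simps)
  thus ?thesis using True by simp
next
  case False
  let ?f = "\<lambda>c. \<bar>1 - (1 - 2 * \<rho> * c + \<rho>\<^sup>2) powr \<mu> * (\<Sum>k<m. gegenbauer \<mu> c k * \<rho> ^ k)\<bar>"
  have nonneg: "0 \<le> 1 - 2 * \<rho> * c + \<rho>\<^sup>2" if "\<bar>c\<bar> \<le> 1" for c
  proof -
    have "0 \<le> (1 - \<rho>)\<^sup>2 + 2 * \<rho> * (1 - c)" using that \<rho> by (intro add_nonneg_nonneg) auto
    thus ?thesis by (simp add: power2_eq_square algebra_simps)
  qed
  have cont: "continuous_on {-1..1} ?f"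
    using \<mu> nonneg by (intro continuous_intros continuous_on_powr'
        continuous_on_subset[OF continuous_on_gegenbauer]) auto
  have "?f c \<le> 20 * (3 + 2 / \<mu>) * \<rho> ^ m"
  proof (rule continuous_le_on_closure[where f = ?f and S = "{-1<..<1}"])
    show "continuous_on (closure {-1<..<1}) ?f" using cont by simp
    show "c \<in> closure {-1<..<1}" using c by auto
    fix x :: real assume x: "x \<in> {-1<..<1}"
    hence "sin (arccos x) > 0" using arccos_lt_bounded[of x] by (intro sin_gt_zero) auto
    from gegenbauer_remainder_cos[OF \<mu> _ \<rho> this, of m] show "?f x \<le> 20 * (3 + 2 / \<mu>) * \<rho> ^ m"
      using x False by simp
  qed
  thus ?thesis .
qed

section \<open>Gaussians as test functions\<close>

text \<open>The inductive form gives polynomial growth and closure under partial derivatives by rule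
  induction. Every iterated partial derivative of a Gaussian is such a map times the same
  Gaussian.\<close>

inductive_set polynomial_maps :: "(real ^ 'n \<Rightarrow> complex) set" where
  const: "(\<lambda>x. c) \<in> polynomial_maps"
| coord: "(\<lambda>x. of_real (x $ i)) \<in> polynomial_maps"
| add: "p \<in> polynomial_maps \<Longrightarrow> q \<in> polynomial_maps \<Longrightarrow> (\<lambda>x. p x + q x) \<in> polynomial_maps"
| mult: "p \<in> polynomial_maps \<Longrightarrow> q \<in> polynomial_maps \<Longrightarrow> (\<lambda>x. p x * q x) \<in> polynomial_maps"

lemma polynomial_maps_bound:
  fixes p :: "real ^ 'n \<Rightarrow> complex"
  assumes "p \<in> polynomial_maps"
  shows "\<exists>C k. 0 \<le> C \<and> (\<forall>x. norm (p x) \<le> C * (1 + norm x) ^ k)"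
  using assms
proof induction
  case (const c)
  show ?case by (intro exI[of _ "norm c"] exI[of _ 0]) auto
next
  case (coord i)
  have "\<bar>x $ i\<bar> \<le> 1 * (1 + norm x) ^ 1" for x :: "real ^ 'n"
    using component_le_norm_cart[of x i] norm_ge_zero[of x] by (simp del: norm_ge_zero)
  thus ?case by (intro exI[of _ 1] exI[of _ "1::nat"]) auto
next
  case (add p q)
  then obtain C k D l where *: "0 \<le> C" "\<And>x. norm (p x) \<le> C * (1 + norm x) ^ k"
    "0 \<le> D" "\<And>x. norm (q x) \<le> D * (1 + norm x) ^ l" by blast
  have "norm (p x + q x) \<le> (C + D) * (1 + norm x) ^ (k + l)" for x
  proof -
    have "norm (p x + q x) \<le> C * (1 + norm x) ^ k + D * (1 + norm x) ^ l"
      using *(2)[of x] *(4)[of x] norm_triangle_ineq[of "p x" "q x"] by linarith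
    also have "\<dots> \<le> C * (1 + norm x) ^ (k + l) + D * (1 + norm x) ^ (k + l)"
      using * by (intro add_mono mult_left_mono power_increasing) auto
    finally show ?thesis by (simp add: distrib_right)
  qed
  thus ?case using * by (intro exI[of _ "C + D"] exI[of _ "k + l"]) auto
next
  case (mult p q)
  then obtain C k D l where *: "0 \<le> C" "\<And>x. norm (p x) \<le> C * (1 + norm x) ^ k"
    "0 \<le> D" "\<And>x. norm (q x) \<le> D * (1 + norm x) ^ l" by blast
  have "norm (p x * q x) \<le> (C * D) * (1 + norm x) ^ (k + l)" for x
  proof -
    have "norm (p x * q x) \<le> (C * (1 + norm x) ^ k) * (D * (1 + norm x) ^ l)"
      unfolding norm_mult using * by (intro mult_mono) auto
    thus ?thesis by (simp add: power_add mult_ac)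
  qed
  thus ?case using * by (intro exI[of _ "C * D"] exI[of _ "k + l"]) auto
qed

lemma polynomial_maps_derivative:
  fixes p :: "real ^ 'n \<Rightarrow> complex"
  assumes "p \<in> polynomial_maps"
  shows "\<exists>P. (\<forall>x. (p has_derivative P x) (at x)) \<and> (\<forall>i. (\<lambda>x. P x (axis i 1)) \<in> polynomial_maps)"
  using assms
proof induction
  case (const c)
  show ?case by (intro exI[of _ "\<lambda>_ _. 0"]) (auto intro: polynomial_maps.const)
next
  case (coord i)
  have "((\<lambda>x. complex_of_real (x $ i)) has_derivative (\<lambda>h. of_real (h $ i))) (at x)" for x :: "real ^ 'n"
    by (intro bounded_linear_imp_has_derivative bounded_linear_compose[OF bounded_linear_of_real bounded_linear_vec_nth])
  thus ?case by (intro exI[of _ "\<lambda>x h. of_real (h $ i)"]) (auto intro: polynomial_maps.const)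
next
  case (add p q)
  then obtain P Q where *: "\<And>x. (p has_derivative P x) (at x)" "\<And>i. (\<lambda>x. P x (axis i 1)) \<in> polynomial_maps"
    "\<And>x. (q has_derivative Q x) (at x)" "\<And>i. (\<lambda>x. Q x (axis i 1)) \<in> polynomial_maps" by blast
  show ?case
    by (intro exI[of _ "\<lambda>x h. P x h + Q x h"] conjI allI has_derivative_add * polynomial_maps.add)
next
  case (mult p q)
  then obtain P Q where *: "\<And>x. (p has_derivative P x) (at x)" "\<And>i. (\<lambda>x. P x (axis i 1)) \<in> polynomial_maps"
    "\<And>x. (q has_derivative Q x) (at x)" "\<And>i. (\<lambda>x. Q x (axis i 1)) \<in> polynomial_maps" by blast
  show ?case
    by (intro exI[of _ "\<lambda>x h. p x * Q x h + P x h * q x"] conjI allI has_derivative_mult *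
        polynomial_maps.add polynomial_maps.mult mult.hyps)
qed

text \<open>The Schwartz function whose Fourier transform is the heat kernel at time t centred at a
  (\<open>fourier_modulated_gaussian\<close>). Testing a distribution's Fourier transform against it
  therefore evaluates a heat flow at a.\<close>

definition modulated_gaussian :: "real \<Rightarrow> real ^ 'n \<Rightarrow> real ^ 'n \<Rightarrow> complex" where
  "modulated_gaussian t a x = exp (of_real (- (pi * t * (norm x)\<^sup>2)) + of_real (2 * pi * (a \<bullet> x)) * \<i>)"

lemma norm_modulated_gaussian: "norm (modulated_gaussian t a x) = exp (- (pi * t * (norm x)\<^sup>2))"
  by (simp add: modulated_gaussian_def)

lemma has_derivative_polynomial_times_gaussian:
  fixes p :: "real ^ 'n \<Rightarrow> complex"
  assumes "p \<in> polynomial_maps"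
  shows "\<exists>D. (\<forall>x. ((\<lambda>x. p x * modulated_gaussian t a x) has_derivative D x) (at x)) \<and>
     (\<forall>i. \<exists>q\<in>polynomial_maps. \<forall>x. D x (axis i 1) = q x * modulated_gaussian t a x)"
proof -
  obtain P where P: "\<And>x. (p has_derivative P x) (at x)" "\<And>i. (\<lambda>x. P x (axis i 1)) \<in> polynomial_maps"
    using polynomial_maps_derivative[OF assms] by blast
  define e where "e = (\<lambda>x. complex_of_real (- (pi * t * (x \<bullet> x))) + of_real (2 * pi * (a \<bullet> x)) * \<i>)"
  define L where "L = (\<lambda>x h. complex_of_real (- (pi * t * (2 * (x \<bullet> h)))) + of_real (2 * pi * (a \<bullet> h)) * \<i>)"
  have "(e has_derivative L x) (at x)" for x
    unfolding e_def L_def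
    by (rule has_derivative_eq_rhs, (rule derivative_intros refl)+) (auto simp: inner_commute algebra_simps)
  hence "((\<lambda>x. exp (e x)) has_derivative (\<lambda>h. exp (e x) * L x h)) (at x)" for x
    by (rule has_derivative_compose[OF _ DERIV_exp[unfolded has_field_derivative_def]])
  moreover have "modulated_gaussian t a = (\<lambda>x. exp (e x))"
    by (simp add: fun_eq_iff modulated_gaussian_def e_def power2_norm_eq_inner)
  ultimately have G: "(modulated_gaussian t a has_derivative (\<lambda>h. modulated_gaussian t a x * L x h)) (at x)" for x
    by simp
  have lin: "(\<lambda>x. L x (axis i 1)) \<in> polynomial_maps" for i
  proof -
    have "(\<lambda>x. of_real (- (2 * pi * t)) * of_real (x $ i) + of_real (2 * pi * (a $ i)) * \<i>) \<in> polynomial_maps"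
      by (intro polynomial_maps.intros)
    thus ?thesis by (simp add: L_def inner_axis mult_ac)
  qed
  let ?D = "\<lambda>x h. p x * (modulated_gaussian t a x * L x h) + P x h * modulated_gaussian t a x"
  have "((\<lambda>x. p x * modulated_gaussian t a x) has_derivative ?D x) (at x)" for x
    by (intro has_derivative_mult P G)
  moreover have "\<exists>q\<in>polynomial_maps. \<forall>x. ?D x (axis i 1) = q x * modulated_gaussian t a x" for i
    by (rule bexI[of _ "\<lambda>x. p x * L x (axis i 1) + P x (axis i 1)"])
       (auto intro!: polynomial_maps.intros lin P assms simp: algebra_simps)
  ultimately show ?thesis by (intro exI[of _ ?D] conjI allI)
qed

lemma iterated_partial_modulated_gaussian:
  "\<exists>p\<in>polynomial_maps. iterated_partial is (modulated_gaussian t a) = (\<lambda>x. p x * modulated_gaussian t a x)"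
proof (induction "is")
  case Nil
  show ?case by (intro bexI[of _ "\<lambda>x. 1"]) (auto simp: iterated_partial_def intro: polynomial_maps.const)
next
  case (Cons i "is")
  then obtain p where p: "p \<in> polynomial_maps"
    "iterated_partial is (modulated_gaussian t a) = (\<lambda>x. p x * modulated_gaussian t a x)" by blast
  obtain D where D: "\<And>x. ((\<lambda>x. p x * modulated_gaussian t a x) has_derivative D x) (at x)"
     "\<And>i. \<exists>q\<in>polynomial_maps. \<forall>x. D x (axis i 1) = q x * modulated_gaussian t a x"
    using has_derivative_polynomial_times_gaussian[OF p(1), of t a] by blast
  have "iterated_partial (i # is) (modulated_gaussian t a) = (\<lambda>x. D x (axis i 1))"
  proof -
    have "iterated_partial (i # is) (modulated_gaussian t a) = partial_deriv i (iterated_partial is (modulated_gaussian t a))"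
      by (simp add: iterated_partial_def)
    also have "\<dots> = (\<lambda>x. D x (axis i 1))"
      unfolding p(2) partial_deriv_def frechet_derivative_at[OF D(1), symmetric] ..
    finally show ?thesis .
  qed
  thus ?case using D(2)[of i] by (metis (no_types, lifting) ext)
qed

text \<open>The inequality (1 + x/n)^n \<le> exp x replaces the power by a multiple of exp (1 + r),
  and completing the square bounds r - a r^2 by 1/(4 a).\<close>

lemma power_times_gaussian_bounded:
  fixes a r :: real
  assumes "a > 0" "r \<ge> 0" 
  shows "(1 + r) ^ k * exp (- (a * r\<^sup>2)) \<le> real (Suc k) ^ Suc k * exp (1 + 1 / (4 * a))"
proof -
  let ?n = "Suc k"
  have "(1 + r) ^ k \<le> (1 + r) ^ ?n" using assms by (intro power_increasing) auto
  also have "\<dots> = real ?n ^ ?n * ((1 + r) / real ?n) ^ ?n"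
    by (simp add: power_divide del: power_Suc of_nat_Suc)
  also have "\<dots> \<le> real ?n ^ ?n * (1 + (1 + r) / real ?n) ^ ?n"
    using assms by (intro mult_left_mono power_mono) (auto simp del: of_nat_Suc)
  also have "\<dots> \<le> real ?n ^ ?n * exp (1 + r)"
    using assms by (intro mult_left_mono exp_ge_one_plus_x_over_n_power_n) auto
  finally have "(1 + r) ^ k * exp (- (a * r\<^sup>2)) \<le> real ?n ^ ?n * exp (1 + r) * exp (- (a * r\<^sup>2))"
    by (intro mult_right_mono) auto
  also have "\<dots> = real ?n ^ ?n * exp (1 + r - a * r\<^sup>2)"
    by (simp add: mult.assoc flip: exp_add)
  also have "\<dots> \<le> real ?n ^ ?n * exp (1 + 1 / (4 * a))"
  proof (intro mult_left_mono)
    have "0 \<le> a * (r - 1 / (2 * a))\<^sup>2" using assms by simp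
    also have "\<dots> = a * r\<^sup>2 - r + 1 / (4 * a)"
      using assms by (simp add: power2_eq_square field_simps)
    finally show "exp (1 + r - a * r\<^sup>2) \<le> exp (1 + 1 / (4 * a))" by simp
  qed auto
  finally show ?thesis .
qed

lemma modulated_gaussian_schwartz:
  assumes "t > 0" shows "modulated_gaussian t a \<in> schwartz_space"
  unfolding schwartz_space_def
proof (intro CollectI conjI allI)
  fix "is" :: "'a list" and k :: nat
  obtain p where p: "p \<in> polynomial_maps" 
    "iterated_partial is (modulated_gaussian t a) = (\<lambda>x. p x * modulated_gaussian t a x)"
    using iterated_partial_modulated_gaussian by blast
  show "iterated_partial is (modulated_gaussian t a) differentiable (at x)" for x
    using has_derivative_polynomial_times_gaussian[OF p(1), of t a] unfolding p(2) differentiable_def by blast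
  obtain C l where C: "0 \<le> C" "\<And>x. norm (p x) \<le> C * (1 + norm x) ^ l"
    using polynomial_maps_bound[OF p(1)] by blast
  let ?B = "C * (real (Suc (k + l)) ^ Suc (k + l) * exp (1 + 1 / (4 * (pi * t))))"
  have "norm (schwartz_weighted k is (modulated_gaussian t a) x) \<le> ?B" for x
  proof -
    have "norm (schwartz_weighted k is (modulated_gaussian t a) x) =
      norm x ^ k * (norm (p x) * exp (- (pi * t * (norm x)\<^sup>2)))"
      by (simp add: schwartz_weighted_def p(2) norm_mult norm_modulated_gaussian)
    also have "\<dots> \<le> (1 + norm x) ^ k * ((C * (1 + norm x) ^ l) * exp (- (pi * t * (norm x)\<^sup>2)))"
      by (intro mult_mono power_mono C(2)) (auto intro!: mult_nonneg_nonneg C(1) zero_le_power)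
    also have "\<dots> = C * ((1 + norm x) ^ (k + l) * exp (- (pi * t * (norm x)\<^sup>2)))"
      by (simp add: power_add)
    also have "\<dots> \<le> ?B"
      using assms by (intro mult_left_mono power_times_gaussian_bounded C(1)) auto
    finally show ?thesis .
  qed
  thus "bounded (range (schwartz_weighted k is (modulated_gaussian t a)))"
    unfolding bounded_iff by blast
qed

text \<open>A rescaling of the characteristic function of the standard normal distribution.\<close>

lemma integral_gaussian_character_real:
  fixes t b :: real
  assumes "t > 0"
  shows "integrable lborel (\<lambda>x. exp (of_real (- (pi * t * x\<^sup>2)) + of_real (2 * pi * (b * x)) * \<i>))"
    and "(LINT x|lborel. exp (of_real (- (pi * t * x\<^sup>2)) + of_real (2 * pi * (b * x)) * \<i>)) =
           of_real (exp (- (pi * b\<^sup>2 / t)) / sqrt t)"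
proof -
  \<comment> \<open>Scaling by \<open>c\<close> turns exp (-x^2/2) into exp (-pi t x^2), and
    \<open>s\<close> is the frequency that becomes 2 pi b after this scaling.\<close>
  define c where "c = sqrt (2 * pi * t)"
  have c: "c > 0" "c\<^sup>2 = 2 * pi * t" using assms by (auto simp: c_def)
  define s where "s = 2 * pi * b / c"
  define f where "f = (\<lambda>x. std_normal_density x *\<^sub>R iexp (s * x))"
  have f_int: "integrable lborel f"
  proof (rule Bochner_Integration.integrable_bound[of _ std_normal_density])
    show "integrable lborel std_normal_density" by (rule integrable_normal_density) simp
  qed (auto simp: f_def)
  have f_eq: "f (0 + c * x) = (1 / sqrt (2 * pi)) *\<^sub>R exp (of_real (- (pi * t * x\<^sup>2)) + of_real (2 * pi * (b * x)) * \<i>)" for x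
  proof -
    have "std_normal_density (c * x) = 1 / sqrt (2 * pi) * exp (- (pi * t * x\<^sup>2))"
      using c by (simp add: std_normal_density_def power_mult_distrib)
    moreover have "s * (c * x) = 2 * pi * (b * x)" using c by (simp add: s_def)
    ultimately have "f (0 + c * x) = (1 / sqrt (2 * pi) * exp (- (pi * t * x\<^sup>2))) *\<^sub>R iexp (2 * pi * (b * x))"
      by (simp only: f_def add_0)
    also have "iexp (2 * pi * (b * x)) = exp (of_real (2 * pi * (b * x)) * \<i>)" by (simp only: mult.commute)
    also have "(1 / sqrt (2 * pi) * exp (- (pi * t * x\<^sup>2))) *\<^sub>R exp (of_real (2 * pi * (b * x)) * \<i>) =
       (1 / sqrt (2 * pi)) *\<^sub>R (exp (of_real (- (pi * t * x\<^sup>2))) * exp (of_real (2 * pi * (b * x)) * \<i>))"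
      by (simp only: scaleR_conv_of_real of_real_mult exp_of_real[symmetric] mult.assoc)
    finally show ?thesis by (simp only: exp_add)
  qed
  have "integrable lborel (\<lambda>x. sqrt (2 * pi) *\<^sub>R f (0 + c * x))"
    using c f_int by (intro integrable_scaleR_right lborel_integrable_real_affine) auto
  thus "integrable lborel (\<lambda>x. exp (of_real (- (pi * t * x\<^sup>2)) + of_real (2 * pi * (b * x)) * \<i>))"
    unfolding f_eq by simp
  have "complex_of_real (exp (- (s\<^sup>2) / 2)) = (LINT x|std_normal_distribution. iexp (s * x))"
    using fun_cong[OF char_std_normal_distribution, of s] by (simp add: char_def)
  also have "\<dots> = integral\<^sup>L lborel f"
    unfolding f_def by (subst integral_density) auto
  also have "\<dots> = \<bar>c\<bar> *\<^sub>R (LINT x|lborel. f (0 + c * x))"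
    using c by (intro lborel_integral_real_affine) auto
  also have "\<dots> = (c / sqrt (2 * pi)) *\<^sub>R (LINT x|lborel. exp (of_real (- (pi * t * x\<^sup>2)) + of_real (2 * pi * (b * x)) * \<i>))"
    unfolding f_eq using c by simp
  also have "c / sqrt (2 * pi) = sqrt t" by (simp add: c_def real_sqrt_mult)
  finally have *: "sqrt t *\<^sub>R (LINT x|lborel. exp (of_real (- (pi * t * x\<^sup>2)) + of_real (2 * pi * (b * x)) * \<i>)) =
     complex_of_real (exp (- (s\<^sup>2) / 2))" ..
  have "- (s\<^sup>2) / 2 = - (pi * b\<^sup>2 / t)"
    using c assms by (simp add: s_def power_divide power_mult_distrib) (simp add: power2_eq_square)
  with * show "(LINT x|lborel. exp (of_real (- (pi * t * x\<^sup>2)) + of_real (2 * pi * (b * x)) * \<i>)) =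
           of_real (exp (- (pi * b\<^sup>2 / t)) / sqrt t)"
    using assms by (simp add: scaleR_conv_of_real field_simps)
qed

section \<open>Gaussian integrals in n dimensions as products of one-dimensional ones\<close>

lemma lborel_integral_prod_Basis:
  fixes h :: "'a :: euclidean_space \<Rightarrow> real \<Rightarrow> complex"
  assumes "\<And>b. b \<in> Basis \<Longrightarrow> integrable lborel (h b)"
  shows "integrable lborel (\<lambda>x. \<Prod>b\<in>Basis. h b (x \<bullet> b))"
    and "(LINT x|lborel. (\<Prod>b\<in>Basis. h b (x \<bullet> b))) = (\<Prod>b\<in>Basis. LINT y|lborel. h b y)"
proof -
  interpret product_sigma_finite "\<lambda>b::'a. lborel :: real measure"
    by (rule product_sigma_finite.intro) (rule sigma_finite_lborel)
  have [measurable]: "h b \<in> borel_measurable borel" if "b \<in> Basis" for b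
    using assms[OF that] by (auto dest: borel_measurable_integrable)
  have meas: "(\<lambda>x. \<Prod>b\<in>Basis. h b (x \<bullet> b)) \<in> borel_measurable borel"
    by measurable
  have eq: "(\<Prod>b\<in>Basis. h b ((\<Sum>b\<in>Basis. f b *\<^sub>R b) \<bullet> b)) = (\<Prod>b\<in>Basis. h b (f b))" for f :: "'a \<Rightarrow> real"
    by (intro prod.cong) auto
  show "integrable lborel (\<lambda>x. \<Prod>b\<in>Basis. h b (x \<bullet> b))"
    unfolding lborel_eq[where 'a = 'a]
    using product_integrable_prod[of Basis h, OF finite_Basis assms]
    by (subst integrable_distr_eq) (use meas in \<open>simp_all add: eq\<close>)
  show "(LINT x|lborel. (\<Prod>b\<in>Basis. h b (x \<bullet> b))) = (\<Prod>b\<in>Basis. LINT y|lborel. h b y)"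
    unfolding lborel_eq[where 'a = 'a]
    using product_integral_prod[of Basis h, OF finite_Basis assms]
    by (subst integral_distr) (use meas in \<open>simp_all add: eq\<close>)
qed

text \<open>The classical heat kernel at time t/(4 pi). This time scale matches the Fourier
  normalization: the multiplier is exp (-pi t |\<xi>|^2).\<close>

definition heat_kernel :: "real \<Rightarrow> real ^ 'n \<Rightarrow> real" where
  "heat_kernel t x = t powr (- (real CARD('n) / 2)) * exp (- (pi * (norm x)\<^sup>2 / t))"

lemma integral_modulated_gaussian:
  fixes a :: "real ^ 'n"
  assumes "t > 0"
  shows "integrable lborel (modulated_gaussian t a)"
    and "(LINT x|lborel. modulated_gaussian t a x) = of_real (heat_kernel t a)"
proof -
  define h where "h = (\<lambda>b x. exp (of_real (- (pi * t * x\<^sup>2)) + of_real (2 * pi * ((a \<bullet> b) * x)) * \<i>))"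
  have eq: "modulated_gaussian t a = (\<lambda>x. \<Prod>b\<in>Basis. h b (x \<bullet> b))"
  proof
    fix x :: "real ^ 'n"
    have "(norm x)\<^sup>2 = (\<Sum>b\<in>Basis. (x \<bullet> b)\<^sup>2)"
      unfolding power2_norm_eq_inner by (subst euclidean_inner) (simp add: power2_eq_square)
    moreover have "a \<bullet> x = (\<Sum>b\<in>Basis. (a \<bullet> b) * (x \<bullet> b))"
      by (rule euclidean_inner)
    ultimately show "modulated_gaussian t a x = (\<Prod>b\<in>Basis. h b (x \<bullet> b))"
      unfolding modulated_gaussian_def h_def exp_sum[symmetric, OF finite_Basis]
      by (simp add: sum.distrib sum_distrib_left sum_distrib_right sum_negf sum_subtractf)
  qed
  have int: "integrable lborel (h b)" for b
    unfolding h_def by (rule integral_gaussian_character_real[OF assms])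
  show "integrable lborel (modulated_gaussian t a)"
    unfolding eq by (rule lborel_integral_prod_Basis(1)[OF int])
  have "(LINT x|lborel. modulated_gaussian t a x) =
     (\<Prod>b\<in>Basis. complex_of_real (exp (- (pi * (a \<bullet> b)\<^sup>2 / t)) / sqrt t))"
    unfolding eq lborel_integral_prod_Basis(2)[OF int]
    unfolding h_def integral_gaussian_character_real(2)[OF assms] ..
  also have "\<dots> = of_real (\<Prod>b\<in>Basis. exp (- (pi * (a \<bullet> b)\<^sup>2 / t)) * (1 / sqrt t))"
    by simp
  also have "(\<Prod>b\<in>Basis. exp (- (pi * (a \<bullet> b)\<^sup>2 / t)) * (1 / sqrt t)) =
      (\<Prod>b\<in>Basis. exp (- (pi * (a \<bullet> b)\<^sup>2 / t))) * (1 / sqrt t) ^ DIM(real ^ 'n)"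
    by (simp only: prod.distrib prod_constant)
  also have "(\<Prod>b\<in>Basis. exp (- (pi * (a \<bullet> b)\<^sup>2 / t))) = exp (- (pi * (norm a)\<^sup>2 / t))"
  proof -
    have "(norm a)\<^sup>2 = (\<Sum>b\<in>Basis. (a \<bullet> b)\<^sup>2)"
      unfolding power2_norm_eq_inner by (subst euclidean_inner) (simp add: power2_eq_square)
    thus ?thesis
      by (simp add: exp_sum[symmetric] sum_negf sum_divide_distrib sum_distrib_left)
  qed
  also have "(1 / sqrt t) ^ DIM(real ^ 'n) = t powr (- (real CARD('n) / 2))"
  proof -
    have "1 / sqrt t = t powr (- (1 / 2))"
      using assms by (simp add: powr_minus powr_half_sqrt divide_simps)
    hence "(1 / sqrt t) ^ DIM(real ^ 'n) = (t powr (- (1 / 2))) ^ CARD('n)" by simp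
    also have "\<dots> = t powr (- (real CARD('n) / 2))"
      using assms by (simp add: powr_power)
    finally show ?thesis .
  qed
  finally show "(LINT x|lborel. modulated_gaussian t a x) = of_real (heat_kernel t a)"
    by (simp add: heat_kernel_def mult.commute)
qed

lemma modulated_gaussian_times_character:
  "exp (- (2 * of_real pi * \<i> * of_real (x \<bullet> y))) * modulated_gaussian t a x = modulated_gaussian t (a - y) x"
  unfolding modulated_gaussian_def exp_add[symmetric]
  by (rule arg_cong[of _ _ exp]) (simp add: inner_diff_left inner_commute algebra_simps)

lemma borel_measurable_modulated_gaussian [measurable (raw)]:
  fixes g :: "'b \<Rightarrow> real ^ 'n"
  assumes [measurable]: "f \<in> borel_measurable M" "h \<in> borel_measurable M" "g \<in> borel_measurable M"
  shows "(\<lambda>x. modulated_gaussian (f x) (h x) (g x)) \<in> borel_measurable M"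
  unfolding modulated_gaussian_def by measurable

lemma fourier_modulated_gaussian:
  assumes "t > 0"
  shows "fourier (modulated_gaussian t a) y = of_real (heat_kernel t (a - y))"
  unfolding fourier_def modulated_gaussian_times_character
  using integral_modulated_gaussian(2)[OF assms] by (simp add: integral_completion)

section \<open>Representation as a Riesz potential\<close>

lemma lborel_pair_dominated:
  fixes f :: "'a::euclidean_space \<Rightarrow> 'b::euclidean_space \<Rightarrow> complex"
  assumes [measurable]: "(\<lambda>(x, y). f x y) \<in> borel_measurable (borel \<Otimes>\<^sub>M borel)"
    and h: "integrable lborel h1" "integrable lborel h2"
    and bound: "\<And>x y. norm (f x y) \<le> h1 x * h2 y"
  shows "integrable (lborel \<Otimes>\<^sub>M lborel) (\<lambda>(x, y). f x y)"
    and "(LINT y|lborel. LINT x|lborel. f x y) = (LINT x|lborel. LINT y|lborel. f x y)"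
proof -
  have [measurable]: "h1 \<in> borel_measurable borel" "h2 \<in> borel_measurable borel"
    using h by (auto dest: borel_measurable_integrable)
  have "integrable (lborel \<Otimes>\<^sub>M lborel) (\<lambda>(x, y). h1 x * h2 y)"
  proof (rule lborel_pair.Fubini_integrable)
    have "integrable lborel (\<lambda>x. norm (h1 x) * (LINT y|lborel. norm (h2 y)))"
      using h by (intro integrable_mult_left integrable_norm) auto
    thus "integrable lborel (\<lambda>x. LINT y|lborel. norm (case (x, y) of (x, y) \<Rightarrow> h1 x * h2 y))"
      by (simp only: case_prod_conv real_norm_def abs_mult integral_mult_right_zero)
    show "AE x in lborel. integrable lborel (\<lambda>y. case (x, y) of (x, y) \<Rightarrow> h1 x * h2 y)"
      using h by (auto intro!: integrable_mult_right)
  qed measurable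
  thus int: "integrable (lborel \<Otimes>\<^sub>M lborel) (\<lambda>(x, y). f x y)"
    by (rule Bochner_Integration.integrable_bound)
       (auto intro!: AE_I2 order.trans[OF bound abs_ge_self])
  show "(LINT y|lborel. LINT x|lborel. f x y) = (LINT x|lborel. LINT y|lborel. f x y)"
    by (rule lborel_pair.Fubini_integral[OF int])
qed

section \<open>The heat kernel: mass, translates and averages over a set\<close>

lemma heat_kernel_nonneg: "0 \<le> heat_kernel t x"
  by (simp add: heat_kernel_def)

lemma heat_kernel_le: "0 \<le> t \<Longrightarrow> heat_kernel t (x :: real ^ 'n) \<le> t powr (- (real CARD('n) / 2))"
  by (simp add: heat_kernel_def mult_left_le)

lemma borel_measurable_heat_kernel [measurable (raw)]:
  fixes g :: "'b \<Rightarrow> real ^ 'n"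
  assumes [measurable]: "f \<in> borel_measurable M" "g \<in> borel_measurable M"
  shows "(\<lambda>x. heat_kernel (f x) (g x)) \<in> borel_measurable M"
  unfolding heat_kernel_def by measurable

text \<open>Up to t^(-n/2) the kernel is the unmodulated Gaussian of parameter 1/t, whose integral
  is the heat kernel of time 1/t at the origin, namely t^(n/2).\<close>

lemma heat_kernel_integral:
  assumes "t > 0"
  shows "integrable lborel (heat_kernel t :: real ^ 'n \<Rightarrow> real)"
    and "(LINT x|lborel. heat_kernel t (x :: real ^ 'n)) = 1"
proof -
  let ?G = "modulated_gaussian (1 / t) (0 :: real ^ 'n)"
  let ?c = "t powr (- (real CARD('n) / 2))"
  have eq: "complex_of_real (heat_kernel t x) = of_real ?c * ?G x" for x :: "real ^ 'n"
    by (simp add: heat_kernel_def modulated_gaussian_def exp_of_real[symmetric])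
  have G: "integrable lborel ?G" "(LINT x|lborel. ?G x) = of_real (heat_kernel (1 / t) (0 :: real ^ 'n))"
    using integral_modulated_gaussian[of "1 / t" "0 :: real ^ 'n"] assms by auto
  have "integrable lborel (\<lambda>x :: real ^ 'n. complex_of_real (heat_kernel t x))"
    unfolding eq using G by (intro integrable_mult_right) auto
  thus int: "integrable lborel (heat_kernel t :: real ^ 'n \<Rightarrow> real)"
    using complex_of_real_integrable_eq by blast
  have "complex_of_real (LINT x|lborel. heat_kernel t (x :: real ^ 'n)) = of_real (?c * heat_kernel (1 / t) (0 :: real ^ 'n))"
    by (subst integral_complex_of_real[symmetric]) (simp only: eq integral_mult_right_zero G(2) of_real_mult)
  also have "?c * heat_kernel (1 / t) (0 :: real ^ 'n) = 1"
    using assms by (simp add: heat_kernel_def powr_divide powr_minus)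
  finally show "(LINT x|lborel. heat_kernel t (x :: real ^ 'n)) = 1" by (simp only: of_real_eq_iff)
qed

lemma heat_kernel_shift_integral:
  fixes y :: "real ^ 'n"
  assumes "t > 0"
  shows "integrable lborel (\<lambda>a. heat_kernel t (a - y))" "(LINT a|lborel. heat_kernel t (a - y)) = 1"
proof -
  have *: "lborel = distr lborel borel (\<lambda>x :: real ^ 'n. x - y)"
  proof -
    have "(\<lambda>x. x - y) = (+) (- y)" by auto
    thus ?thesis using lborel_distr_plus[of "- y"] by simp
  qed
  have meas: "heat_kernel t \<in> borel_measurable (borel :: (real ^ 'n) measure)" by measurable
  show "integrable lborel (\<lambda>a. heat_kernel t (a - y))"
    using heat_kernel_integral(1)[OF assms, where 'n = 'n] meas
    by (subst (asm) *, subst (asm) integrable_distr_eq) auto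
  show "(LINT a|lborel. heat_kernel t (a - y)) = 1"
    using heat_kernel_integral(2)[OF assms, where 'n = 'n] meas
    by (subst (asm) *, subst (asm) integral_distr) auto
qed

text \<open>Heat kernel averaged over a set of centres; averaging makes the limits below integrable.\<close>

definition heat_mass :: "(real ^ 'n) set \<Rightarrow> real \<Rightarrow> real ^ 'n \<Rightarrow> real" where
  "heat_mass B t y = (LINT a|lborel. indicator B a * heat_kernel t (a - y))"

lemma borel_measurable_heat_mass [measurable (raw)]:
  fixes g :: "'b \<Rightarrow> real ^ 'n"
  assumes [measurable]: "f \<in> borel_measurable M" "g \<in> borel_measurable M" and B: "B \<in> sets borel"
  shows "(\<lambda>x. heat_mass B (f x) (g x)) \<in> borel_measurable M"
proof -
  have [measurable]: "B \<in> sets borel" by fact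
  show ?thesis unfolding heat_mass_def by measurable
qed

text \<open>The inverse Fourier transform of the indicator of B; it appears when the modulated
  Gaussians are integrated over their centres a in B.\<close>

definition indicator_transform :: "(real ^ 'n) set \<Rightarrow> real ^ 'n \<Rightarrow> complex" where
  "indicator_transform B \<xi> = (LINT a|lborel. indicator B a *\<^sub>R exp (of_real (2 * pi * (a \<bullet> \<xi>)) * \<i>))"

context
  fixes B :: "(real ^ 'n) set"
  assumes B [measurable]: "B \<in> sets borel" and B_finite: "emeasure lborel B < \<infinity>"
begin

lemma integrable_indicator_B: "integrable lborel (indicator B :: _ \<Rightarrow> real)"
  using B B_finite by (intro integrable_real_indicator) auto

lemma heat_mass_nonneg: "0 \<le> heat_mass B t y"
  unfolding heat_mass_def by (intro integral_nonneg_AE) (auto simp: heat_kernel_nonneg)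

lemma integrable_indicator_heat_kernel:
  assumes "t > 0" shows "integrable lborel (\<lambda>a. indicator B a * heat_kernel t (a - y))"
  using integrable_mult_indicator[OF _ heat_kernel_shift_integral(1)[OF assms], of B y] by simp

text \<open>Total mass 1 serves small times and the sup norm of the kernel serves large ones. Their
  minimum is integrable against \<tau>^(\<alpha>/2 - 1) on the half-line when 0 < \<alpha> <
  n.\<close>

lemma heat_mass_le:
  assumes "t > 0"
  shows "heat_mass B t y \<le> min 1 (measure lborel B * t powr (- (real CARD('n) / 2)))"
proof (rule min.boundedI)
  have "heat_mass B t y \<le> (LINT a|lborel. heat_kernel t (a - y))"
    unfolding heat_mass_def using integrable_indicator_heat_kernel[OF assms] heat_kernel_shift_integral(1)[OF assms]
    by (intro integral_mono) (auto simp: indicator_def heat_kernel_nonneg)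
  thus "heat_mass B t y \<le> 1" by (simp add: heat_kernel_shift_integral(2)[OF assms])
  have "heat_mass B t y \<le> (LINT a|lborel. indicator B a * t powr (- (real CARD('n) / 2)))"
    unfolding heat_mass_def using assms integrable_indicator_heat_kernel[OF assms] integrable_indicator_B
    by (intro integral_mono integrable_mult_left) (auto split: split_indicator simp: heat_kernel_le)
  thus "heat_mass B t y \<le> measure lborel B * t powr (- (real CARD('n) / 2))"
    by simp
qed

lemma heat_mass_tendsto:
  assumes t: "t > 0" and s: "s \<longlonglongrightarrow> t" "\<And>k. s k \<ge> t"
  shows "(\<lambda>k. heat_mass B (s k) y) \<longlonglongrightarrow> heat_mass B t y"
  unfolding heat_mass_def
proof (rule integral_dominated_convergence[where w = "\<lambda>a. indicator B a * t powr (- (real CARD('n) / 2))"])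
  show "integrable lborel (\<lambda>a. indicat_real B a * t powr (- (real CARD('n) / 2)))"
    by (intro integrable_mult_left integrable_indicator_B)
  show "AE a in lborel. (\<lambda>k. indicat_real B a * heat_kernel (s k) (a - y)) \<longlonglongrightarrow> indicat_real B a * heat_kernel t (a - y)"
    unfolding heat_kernel_def using t by (intro AE_I2 tendsto_intros s) auto
  show "AE a in lborel. norm (indicat_real B a * heat_kernel (s k) (a - y)) \<le> indicator B a * t powr (- (real CARD('n) / 2))" for k
  proof (intro AE_I2)
    fix a
    have "heat_kernel (s k) (a - y) \<le> s k powr (- (real CARD('n) / 2))"
      using s(2)[of k] t by (intro heat_kernel_le) auto
    also have "\<dots> \<le> t powr (- (real CARD('n) / 2))"
      using s(2)[of k] t by (intro powr_mono2') auto
    finally show "norm (indicat_real B a * heat_kernel (s k) (a - y)) \<le> indicator B a * t powr (- (real CARD('n) / 2))"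
      using heat_kernel_nonneg[of "s k" "a - y"] by (auto simp: indicator_def)
  qed
qed measurable

lemma heat_mass_eq_rescaled:
  assumes t: "t > 0"
  shows "heat_mass B t y = (LINT z|lborel. indicator B (y + sqrt t *\<^sub>R z) * heat_kernel 1 z)"
proof -
  let ?f = "\<lambda>a. indicator B a * heat_kernel t (a - y)"
  have c: "sqrt t \<noteq> 0" using t by simp
  have "heat_mass B t y = (LINT z|lborel. \<bar>sqrt t\<bar> ^ DIM(real ^ 'n) *\<^sub>R ?f (y + sqrt t *\<^sub>R z))"
    unfolding heat_mass_def
    by (subst lborel_affine[OF c, of y], subst integral_density)
       (auto simp: integral_distr intro!: AE_I2)
  also have "\<dots> = (LINT z|lborel. indicator B (y + sqrt t *\<^sub>R z) * heat_kernel 1 z)"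
  proof (intro Bochner_Integration.integral_cong refl)
    fix z :: "real ^ 'n"
    have "sqrt t ^ CARD('n) = t powr (real CARD('n) / 2)"
      using t by (simp add: powr_half_sqrt[symmetric] powr_power)
    hence "\<bar>sqrt t\<bar> ^ DIM(real ^ 'n) * t powr (- (real CARD('n) / 2)) = 1"
      using t by (simp add: powr_minus)
    moreover have "(norm (sqrt t *\<^sub>R z))\<^sup>2 / t = (norm z)\<^sup>2"
      using t by (simp add: power_mult_distrib)
    ultimately show "\<bar>sqrt t\<bar> ^ DIM(real ^ 'n) *\<^sub>R ?f (y + sqrt t *\<^sub>R z) = indicator B (y + sqrt t *\<^sub>R z) * heat_kernel 1 z"
      by (simp add: heat_kernel_def times_divide_eq_right[symmetric] del: times_divide_eq_right) 
  qed
  finally show ?thesis .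
qed

text \<open>After rescaling, the time sits in the indicator alone and \<open>heat_kernel 1\<close>
  is a fixed majorant. Off the frontier the indicator is locally constant, so the integrand
  converges at every z.\<close>

lemma heat_mass_tendsto_indicator:
  assumes s: "s \<longlonglongrightarrow> 0" "\<And>k. s k > 0" and y: "y \<notin> frontier B"
  shows "(\<lambda>k. heat_mass B (s k) y) \<longlonglongrightarrow> indicator B y"
proof -
  have "(\<lambda>k. LINT z|lborel. indicator B (y + sqrt (s k) *\<^sub>R z) * heat_kernel 1 z) \<longlonglongrightarrow>
        (LINT z|lborel. indicator B y * heat_kernel 1 (z :: real ^ 'n))"
  proof (rule integral_dominated_convergence[where w = "heat_kernel 1"])
    show "integrable lborel (heat_kernel 1 :: real ^ 'n \<Rightarrow> real)" by (rule heat_kernel_integral) simp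
    show "AE z in lborel. (\<lambda>k. indicat_real B (y + sqrt (s k) *\<^sub>R z) * heat_kernel 1 z) \<longlonglongrightarrow> indicator B y * heat_kernel 1 z"
    proof (intro AE_I2 tendsto_mult tendsto_const)
      fix z :: "real ^ 'n"
      have "(\<lambda>k. y + sqrt (s k) *\<^sub>R z) \<longlonglongrightarrow> y + sqrt 0 *\<^sub>R z" by (intro tendsto_intros s)
      hence lim: "(\<lambda>k. y + sqrt (s k) *\<^sub>R z) \<longlonglongrightarrow> y" by simp
      consider "y \<in> interior B" | "y \<in> - closure B"
        using y by (auto simp: frontier_def)
      thus "(\<lambda>k. indicat_real B (y + sqrt (s k) *\<^sub>R z)) \<longlonglongrightarrow> indicator B y"
      proof cases
        case 1
        hence "eventually (\<lambda>k. y + sqrt (s k) *\<^sub>R z \<in> interior B) sequentially"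
          using lim open_interior topological_tendstoD by blast
        hence "eventually (\<lambda>k. indicat_real B (y + sqrt (s k) *\<^sub>R z) = indicator B y) sequentially"
          using 1 interior_subset by (auto elim!: eventually_mono simp: indicator_def)
        thus ?thesis by (rule tendsto_eventually)
      next
        case 2
        hence "eventually (\<lambda>k. y + sqrt (s k) *\<^sub>R z \<in> - closure B) sequentially"
          using lim closed_closure open_Compl topological_tendstoD by blast
        hence "eventually (\<lambda>k. indicat_real B (y + sqrt (s k) *\<^sub>R z) = indicator B y) sequentially"
          using 2 closure_subset[of B] by (auto elim!: eventually_mono simp: indicator_def)
        thus ?thesis by (rule tendsto_eventually)
      qed
    qed
    show "AE z in lborel. norm (indicat_real B (y + sqrt (s k) *\<^sub>R z) * heat_kernel 1 z) \<le> heat_kernel 1 z" for k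
      by (intro AE_I2) (auto simp: indicator_def heat_kernel_nonneg)
  qed measurable
  thus ?thesis
    using s heat_kernel_integral(2)[of 1, where 'n = 'n] by (simp add: heat_mass_eq_rescaled)
qed

lemma modulated_gaussian_split:
  "modulated_gaussian t a \<xi> = exp (of_real (2 * pi * (a \<bullet> \<xi>)) * \<i>) * of_real (exp (- (pi * t * (norm \<xi>)\<^sup>2)))"
  unfolding modulated_gaussian_def exp_add by (simp add: exp_of_real[symmetric])

lemma norm_indicator_transform_le: "norm (indicator_transform B \<xi>) \<le> measure lborel B"
proof -
  have "norm (indicator_transform B \<xi>) \<le> (LINT a|lborel. norm (indicator B a *\<^sub>R exp (of_real (2 * pi * (a \<bullet> \<xi>)) * \<i>)))"
    unfolding indicator_transform_def by (rule integral_norm_bound)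
  also have "\<dots> = (LINT a|lborel. indicator B a)" by simp
  finally show ?thesis by simp
qed

lemma borel_measurable_indicator_transform [measurable]: "indicator_transform B \<in> borel_measurable borel"
  unfolding indicator_transform_def by measurable

text \<open>Integrate the pointwise identity \<open>eq\<close> over the centres a in B and exchange
  integrals on both sides. The multiplier m is kept general because the lemma serves both g, with
  the factor |\<xi>|^\<alpha>, and u, without it.\<close>

lemma heat_mass_pairing:
  fixes f m :: "real ^ 'n \<Rightarrow> complex"
  assumes t: "t > 0" and f: "integrable lborel f" and [measurable]: "m \<in> borel_measurable borel"
    and m: "integrable lborel (\<lambda>\<xi>. m \<xi> * of_real (exp (- (pi * t * (norm \<xi>)\<^sup>2))))"
    and eq: "\<And>a. (LINT y|lborel. f y * of_real (heat_kernel t (a - y))) = (LINT \<xi>|lborel. m \<xi> * modulated_gaussian t a \<xi>)"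
  shows "(LINT y|lborel. f y * of_real (heat_mass B t y)) =
         (LINT \<xi>|lborel. m \<xi> * of_real (exp (- (pi * t * (norm \<xi>)\<^sup>2))) * indicator_transform B \<xi>)"
proof -
  have [measurable]: "f \<in> borel_measurable borel" using f by (auto dest: borel_measurable_integrable)
  let ?n = "real CARD('n)"
  have "(LINT y|lborel. f y * of_real (heat_mass B t y)) =
      (LINT y|lborel. LINT a|lborel. f y * of_real (indicator B a * heat_kernel t (a - y)))"
    by (simp only: heat_mass_def integral_complex_of_real integral_mult_right_zero)
  also have "\<dots> = (LINT a|lborel. LINT y|lborel. f y * of_real (indicator B a * heat_kernel t (a - y)))"
  proof (rule lborel_pair_dominated(2))
    show "integrable lborel (\<lambda>a. indicator B a * t powr (- (?n / 2)))"
      by (intro integrable_mult_left integrable_indicator_B)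
    show "integrable lborel (\<lambda>y. norm (f y))" using f by (rule integrable_norm)
    show "norm (f y * of_real (indicator B a * heat_kernel t (a - y))) \<le> (indicator B a * t powr (- (?n / 2))) * norm (f y)" for a y
      using heat_kernel_le[of t "a - y"] t heat_kernel_nonneg[of t "a - y"]
      by (auto simp: indicator_def norm_mult mult.commute intro: mult_left_mono)
  qed measurable
  also have "\<dots> = (LINT a|lborel. of_real (indicator B a) * (LINT y|lborel. f y * of_real (heat_kernel t (a - y))))"
    by (intro Bochner_Integration.integral_cong refl, subst integral_mult_right_zero[symmetric])
       (simp add: mult_ac)
  also have "\<dots> = (LINT a|lborel. LINT \<xi>|lborel. of_real (indicator B a) * (m \<xi> * modulated_gaussian t a \<xi>))"
    by (simp only: eq integral_mult_right_zero)
  also have "\<dots> = (LINT \<xi>|lborel. LINT a|lborel. of_real (indicator B a) * (m \<xi> * modulated_gaussian t a \<xi>))"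
  proof (rule lborel_pair_dominated(2)[where ?h1.0 = "\<lambda>\<xi>. norm (m \<xi> * of_real (exp (- (pi * t * (norm \<xi>)\<^sup>2))))"
        and ?h2.0 = "indicator B"])
    show "integrable lborel (indicator B :: _ \<Rightarrow> real)" by (rule integrable_indicator_B)
    show "integrable lborel (\<lambda>\<xi>. norm (m \<xi> * of_real (exp (- (pi * t * (norm \<xi>)\<^sup>2)))))"
      using m by (rule integrable_norm)
    show "norm (of_real (indicator B a) * (m \<xi> * modulated_gaussian t a \<xi>)) \<le>
       norm (m \<xi> * of_real (exp (- (pi * t * (norm \<xi>)\<^sup>2)))) * indicator B a" for \<xi> a
      by (simp add: norm_mult norm_modulated_gaussian)
  qed measurable
  also have "\<dots> = (LINT \<xi>|lborel. m \<xi> * of_real (exp (- (pi * t * (norm \<xi>)\<^sup>2))) * indicator_transform B \<xi>)"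
    unfolding indicator_transform_def integral_mult_right_zero[symmetric]
    by (intro Bochner_Integration.integral_cong refl) 
       (simp add: modulated_gaussian_split scaleR_conv_of_real mult_ac)
  finally show ?thesis .
qed

end

section \<open>The weight \<tau>^(p - 1) on the half-line and its integrals\<close>

definition power_weight :: "real \<Rightarrow> real \<Rightarrow> real" where
  "power_weight p \<tau> = indicator {0..} \<tau> * \<tau> powr (p - 1)"

lemma power_weight_nonneg: "0 \<le> power_weight p \<tau>"
  by (simp add: power_weight_def)

lemma power_weight_eq_0: "\<tau> \<le> 0 \<Longrightarrow> power_weight p \<tau> = 0"
  by (cases "\<tau> = 0") (auto simp: power_weight_def)

lemma power_weight_scale: "c > 0 \<Longrightarrow> power_weight p (c * \<tau>) = c powr (p - 1) * power_weight p \<tau>"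
  by (auto simp: power_weight_def powr_mult indicator_def zero_le_mult_iff)

lemma borel_measurable_power_weight [measurable]: "power_weight p \<in> borel_measurable borel"
  unfolding power_weight_def by measurable

lemma power_weight_exp_integral:
  assumes "p > 0" "c > 0"
  shows "has_bochner_integral lborel (\<lambda>\<tau>. power_weight p \<tau> * exp (- (c * \<tau>))) (Gamma p * c powr (- p))"
proof -
  let ?f = "\<lambda>\<tau>. power_weight p \<tau> * exp (- \<tau>)"
  have "has_bochner_integral lborel ?f (Gamma p)"
  proof (rule has_bochner_integral_nn_integral)
    show "(\<integral>\<^sup>+ \<tau>. ennreal (?f \<tau>) \<partial>lborel) = ennreal (Gamma p)"
      using Gamma_conv_nn_integral_real[OF assms(1)]
      by (simp add: power_weight_def exp_minus field_simps)
    show "0 \<le> Gamma p" using Gamma_real_pos[OF assms(1)] by simp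
  qed (auto simp: power_weight_nonneg)
  hence "has_bochner_integral lborel (\<lambda>\<tau>. ?f (0 + c * \<tau>)) (Gamma p /\<^sub>R \<bar>c\<bar>)"
    using assms by (subst (asm) lborel_has_bochner_integral_real_affine_iff[of c _ _ 0]) auto
  hence "has_bochner_integral lborel (\<lambda>\<tau>. c powr (1 - p) * ?f (0 + c * \<tau>)) (c powr (1 - p) * (Gamma p /\<^sub>R \<bar>c\<bar>))"
    by (rule has_bochner_integral_mult_right)
  moreover have "c powr (1 - p) * ?f (0 + c * \<tau>) = power_weight p \<tau> * exp (- (c * \<tau>))" for \<tau>
    using assms by (simp add: power_weight_scale mult.assoc[symmetric] powr_add[symmetric])
  moreover have "c powr (1 - p) * (Gamma p /\<^sub>R \<bar>c\<bar>) = Gamma p * c powr (- p)"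
    using assms by (simp add: powr_diff powr_minus field_simps)
  ultimately show ?thesis by (simp only:)
qed

text \<open>On [0, 1] the minimum is bounded by 1 and p > 0 suffices; beyond 1 the decaying entry is
  used and p < q suffices.\<close>

lemma integrable_power_weight_min:
  assumes "p > 0" "p < q" "b \<ge> 0"
  shows "integrable lborel (\<lambda>\<tau>. power_weight p \<tau> * min 1 (b * \<tau> powr (- q)))"
proof (rule Bochner_Integration.integrable_bound)
  have "integrable lborel (\<lambda>x. indicator {0..1} x * x powr (p - 1))"
  proof (rule integrableI_nn_integral_finite[where x = "1 powr (p - 1 + 1) / (p - 1 + 1)"])
    show "(\<integral>\<^sup>+ x. ennreal (indicator {0..1} x * x powr (p - 1)) \<partial>lborel) = ennreal (1 powr (p - 1 + 1) / (p - 1 + 1))"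
      using nn_integral_has_integral_lebesgue[OF _ has_integral_powr_from_0[of "p - 1" 1]] assms by simp
  qed (auto simp: assms)
  moreover have "integrable lborel (\<lambda>x. indicator {1..} x * x powr (p - 1 - q))"
  proof (rule integrableI_nn_integral_finite[where x = "- (1 powr (p - 1 - q + 1)) / (p - 1 - q + 1)"])
    show "(\<integral>\<^sup>+ x. ennreal (indicator {1..} x * x powr (p - 1 - q)) \<partial>lborel) = ennreal (- (1 powr (p - 1 - q + 1)) / (p - 1 - q + 1))"
      using nn_integral_has_integral_lebesgue[OF _ has_integral_powr_to_inf[of "p - 1 - q" 1]] assms by simp
  qed (use assms in \<open>auto simp: field_simps\<close>)
  ultimately show "integrable lborel (\<lambda>x. indicator {0..1} x * x powr (p - 1) + b * (indicator {1..} x * x powr (p - 1 - q)))"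
    by (intro Bochner_Integration.integrable_add integrable_mult_right)
  show "AE \<tau> in lborel. norm (power_weight p \<tau> * min 1 (b * \<tau> powr (- q))) \<le>
      norm (indicator {0..1} \<tau> * \<tau> powr (p - 1) + b * (indicator {1..} \<tau> * \<tau> powr (p - 1 - q)))"
  proof (intro AE_I2)
    fix \<tau> :: real
    consider "\<tau> \<le> 0" | "0 < \<tau>" "\<tau> \<le> 1" | "\<tau> > 1" by linarith
    thus "norm (power_weight p \<tau> * min 1 (b * \<tau> powr (- q))) \<le>
      norm (indicator {0..1} \<tau> * \<tau> powr (p - 1) + b * (indicator {1..} \<tau> * \<tau> powr (p - 1 - q)))"
    proof cases
      case 1
      thus ?thesis by (simp add: power_weight_eq_0)
    next
      case 2
      have "\<tau> powr (p - 1) * min 1 (b * \<tau> powr (- q)) \<le> \<tau> powr (p - 1) * 1"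
        by (intro mult_left_mono) auto
      also have "\<dots> \<le> indicator {0..1} \<tau> * \<tau> powr (p - 1) + b * (indicator {1..} \<tau> * \<tau> powr (p - 1 - q))"
        using 2 assms by simp
      finally show ?thesis using 2 assms by (simp add: power_weight_def abs_mult)
    next
      case 3
      have "\<tau> powr (p - 1) * min 1 (b * \<tau> powr (- q)) \<le> \<tau> powr (p - 1) * (b * \<tau> powr (- q))"
        by (intro mult_left_mono) auto
      also have "\<dots> = b * \<tau> powr (p - 1 - q)"
        by (simp add: mult.left_commute powr_add[symmetric])
      finally show ?thesis using 3 assms by (simp add: power_weight_def abs_mult)
    qed
  qed
qed measurable

text \<open>Half of the Gaussian absorbs the power, and the other half remains as an integrable
  majorant.\<close>

lemma integrable_norm_powr_gaussian:
  assumes t: "t > 0" and "\<alpha> \<ge> 0"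
  shows "integrable lborel (\<lambda>\<xi> :: real ^ 'n. norm \<xi> powr \<alpha> * exp (- (pi * t * (norm \<xi>)\<^sup>2)))"
proof -
  obtain k :: nat where k: "\<alpha> \<le> real k" using real_arch_simple by blast
  define C where "C = real (Suc k) ^ Suc k * exp (1 + 1 / (4 * (pi * (t / 2))))"
  show ?thesis
  proof (rule Bochner_Integration.integrable_bound)
    show "integrable lborel (\<lambda>\<xi> :: real ^ 'n. C * norm (modulated_gaussian (t / 2) 0 \<xi>))"
      using t by (intro integrable_mult_right integrable_norm integral_modulated_gaussian) auto
    show "AE \<xi> in lborel. norm (norm (\<xi> :: real ^ 'n) powr \<alpha> * exp (- (pi * t * (norm \<xi>)\<^sup>2))) \<le>
        norm (C * norm (modulated_gaussian (t / 2) 0 \<xi>))"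
    proof (intro AE_I2)
      fix \<xi> :: "real ^ 'n"
      let ?e = "exp (- (pi * (t / 2) * (norm \<xi>)\<^sup>2))"
      have "norm \<xi> powr \<alpha> \<le> (1 + norm \<xi>) powr \<alpha>" using assms by (intro powr_mono2) auto
      also have "\<dots> \<le> (1 + norm \<xi>) powr real k" using k by (intro powr_mono) auto
      also have "\<dots> = (1 + norm \<xi>) ^ k" by (intro powr_realpow) (auto simp: add_pos_nonneg)
      finally have "norm \<xi> powr \<alpha> * ?e \<le> (1 + norm \<xi>) ^ k * ?e" by (intro mult_right_mono) auto
      also have "\<dots> \<le> C" unfolding C_def using t by (intro power_times_gaussian_bounded) auto
      finally have "norm \<xi> powr \<alpha> * ?e * ?e \<le> C * ?e" by (intro mult_right_mono) auto
      moreover have "?e * ?e = exp (- (pi * t * (norm \<xi>)\<^sup>2))" by (simp flip: exp_add)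
      ultimately have "norm \<xi> powr \<alpha> * exp (- (pi * t * (norm \<xi>)\<^sup>2)) \<le> C * norm (modulated_gaussian (t / 2) 0 \<xi>)"
        by (simp only: norm_modulated_gaussian mult.assoc)
      thus "norm (norm \<xi> powr \<alpha> * exp (- (pi * t * (norm \<xi>)\<^sup>2))) \<le> norm (C * norm (modulated_gaussian (t / 2) 0 \<xi>))"
        by simp
    qed
  qed measurable
qed

section \<open>Fourier transforms of integrable functions against Gaussians\<close>

lemma fourier_lborel:
  assumes [measurable]: "u \<in> borel_measurable borel"
  shows "fourier u \<xi> = (LINT x|lborel. exp (- (2 * of_real pi * \<i> * of_real (x \<bullet> \<xi>))) * u x)"
  unfolding fourier_def by (intro integral_completion) measurable

lemma borel_measurable_fourier:
  assumes [measurable]: "u \<in> borel_measurable borel"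
  shows "fourier u \<in> borel_measurable borel"
  unfolding fourier_lborel[OF assms, abs_def] by measurable

lemma norm_fourier_le:
  assumes "integrable lborel u"
  shows "norm (fourier u \<xi>) \<le> (LINT x|lborel. norm (u x))"
proof -
  have "u \<in> borel_measurable borel" using assms by (auto dest: borel_measurable_integrable)
  hence "norm (fourier u \<xi>) \<le> (LINT x|lborel. norm (exp (- (2 * of_real pi * \<i> * of_real (x \<bullet> \<xi>))) * u x))"
    by (simp only: fourier_lborel integral_norm_bound)
  also have "\<dots> = (LINT x|lborel. norm (u x))" by (simp add: norm_mult)
  finally show ?thesis .
qed

lemma integrable_fourier_gaussian:
  fixes u :: "real ^ 'n \<Rightarrow> complex"
  assumes u: "integrable lborel u" and t: "t > 0" and "\<alpha> \<ge> 0"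
  shows "integrable lborel (\<lambda>\<xi>. of_real (norm \<xi> powr \<alpha>) * fourier u \<xi> * of_real (exp (- (pi * t * (norm \<xi>)\<^sup>2))))"
    and "integrable lborel (\<lambda>\<xi>. fourier u \<xi> * of_real (exp (- (pi * t * (norm \<xi>)\<^sup>2))))"
proof -
  have um: "u \<in> borel_measurable borel" using u by (auto dest: borel_measurable_integrable)
  note [measurable] = borel_measurable_fourier[OF um]
  let ?N = "LINT x|lborel. norm (u x)"
  show "integrable lborel (\<lambda>\<xi>. of_real (norm \<xi> powr \<alpha>) * fourier u \<xi> * of_real (exp (- (pi * t * (norm \<xi>)\<^sup>2))))"
  proof (rule Bochner_Integration.integrable_bound)
    show "integrable lborel (\<lambda>\<xi> :: real ^ 'n. ?N * (norm \<xi> powr \<alpha> * exp (- (pi * t * (norm \<xi>)\<^sup>2))))"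
      by (intro integrable_mult_right integrable_norm_powr_gaussian assms)
    show "AE \<xi> in lborel. norm (of_real (norm \<xi> powr \<alpha>) * fourier u \<xi> * of_real (exp (- (pi * t * (norm \<xi>)\<^sup>2)))) \<le>
      norm (?N * (norm \<xi> powr \<alpha> * exp (- (pi * t * (norm \<xi>)\<^sup>2))))"
    proof (intro AE_I2)
      fix \<xi> :: "real ^ 'n"
      have "norm (fourier u \<xi>) * (norm \<xi> powr \<alpha> * exp (- (pi * t * (norm \<xi>)\<^sup>2))) \<le>
        ?N * (norm \<xi> powr \<alpha> * exp (- (pi * t * (norm \<xi>)\<^sup>2)))"
        by (intro mult_right_mono norm_fourier_le u) auto
      thus "norm (of_real (norm \<xi> powr \<alpha>) * fourier u \<xi> * of_real (exp (- (pi * t * (norm \<xi>)\<^sup>2)))) \<le>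
        norm (?N * (norm \<xi> powr \<alpha> * exp (- (pi * t * (norm \<xi>)\<^sup>2))))"
        by (simp add: norm_mult abs_mult mult_ac)
    qed
  qed measurable
  show "integrable lborel (\<lambda>\<xi>. fourier u \<xi> * of_real (exp (- (pi * t * (norm \<xi>)\<^sup>2))))"
  proof (rule Bochner_Integration.integrable_bound)
    show "integrable lborel (\<lambda>\<xi> :: real ^ 'n. ?N * norm (modulated_gaussian t 0 \<xi>))"
      using t by (intro integrable_mult_right integrable_norm integral_modulated_gaussian) auto
    show "AE \<xi> in lborel. norm (fourier u \<xi> * of_real (exp (- (pi * t * (norm \<xi>)\<^sup>2)))) \<le>
      norm (?N * norm (modulated_gaussian t 0 \<xi>))"
      using norm_fourier_le[OF u] 
      by (intro AE_I2) (simp add: norm_mult norm_modulated_gaussian abs_mult mult_right_mono)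
  qed measurable
qed

lemma heat_kernel_convolution_fourier:
  fixes u :: "real ^ 'n \<Rightarrow> complex"
  assumes u: "integrable lborel u" and t: "t > 0"
  shows "(LINT y|lborel. u y * of_real (heat_kernel t (a - y))) = (LINT \<xi>|lborel. fourier u \<xi> * modulated_gaussian t a \<xi>)"
proof -
  have um [measurable]: "u \<in> borel_measurable borel" using u by (auto dest: borel_measurable_integrable)
  let ?e = "\<lambda>y \<xi>. exp (- (2 * of_real pi * \<i> * of_real (y \<bullet> \<xi>)))"
  have shift: "?e y \<xi> * modulated_gaussian t a \<xi> = modulated_gaussian t (a - y) \<xi>" for y \<xi> :: "real ^ 'n"
    using modulated_gaussian_times_character[of \<xi> y t a] by (simp add: inner_commute)
  have "(LINT y|lborel. u y * of_real (heat_kernel t (a - y))) =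
     (LINT y|lborel. LINT \<xi>|lborel. u y * (?e y \<xi> * modulated_gaussian t a \<xi>))"
    by (simp only: shift integral_mult_right_zero integral_modulated_gaussian(2)[OF t])
  also have "\<dots> = (LINT \<xi>|lborel. LINT y|lborel. u y * (?e y \<xi> * modulated_gaussian t a \<xi>))"
  proof (rule lborel_pair_dominated(2)[where ?h1.0 = "\<lambda>\<xi>. norm (modulated_gaussian t 0 \<xi>)" and ?h2.0 = "\<lambda>y. norm (u y)"])
    show "integrable lborel (\<lambda>\<xi>. norm (modulated_gaussian t 0 \<xi>))" "integrable lborel (\<lambda>y. norm (u y))"
      using t u by (auto intro!: integrable_norm integral_modulated_gaussian)
    show "norm (u y * (?e y \<xi> * modulated_gaussian t a \<xi>)) \<le> norm (modulated_gaussian t 0 \<xi>) * norm (u y)" for \<xi> y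
      by (simp only: shift norm_mult norm_modulated_gaussian) (simp add: mult.commute)
  qed measurable
  also have "\<dots> = (LINT \<xi>|lborel. fourier u \<xi> * modulated_gaussian t a \<xi>)"
    unfolding fourier_lborel[OF um] integral_mult_left_zero[symmetric] by (simp add: mult_ac)
  finally show ?thesis .
qed

lemma lborel_integral_swap:
  fixes f :: "'a::euclidean_space \<Rightarrow> 'b::euclidean_space \<Rightarrow> complex"
  assumes [measurable]: "(\<lambda>(x, y). f x y) \<in> borel_measurable (borel \<Otimes>\<^sub>M borel)"
    and "\<And>x. integrable lborel (f x)"
    and "integrable lborel (\<lambda>x. LINT y|lborel. norm (f x y))"
  shows "(LINT y|lborel. LINT x|lborel. f x y) = (LINT x|lborel. LINT y|lborel. f x y)"
  by (rule lborel_pair.Fubini_integral, rule lborel_pair.Fubini_integrable) (use assms in auto)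

text \<open>Subordination: $\int_0^\infty \tau^{\alpha/2-1} e^{-\pi\tau|\xi|^2} d\tau$ cancels the factor $|\xi|^\alpha$ of the
  multiplier. The shift by $s$ keeps all integrals absolutely convergent.\<close>

lemma heat_mass_subordination:
  fixes u g :: "real ^ 'n \<Rightarrow> complex"
  assumes u: "integrable lborel u" and g: "integrable lborel g" and \<alpha>: "\<alpha> > 0" and s: "s > 0"
    and B: "B \<in> sets borel" "emeasure lborel B < \<infinity>"
    and star: "\<And>t a. t > 0 \<Longrightarrow> (LINT y|lborel. g y * of_real (heat_kernel t (a - y))) =
      (LINT \<xi>|lborel. of_real (norm \<xi> powr \<alpha>) * fourier u \<xi> * modulated_gaussian t a \<xi>)"
  shows "of_real (Gamma (\<alpha> / 2) * pi powr (- (\<alpha> / 2))) * (LINT y|lborel. u y * of_real (heat_mass B s y)) =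
     (LINT \<tau>|lborel. of_real (power_weight (\<alpha> / 2) \<tau>) * (LINT y|lborel. g y * of_real (heat_mass B (\<tau> + s) y)))"
proof -
  have um [measurable]: "u \<in> borel_measurable borel" using u by (auto dest: borel_measurable_integrable)
  note [measurable] = borel_measurable_fourier[OF um] borel_measurable_indicator_transform[OF B]
  define p where "p = \<alpha> / 2"
  have p: "p > 0" using \<alpha> by (simp add: p_def)
  let ?E = "\<lambda>t \<xi> :: real ^ 'n. complex_of_real (exp (- (pi * t * (norm \<xi>)\<^sup>2)))"
  let ?m = "\<lambda>\<xi>. of_real (norm \<xi> powr \<alpha>) * fourier u \<xi>"
  define M where "M = (\<lambda>\<xi>. fourier u \<xi> * ?E s \<xi> * indicator_transform B \<xi>)"
  \<comment> \<open>The semigroup law splits exp (-pi (\<tau> + s) |\<xi>|^2): the \<tau>-part is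
    integrated against the weight, and the s-part goes into \<open>M\<close> and makes it integrable
    in \<xi>.\<close>
  define F where "F = (\<lambda>\<xi> \<tau>. of_real (norm \<xi> powr \<alpha> * (power_weight p \<tau> * exp (- ((pi * (norm \<xi>)\<^sup>2) * \<tau>)))) * M \<xi>)"
  have M_meas [measurable]: "M \<in> borel_measurable borel" unfolding M_def by measurable
  have M_int: "integrable lborel M"
  proof (rule Bochner_Integration.integrable_bound)
    show "integrable lborel (\<lambda>\<xi>. measure lborel B *\<^sub>R (fourier u \<xi> * ?E s \<xi>))"
      using integrable_fourier_gaussian(2)[OF u s, of \<alpha>] \<alpha> by (intro integrable_scaleR_right) auto
    show "AE \<xi> in lborel. norm (M \<xi>) \<le> norm (measure lborel B *\<^sub>R (fourier u \<xi> * ?E s \<xi>))"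
    proof (intro AE_I2)
      fix \<xi>
      have "norm (fourier u \<xi> * ?E s \<xi>) * norm (indicator_transform B \<xi>) \<le> norm (fourier u \<xi> * ?E s \<xi>) * measure lborel B"
        by (intro mult_left_mono norm_indicator_transform_le B) auto
      thus "norm (M \<xi>) \<le> norm (measure lborel B *\<^sub>R (fourier u \<xi> * ?E s \<xi>))"
        unfolding M_def by (simp only: norm_mult norm_scaleR) (simp add: mult_ac)
    qed
  qed measurable
  \<comment> \<open>At the origin \<open>norm \<xi> powr \<alpha>\<close> is 0, so the integral is 0
    and not the constant found elsewhere. This single point is discarded as a null set after the
    exchange of integrals.\<close>
  have inner: "has_bochner_integral lborel (\<lambda>\<tau>. norm \<xi> powr \<alpha> * (power_weight p \<tau> * exp (- ((pi * (norm \<xi>)\<^sup>2) * \<tau>))))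
      (if \<xi> = 0 then 0 else Gamma p * pi powr (- p))" for \<xi> :: "real ^ 'n"
  proof (cases "\<xi> = 0")
    case False
    have "norm \<xi> powr \<alpha> * (pi * (norm \<xi>)\<^sup>2) powr (- p) = pi powr (- p) * (norm \<xi> powr \<alpha> * ((norm \<xi>)\<^sup>2) powr (- p))"
      by (simp add: powr_mult)
    also have "((norm \<xi>)\<^sup>2) powr (- p) = norm \<xi> powr (- \<alpha>)"
      using False by (simp add: p_def powr_powr flip: powr_numeral)
    also have "norm \<xi> powr \<alpha> * norm \<xi> powr (- \<alpha>) = 1" using False by (simp add: powr_minus)
    finally have "norm \<xi> powr \<alpha> * (Gamma p * (pi * (norm \<xi>)\<^sup>2) powr (- p)) = Gamma p * pi powr (- p)"
      by (simp add: mult.left_commute)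
    moreover have "pi * (norm \<xi>)\<^sup>2 > 0" using False by simp
    note has_bochner_integral_mult_right[OF power_weight_exp_integral[OF p this], of "norm \<xi> powr \<alpha>"]
    ultimately show ?thesis using False by (simp only: if_False)
  qed (auto intro: has_bochner_integral_zero)
  have F_int: "integrable lborel (F \<xi>)" for \<xi>
    unfolding F_def using has_bochner_integral_iff[THEN iffD1, OF inner] 
    by (intro integrable_mult_left) (simp only: complex_of_real_integrable_eq)
  have F_val: "(LINT \<tau>|lborel. F \<xi> \<tau>) = of_real (if \<xi> = 0 then 0 else Gamma p * pi powr (- p)) * M \<xi>" for \<xi>
    unfolding F_def integral_mult_left_zero integral_complex_of_real has_bochner_integral_integral_eq[OF inner] ..
  have F_norm: "(LINT \<tau>|lborel. norm (F \<xi> \<tau>)) = (if \<xi> = 0 then 0 else Gamma p * pi powr (- p)) * norm (M \<xi>)" for \<xi>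
  proof -
    have "norm (F \<xi> \<tau>) = (norm \<xi> powr \<alpha> * (power_weight p \<tau> * exp (- ((pi * (norm \<xi>)\<^sup>2) * \<tau>)))) * norm (M \<xi>)" for \<tau>
      unfolding F_def norm_mult norm_of_real by (simp add: abs_mult power_weight_nonneg)
    thus ?thesis by (simp only: integral_mult_left_zero has_bochner_integral_integral_eq[OF inner])
  qed
  have "(LINT \<tau>|lborel. of_real (power_weight p \<tau>) * (LINT y|lborel. g y * of_real (heat_mass B (\<tau> + s) y))) =
      (LINT \<tau>|lborel. LINT \<xi>|lborel. F \<xi> \<tau>)"
  proof (intro Bochner_Integration.integral_cong refl)
    fix \<tau> :: real
    show "of_real (power_weight p \<tau>) * (LINT y|lborel. g y * of_real (heat_mass B (\<tau> + s) y)) = (LINT \<xi>|lborel. F \<xi> \<tau>)"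
    proof (cases "\<tau> \<le> 0")
      case True
      thus ?thesis by (simp add: F_def power_weight_eq_0)
    next
      case False
      hence t: "\<tau> + s > 0" using s by simp
      have "(LINT y|lborel. g y * of_real (heat_mass B (\<tau> + s) y)) =
          (LINT \<xi>|lborel. ?m \<xi> * ?E (\<tau> + s) \<xi> * indicator_transform B \<xi>)"
        using \<alpha> by (intro heat_mass_pairing B t g integrable_fourier_gaussian u star) auto
      also have "of_real (power_weight p \<tau>) * \<dots> = (LINT \<xi>|lborel. F \<xi> \<tau>)"
        unfolding integral_mult_right_zero[symmetric]
      proof (intro Bochner_Integration.integral_cong refl)
        fix \<xi> :: "real ^ 'n"
        have "exp (- (pi * (\<tau> + s) * (norm \<xi>)\<^sup>2)) = exp (- ((pi * (norm \<xi>)\<^sup>2) * \<tau>)) * exp (- (pi * s * (norm \<xi>)\<^sup>2))"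
          by (simp add: algebra_simps flip: exp_add)
        thus "of_real (power_weight p \<tau>) * (?m \<xi> * ?E (\<tau> + s) \<xi> * indicator_transform B \<xi>) = F \<xi> \<tau>"
          unfolding F_def M_def by (simp only: of_real_mult mult_ac)
      qed
      finally show ?thesis .
    qed
  qed
  also have "\<dots> = (LINT \<xi>|lborel. LINT \<tau>|lborel. F \<xi> \<tau>)"
  proof (rule lborel_integral_swap)
    show "(\<lambda>(\<xi>, \<tau>). F \<xi> \<tau>) \<in> borel_measurable (borel \<Otimes>\<^sub>M borel)"
      unfolding F_def by measurable
    show "integrable lborel (F \<xi>)" for \<xi> by (rule F_int)
    show "integrable lborel (\<lambda>\<xi>. LINT \<tau>|lborel. norm (F \<xi> \<tau>))"
      unfolding F_norm
    proof (rule Bochner_Integration.integrable_bound)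
      show "integrable lborel (\<lambda>\<xi>. (Gamma p * pi powr (- p)) * norm (M \<xi>))"
        using M_int by (intro integrable_mult_right integrable_norm)
    qed (auto simp: Gamma_real_pos[OF p, THEN less_imp_le])
  qed
  also have "\<dots> = (LINT \<xi>|lborel. of_real (Gamma p * pi powr (- p)) * M \<xi>)"
    unfolding F_val
  proof (rule integral_cong_AE)
    have "AE \<xi> in lborel. \<xi> \<noteq> (0 :: real ^ 'n)" by (rule AE_lborel_singleton)
    thus "AE \<xi> in lborel. of_real (if \<xi> = 0 then 0 else Gamma p * pi powr (- p)) * M \<xi> = of_real (Gamma p * pi powr (- p)) * M \<xi>"
      by eventually_elim simp
  qed measurable
  also have "\<dots> = of_real (Gamma p * pi powr (- p)) * (LINT \<xi>|lborel. M \<xi>)" by simp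
  also have "(LINT \<xi>|lborel. M \<xi>) = (LINT y|lborel. u y * of_real (heat_mass B s y))"
    unfolding M_def using \<alpha>
    by (intro heat_mass_pairing[symmetric] B s u integrable_fourier_gaussian(2)[of _ _ \<alpha>] heat_kernel_convolution_fourier) auto
  finally show ?thesis by (simp only: p_def)
qed

text \<open>Boxes form an intersection-stable generator of the Borel sets. Localizing f to one box
  makes it integrable, so vanishing of the integrals extends to all Borel sets by induction over
  disjoint unions; countably many boxes then exhaust the space.\<close>

lemma AE_eq_0_if_box_integrals_0:
  fixes f :: "'a::euclidean_space \<Rightarrow> complex"
  assumes int: "\<And>a b. integrable lborel (\<lambda>x. indicator (box a b) x *\<^sub>R f x)"
    and zero: "\<And>a b. (LINT x|lborel. indicator (box a b) x *\<^sub>R f x) = 0"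
  shows "AE x in lborel. f x = 0"
proof -
  have *: "AE x in lborel. indicator (box a b) x *\<^sub>R f x = 0" for a b
  proof (rule sigma_finite_measure.density_zero[OF sigma_finite_lborel int])
    let ?h = "\<lambda>x. indicator (box a b) x *\<^sub>R f x"
    let ?G = "range (\<lambda>(a, b). box a b :: 'a set)"
    fix A :: "'a set" assume "A \<in> sets lborel"
    hence A: "A \<in> sigma_sets UNIV ?G"
      by (simp add: borel_eq_box)
    have sets: "X \<in> sets lborel" if "X \<in> sigma_sets UNIV ?G" for X
      using that by (simp add: borel_eq_box)
    have stable: "Int_stable ?G"
    proof (rule Int_stableI)
      fix X Y assume "X \<in> ?G" "Y \<in> ?G"
      then obtain p q r s where "X = box p q" "Y = box r s" by auto
      thus "X \<inter> Y \<in> ?G" using box_Int_box[of p q r s] by auto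
    qed
    have sub: "?G \<subseteq> Pow UNIV" by simp
    from stable sub A show "set_lebesgue_integral lborel A ?h = 0"
    proof (induction rule: sigma_sets_induct_disjoint)
      case (basic A)
      then obtain c d where A: "A = box c d" by auto
      obtain e e' where e: "box a b \<inter> box c d = box e e'" using box_Int_box by blast
      have "(\<lambda>x. indicator A x *\<^sub>R ?h x) = (\<lambda>x. indicator (box e e') x *\<^sub>R f x)"
        unfolding e[symmetric] A by (auto simp: indicator_def)
      thus ?case unfolding set_lebesgue_integral_def by (simp only: zero)
    next
      case empty
      show ?case by (simp add: set_lebesgue_integral_def)
    next
      case (compl A)
      have A: "A \<in> sets lborel" using compl sets by blast
      have "indicator (UNIV - A) x *\<^sub>R ?h x = ?h x - indicator A x *\<^sub>R ?h x" for x
        by (auto simp: indicator_def)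
      moreover have "integrable lborel (\<lambda>x. indicator A x *\<^sub>R ?h x)"
        by (rule integrable_mult_indicator[OF A int])
      ultimately show ?case
        using compl int zero unfolding set_lebesgue_integral_def by simp
    next
      case (union F)
      have F: "F i \<in> sets lborel" for i using union sets by blast
      have "set_lebesgue_integral lborel (\<Union>i. F i) ?h = (\<Sum>i. set_lebesgue_integral lborel (F i) ?h)"
      proof (rule lebesgue_integral_countable_add)
        show "set_integrable lborel (\<Union>i. F i) ?h"
          unfolding set_integrable_def by (rule integrable_mult_indicator[OF _ int]) (use F in auto)
      qed (use F union in \<open>auto simp: disjoint_family_on_def\<close>)
      thus ?case using union by simp
    qed
  qed
  have "AE x in lborel. \<forall>k::nat. indicator (box (- (real k *\<^sub>R One)) (real k *\<^sub>R One)) x *\<^sub>R f x = 0"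
    unfolding AE_all_countable using * by blast
  thus ?thesis
  proof eventually_elim
    case (elim x)
    obtain k :: nat where k: "norm x < real k" using reals_Archimedean2 by blast
    have "x \<in> box (- (real k *\<^sub>R One)) (real k *\<^sub>R One)"
      using k Basis_le_norm[of _ x] by (force simp: mem_box abs_less_iff)
    thus ?case using elim[rule_format, of k] by simp
  qed
qed

text \<open>The shift in \<open>heat_mass_subordination\<close> tends to 0. The shifted times stay
  above \<tau> and the heat bound decreases in time, so the bound at \<tau> dominates all of them;
  on the u side the averages tend to the indicator off the frontier of B.\<close>

lemma subordination_integral:
  fixes u g :: "real ^ 'n \<Rightarrow> complex"
  assumes u: "integrable lborel u" and g: "integrable lborel g" and \<alpha>: "0 < \<alpha>" "\<alpha> < real CARD('n)"
    and B: "B \<in> sets borel" "emeasure lborel B < \<infinity>" and fr: "AE y in lborel. y \<notin> frontier B"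
    and star: "\<And>t a. t > 0 \<Longrightarrow> (LINT y|lborel. g y * of_real (heat_kernel t (a - y))) =
      (LINT \<xi>|lborel. of_real (norm \<xi> powr \<alpha>) * fourier u \<xi> * modulated_gaussian t a \<xi>)"
  shows "of_real (Gamma (\<alpha> / 2) * pi powr (- (\<alpha> / 2))) * (LINT y|lborel. u y * of_real (indicator B y)) =
     (LINT \<tau>|lborel. of_real (power_weight (\<alpha> / 2) \<tau>) * (LINT y|lborel. g y * of_real (heat_mass B \<tau> y)))"
proof (rule LIMSEQ_unique)
  define s where "s = (\<lambda>k. inverse (real (Suc k)))"
  have s: "s \<longlonglongrightarrow> 0" "\<And>k. s k > 0" unfolding s_def by (rule LIMSEQ_inverse_real_of_nat) simp
  have [measurable]: "u \<in> borel_measurable borel" "g \<in> borel_measurable borel" "B \<in> sets borel"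
    using u g B by (auto dest: borel_measurable_integrable)
  let ?A = "complex_of_real (Gamma (\<alpha> / 2) * pi powr (- (\<alpha> / 2)))"
  let ?D = "\<lambda>\<tau>. min 1 (measure lborel B * \<tau> powr (- (real CARD('n) / 2)))"
  let ?N = "LINT y|lborel. norm (g y)"
  note hm_le = heat_mass_le[OF B] and hm_nonneg = heat_mass_nonneg[OF B]
  have D_mono: "?D t \<le> ?D \<tau>" if "0 < \<tau>" "\<tau> \<le> t" for t \<tau>
  proof -
    have "measure lborel B * t powr (- (real CARD('n) / 2)) \<le> measure lborel B * \<tau> powr (- (real CARD('n) / 2))"
      using that by (intro mult_left_mono powr_mono2') auto
    thus ?thesis by (intro min.mono) auto
  qed
  have bound: "norm (LINT y|lborel. g y * of_real (heat_mass B t y)) \<le> ?N * ?D \<tau>" if "0 < \<tau>" "\<tau> \<le> t" for t \<tau>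
  proof -
    have "norm (LINT y|lborel. g y * of_real (heat_mass B t y)) \<le> (LINT y|lborel. norm (g y) * ?D \<tau>)"
    proof (rule Bochner_Integration.integral_norm_bound_integral)
      have le: "norm (g y * of_real (heat_mass B t y)) \<le> norm (g y) * ?D \<tau>" for y
      proof -
        have "heat_mass B t y \<le> ?D \<tau>" using hm_le[of t y] D_mono[OF that] that by linarith
        thus ?thesis using hm_nonneg[of t y] by (simp add: norm_mult mult_left_mono)
      qed
      show "integrable lborel (\<lambda>y. norm (g y) * ?D \<tau>)"
        using g by (intro integrable_mult_left integrable_norm)
      thus "integrable lborel (\<lambda>y. g y * of_real (heat_mass B t y))"
        by (rule Bochner_Integration.integrable_bound)
           (measurable, intro AE_I2 order.trans[OF le], simp only: real_norm_def abs_ge_self)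
      show "norm (g y * of_real (heat_mass B t y)) \<le> norm (g y) * ?D \<tau>" for y by (rule le)
    qed
    thus ?thesis by simp
  qed
  show "(\<lambda>k. ?A * (LINT y|lborel. u y * of_real (heat_mass B (s k) y))) \<longlonglongrightarrow> ?A * (LINT y|lborel. u y * of_real (indicator B y))"
  proof (intro tendsto_mult tendsto_const integral_dominated_convergence)
    show "integrable lborel (\<lambda>y. norm (u y))" using u by simp
    show "AE y in lborel. (\<lambda>k. u y * complex_of_real (heat_mass B (s k) y)) \<longlonglongrightarrow> u y * of_real (indicator B y)"
      using fr by eventually_elim (intro tendsto_intros heat_mass_tendsto_indicator B s)
    show "AE y in lborel. norm (u y * complex_of_real (heat_mass B (s k) y)) \<le> norm (u y)" for k
      using hm_le[OF s(2)[of k]] hm_nonneg[of "s k"]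
      by (intro AE_I2) (simp add: norm_mult mult_left_le)
  qed measurable
  have "(\<lambda>k. LINT \<tau>|lborel. of_real (power_weight (\<alpha> / 2) \<tau>) * (LINT y|lborel. g y * of_real (heat_mass B (\<tau> + s k) y))) \<longlonglongrightarrow>
     (LINT \<tau>|lborel. of_real (power_weight (\<alpha> / 2) \<tau>) * (LINT y|lborel. g y * of_real (heat_mass B \<tau> y)))"
  proof (rule integral_dominated_convergence[where w = "\<lambda>\<tau>. power_weight (\<alpha> / 2) \<tau> * ?D \<tau> * ?N"])
    show "integrable lborel (\<lambda>\<tau>. power_weight (\<alpha> / 2) \<tau> * ?D \<tau> * ?N)"
      using \<alpha> by (intro integrable_mult_left integrable_power_weight_min) auto
    show "AE \<tau> in lborel. (\<lambda>k. of_real (power_weight (\<alpha> / 2) \<tau>) * (LINT y|lborel. g y * of_real (heat_mass B (\<tau> + s k) y)))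
        \<longlonglongrightarrow> of_real (power_weight (\<alpha> / 2) \<tau>) * (LINT y|lborel. g y * of_real (heat_mass B \<tau> y))"
    proof (intro AE_I2)
      fix \<tau> :: real
      show "(\<lambda>k. of_real (power_weight (\<alpha> / 2) \<tau>) * (LINT y|lborel. g y * of_real (heat_mass B (\<tau> + s k) y)))
        \<longlonglongrightarrow> of_real (power_weight (\<alpha> / 2) \<tau>) * (LINT y|lborel. g y * of_real (heat_mass B \<tau> y))"
      proof (cases "\<tau> \<le> 0")
        case False
        have lim: "(\<lambda>k. \<tau> + s k) \<longlonglongrightarrow> \<tau>" using tendsto_add[OF tendsto_const s(1), of \<tau>] by simp
        have ge: "\<tau> + s k \<ge> \<tau>" "\<tau> + s k > 0" for k using s(2)[of k] False by auto
        show ?thesis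
        proof (intro tendsto_mult tendsto_const integral_dominated_convergence)
          show "integrable lborel (\<lambda>y. norm (g y))" using g by simp
          show "AE y in lborel. (\<lambda>k. g y * complex_of_real (heat_mass B (\<tau> + s k) y)) \<longlonglongrightarrow> g y * of_real (heat_mass B \<tau> y)"
            using False by (intro AE_I2 tendsto_intros heat_mass_tendsto B lim ge) auto
          show "AE y in lborel. norm (g y * complex_of_real (heat_mass B (\<tau> + s k) y)) \<le> norm (g y)" for k
            using hm_le[OF ge(2)[of k]] hm_nonneg[of "\<tau> + s k"]
            by (intro AE_I2) (simp add: norm_mult mult_left_le)
        qed measurable
      qed (simp add: power_weight_eq_0)
    qed
    show "AE \<tau> in lborel. norm (of_real (power_weight (\<alpha> / 2) \<tau>) * (LINT y|lborel. g y * of_real (heat_mass B (\<tau> + s k) y)))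
       \<le> power_weight (\<alpha> / 2) \<tau> * ?D \<tau> * ?N" for k
    proof (intro AE_I2)
      fix \<tau> :: real
      show "norm (of_real (power_weight (\<alpha> / 2) \<tau>) * (LINT y|lborel. g y * of_real (heat_mass B (\<tau> + s k) y)))
       \<le> power_weight (\<alpha> / 2) \<tau> * ?D \<tau> * ?N"
      proof (cases "\<tau> \<le> 0")
        case False
        have "norm (of_real (power_weight (\<alpha> / 2) \<tau>) * (LINT y|lborel. g y * of_real (heat_mass B (\<tau> + s k) y)))
          \<le> power_weight (\<alpha> / 2) \<tau> * (?N * ?D \<tau>)"
          unfolding norm_mult norm_of_real using False s(2)[of k]
          by (intro mult_mono bound) (auto simp: power_weight_nonneg)
        thus ?thesis by (simp only: mult_ac)
      qed (simp add: power_weight_eq_0)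
    qed
  qed measurable
  thus "(\<lambda>k. ?A * (LINT y|lborel. u y * of_real (heat_mass B (s k) y))) \<longlonglongrightarrow>
     (LINT \<tau>|lborel. of_real (power_weight (\<alpha> / 2) \<tau>) * (LINT y|lborel. g y * of_real (heat_mass B \<tau> y)))"
    by (simp only: heat_mass_subordination[OF u g \<alpha>(1) s(2) B star])
qed

text \<open>Pure homogeneity: substituting |x|^2 \<tau> for \<tau> extracts the power of |x|, and
  the remaining integral is a constant left unevaluated. With p = \<alpha>/2 the power is the Riesz
  kernel |x|^(\<alpha> - n).\<close>

lemma nn_integral_power_weight_heat_kernel:
  fixes x :: "real ^ 'n"
  assumes "x \<noteq> 0"
  shows "(\<integral>\<^sup>+\<tau>. ennreal (power_weight p \<tau> * heat_kernel \<tau> x) \<partial>lborel) =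
    ennreal (norm x powr (2 * p - real CARD('n))) *
    (\<integral>\<^sup>+\<tau>. ennreal (power_weight p \<tau> * (\<tau> powr (- (real CARD('n) / 2)) * exp (- (pi / \<tau>)))) \<partial>lborel)"
proof -
  define r where "r = (norm x)\<^sup>2"
  have r: "r > 0" using assms by (simp add: r_def)
  let ?n = "real CARD('n)"
  let ?f = "\<lambda>\<tau>. power_weight p \<tau> * (\<tau> powr (- (?n / 2)) * exp (- (pi / \<tau>)))"
  have "ennreal r * ennreal (power_weight p (r * \<tau>) * heat_kernel (r * \<tau>) x) =
        ennreal (norm x powr (2 * p - ?n)) * ennreal (?f \<tau>)" for \<tau>
  proof (cases "\<tau> \<le> 0")
    case True
    thus ?thesis using r by (simp add: power_weight_eq_0 mult_nonneg_nonpos)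
  next
    case False
    have "r * (r powr (p - 1) * r powr (- (?n / 2))) = r powr (p - ?n / 2)"
    proof -
      have "r * (r powr (p - 1) * r powr (- (?n / 2))) = r powr 1 * (r powr (p - 1) * r powr (- (?n / 2)))"
        using r by simp
      also have "\<dots> = r powr (p - ?n / 2)" by (simp only: powr_add[symmetric]) simp
      finally show ?thesis .
    qed
    also have "\<dots> = norm x powr (2 * p - ?n)"
      using assms by (simp add: r_def powr_powr flip: powr_numeral)
    finally have eq: "r * (r powr (p - 1) * r powr (- (?n / 2))) = norm x powr (2 * p - ?n)" .
    have "heat_kernel (r * \<tau>) x = r powr (- (?n / 2)) * (\<tau> powr (- (?n / 2)) * exp (- (pi / \<tau>)))"
      using r False by (simp add: heat_kernel_def powr_mult r_def[symmetric])
    hence "r * (power_weight p (r * \<tau>) * heat_kernel (r * \<tau>) x) = norm x powr (2 * p - ?n) * ?f \<tau>"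
      unfolding eq[symmetric] power_weight_scale[OF r] by (simp only: mult_ac)
    thus ?thesis using r
      by (simp add: ennreal_mult'[symmetric] )
  qed
  hence "(\<integral>\<^sup>+\<tau>. ennreal r * ennreal (power_weight p (r * \<tau>) * heat_kernel (r * \<tau>) x) \<partial>lborel) =
      (\<integral>\<^sup>+\<tau>. ennreal (norm x powr (2 * p - ?n)) * ennreal (?f \<tau>) \<partial>lborel)" by simp
  moreover have "(\<integral>\<^sup>+\<tau>. ennreal (power_weight p \<tau> * heat_kernel \<tau> x) \<partial>lborel) =
     (\<integral>\<^sup>+\<tau>. ennreal r * ennreal (power_weight p (r * \<tau>) * heat_kernel (r * \<tau>) x) \<partial>lborel)"
    using r by (subst nn_integral_real_affine[of _ r 0]) (auto simp: nn_integral_cmult)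
  ultimately show ?thesis by (simp add: nn_integral_cmult)
qed

lemma nn_integral_heat_mass:
  fixes B :: "(real ^ 'n) set"
  assumes B: "B \<in> sets borel" "emeasure lborel B < \<infinity>"
  shows "(\<integral>\<^sup>+\<tau>. ennreal (power_weight p \<tau> * heat_mass B \<tau> y) \<partial>lborel) =
    (\<integral>\<^sup>+a. indicator B a * (ennreal (norm (a - y) powr (2 * p - real CARD('n))) *
      (\<integral>\<^sup>+\<tau>. ennreal (power_weight p \<tau> * (\<tau> powr (- (real CARD('n) / 2)) * exp (- (pi / \<tau>)))) \<partial>lborel)) \<partial>lborel)"
proof -
  have [measurable]: "B \<in> sets borel" by fact
  have "(\<integral>\<^sup>+\<tau>. ennreal (power_weight p \<tau> * heat_mass B \<tau> y) \<partial>lborel) =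
     (\<integral>\<^sup>+\<tau>. \<integral>\<^sup>+a. indicator B a * ennreal (power_weight p \<tau> * heat_kernel \<tau> (a - y)) \<partial>lborel \<partial>lborel)"
  proof (intro nn_integral_cong)
    fix \<tau> :: real
    show "ennreal (power_weight p \<tau> * heat_mass B \<tau> y) =
       (\<integral>\<^sup>+a. indicator B a * ennreal (power_weight p \<tau> * heat_kernel \<tau> (a - y)) \<partial>lborel)"
    proof (cases "\<tau> \<le> 0")
      case False
      hence "ennreal (heat_mass B \<tau> y) = (\<integral>\<^sup>+a. ennreal (indicator B a * heat_kernel \<tau> (a - y)) \<partial>lborel)"
        unfolding heat_mass_def using B
        by (intro nn_integral_eq_integral[symmetric] integrable_indicator_heat_kernel) (auto simp: heat_kernel_nonneg)
      hence "ennreal (power_weight p \<tau>) * ennreal (heat_mass B \<tau> y) =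
         (\<integral>\<^sup>+a. ennreal (power_weight p \<tau>) * ennreal (indicator B a * heat_kernel \<tau> (a - y)) \<partial>lborel)"
        by (simp add: nn_integral_cmult)
      also have "\<dots> = (\<integral>\<^sup>+a. indicator B a * ennreal (power_weight p \<tau> * heat_kernel \<tau> (a - y)) \<partial>lborel)"
        by (intro nn_integral_cong) (auto simp: indicator_def ennreal_mult power_weight_nonneg heat_kernel_nonneg)
      finally show ?thesis by (simp add: ennreal_mult power_weight_nonneg heat_mass_nonneg[OF B])
    qed (simp add: power_weight_eq_0)
  qed
  also have "\<dots> = (\<integral>\<^sup>+a. \<integral>\<^sup>+\<tau>. indicator B a * ennreal (power_weight p \<tau> * heat_kernel \<tau> (a - y)) \<partial>lborel \<partial>lborel)"
    by (rule lborel_pair.Fubini') measurable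
  also have "\<dots> = (\<integral>\<^sup>+a. indicator B a * (\<integral>\<^sup>+\<tau>. ennreal (power_weight p \<tau> * heat_kernel \<tau> (a - y)) \<partial>lborel) \<partial>lborel)"
    by (simp add: nn_integral_cmult)
  also have "\<dots> = (\<integral>\<^sup>+a. indicator B a * (ennreal (norm (a - y) powr (2 * p - real CARD('n))) *
      (\<integral>\<^sup>+\<tau>. ennreal (power_weight p \<tau> * (\<tau> powr (- (real CARD('n) / 2)) * exp (- (pi / \<tau>)))) \<partial>lborel)) \<partial>lborel)"
  proof (rule nn_integral_cong_AE)
    have "AE a in lborel. a \<noteq> y" by (rule AE_lborel_singleton)
    thus "AE a in lborel. indicator B a * (\<integral>\<^sup>+\<tau>. ennreal (power_weight p \<tau> * heat_kernel \<tau> (a - y)) \<partial>lborel) =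
       indicator B a * (ennreal (norm (a - y) powr (2 * p - real CARD('n))) *
      (\<integral>\<^sup>+\<tau>. ennreal (power_weight p \<tau> * (\<tau> powr (- (real CARD('n) / 2)) * exp (- (pi / \<tau>)))) \<partial>lborel))"
      by eventually_elim (simp add: nn_integral_power_weight_heat_kernel)
  qed
  finally show ?thesis .
qed

text \<open>Finiteness follows from that of the superposition averaged over a ball, so no value of the constant
  is needed.\<close>

lemma riesz_constant:
  assumes \<alpha>: "0 < \<alpha>" "\<alpha> < real CARD('n :: finite)"
  shows "\<exists>c>0. (\<integral>\<^sup>+\<tau>. ennreal (power_weight (\<alpha> / 2) \<tau> * (\<tau> powr (- (real CARD('n) / 2)) * exp (- (pi / \<tau>)))) \<partial>lborel) = ennreal c"
proof -
  let ?I = "\<integral>\<^sup>+\<tau>. ennreal (power_weight (\<alpha> / 2) \<tau> * (\<tau> powr (- (real CARD('n) / 2)) * exp (- (pi / \<tau>)))) \<partial>lborel"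
  define B where "B = (ball 0 1 :: (real ^ 'n) set)"
  have B: "B \<in> sets borel" "emeasure lborel B < \<infinity>"
    using emeasure_bounded_finite[of B] by (auto simp: B_def)
  have [measurable]: "B \<in> sets borel" by fact
  let ?D = "\<lambda>\<tau>. min 1 (measure lborel B * \<tau> powr (- (real CARD('n) / 2)))"
  have "(\<integral>\<^sup>+\<tau>. ennreal (power_weight (\<alpha> / 2) \<tau> * heat_mass B \<tau> 0) \<partial>lborel) \<le> (\<integral>\<^sup>+\<tau>. ennreal (power_weight (\<alpha> / 2) \<tau> * ?D \<tau>) \<partial>lborel)"
  proof (intro nn_integral_mono ennreal_leI)
    fix \<tau> show "power_weight (\<alpha> / 2) \<tau> * heat_mass B \<tau> 0 \<le> power_weight (\<alpha> / 2) \<tau> * ?D \<tau>"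
      using heat_mass_le[OF B, of \<tau> 0] power_weight_nonneg[of "\<alpha> / 2" \<tau>]
      by (cases "\<tau> \<le> 0") (auto simp: power_weight_eq_0 intro!: mult_left_mono)
  qed
  also have "\<dots> < \<infinity>"
    using integrable_power_weight_min[of "\<alpha> / 2" "real CARD('n) / 2" "measure lborel B"] \<alpha>
    by (subst nn_integral_eq_integral) (auto simp: power_weight_nonneg)
  finally have fin: "(\<integral>\<^sup>+a. indicator B a * (ennreal (norm (a - 0) powr (2 * (\<alpha> / 2) - real CARD('n))) * ?I) \<partial>lborel) < \<infinity>"
    unfolding nn_integral_heat_mass[OF B] .
  have "AE a in lborel. indicator B a * (ennreal (norm (a - 0) powr (2 * (\<alpha> / 2) - real CARD('n))) * ?I) \<noteq> \<infinity>"
    by (rule nn_integral_PInf_AE) (use fin in auto)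
  moreover have "AE a in lborel. a \<noteq> (0 :: real ^ 'n)" by (rule AE_lborel_singleton)
  ultimately have "AE a in lborel. a \<in> B \<longrightarrow> ?I \<noteq> \<infinity>"
  proof eventually_elim
    case (elim a)
    have "ennreal (norm a powr (\<alpha> - real CARD('n))) \<noteq> 0" using elim by (simp add: ennreal_eq_0_iff powr_nonneg_iff not_le)
    thus ?case using elim by (auto simp: ennreal_mult_eq_top_iff)
  qed
  hence I_fin: "?I \<noteq> \<infinity>"
  proof (rule contrapos_pn)
    assume "?I = \<infinity>"
    show "\<not> (AE a in lborel. a \<in> B \<longrightarrow> ?I \<noteq> \<infinity>)"
    proof
      assume "AE a in lborel. a \<in> B \<longrightarrow> ?I \<noteq> \<infinity>"
      hence "AE a in lborel. a \<notin> B" using \<open>?I = \<infinity>\<close> by simp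
      hence "emeasure lborel B = 0" by (subst (asm) AE_iff_measurable[of B]) auto
      thus False using content_ball_pos[of 1 "0 :: real ^ 'n"] by (simp add: B_def measure_def)
    qed
  qed
  have "?I \<noteq> 0"
  proof
    assume "?I = 0"
    hence "AE \<tau> in lborel. ennreal (power_weight (\<alpha> / 2) \<tau> * (\<tau> powr (- (real CARD('n) / 2)) * exp (- (pi / \<tau>)))) = 0"
      by (subst (asm) nn_integral_0_iff_AE) auto
    hence "AE \<tau> in lborel. \<tau> \<notin> {1..2::real}"
    proof eventually_elim
      case (elim \<tau>)
      show ?case
      proof
        assume "\<tau> \<in> {1..2}"
        hence "0 < power_weight (\<alpha> / 2) \<tau> * (\<tau> powr (- (real CARD('n) / 2)) * exp (- (pi / \<tau>)))"
          by (simp add: power_weight_def)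
        thus False using elim by (simp add: ennreal_eq_0_iff)
      qed
    qed
    hence "emeasure lborel {1..2::real} = 0"
      by (subst (asm) AE_iff_measurable[of "{1..2}"]) auto
    thus False by simp
  qed
  thus ?thesis using I_fin
    by (intro exI[of _ "enn2real ?I"]) (auto simp: enn2real_positive_iff less_top ennreal_enn2real zero_less_iff_neq_zero)
qed

text \<open>The second bound is uniform in y: it is what makes the kernel averaged over B integrable
  against an arbitrary integrable g.\<close>

lemma heat_mass_superposition:
  assumes \<alpha>: "0 < \<alpha>" "\<alpha> < real CARD('n)" and c: "c > 0"
    and c_eq: "(\<integral>\<^sup>+\<tau>. ennreal (power_weight (\<alpha> / 2) \<tau> * (\<tau> powr (- (real CARD('n) / 2)) * exp (- (pi / \<tau>)))) \<partial>lborel) = ennreal c"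
    and B: "B \<in> sets borel" "emeasure lborel B < \<infinity>"
  shows "has_bochner_integral lborel (\<lambda>a. indicator B a * (c * norm (a - y) powr (\<alpha> - real CARD('n))))
           (LINT \<tau>|lborel. power_weight (\<alpha> / 2) \<tau> * heat_mass B \<tau> (y :: real ^ 'n))"
    and "(LINT \<tau>|lborel. power_weight (\<alpha> / 2) \<tau> * heat_mass B \<tau> y) \<le>
         (LINT \<tau>|lborel. power_weight (\<alpha> / 2) \<tau> * min 1 (measure lborel B * \<tau> powr (- (real CARD('n) / 2))))"
proof -
  have [measurable]: "B \<in> sets borel" by fact
  let ?D = "\<lambda>\<tau>. min 1 (measure lborel B * \<tau> powr (- (real CARD('n) / 2)))"
  have D_int: "integrable lborel (\<lambda>\<tau>. power_weight (\<alpha> / 2) \<tau> * ?D \<tau>)"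
    using \<alpha> by (intro integrable_power_weight_min) auto
  have le: "power_weight (\<alpha> / 2) \<tau> * heat_mass B \<tau> y \<le> power_weight (\<alpha> / 2) \<tau> * ?D \<tau>" for \<tau>
    using heat_mass_le[OF B, of \<tau> y] power_weight_nonneg[of "\<alpha> / 2" \<tau>]
    by (cases "\<tau> \<le> 0") (auto simp: power_weight_eq_0 intro!: mult_left_mono)
  have nonneg: "0 \<le> power_weight (\<alpha> / 2) \<tau> * heat_mass B \<tau> y" for \<tau>
    by (intro mult_nonneg_nonneg power_weight_nonneg heat_mass_nonneg B)
  have int: "integrable lborel (\<lambda>\<tau>. power_weight (\<alpha> / 2) \<tau> * heat_mass B \<tau> y)"
    by (rule Bochner_Integration.integrable_bound[OF D_int])
       (measurable, intro AE_I2, use le nonneg in \<open>simp add: abs_of_nonneg order.trans[OF le abs_ge_self]\<close>)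
  show "(LINT \<tau>|lborel. power_weight (\<alpha> / 2) \<tau> * heat_mass B \<tau> y) \<le> (LINT \<tau>|lborel. power_weight (\<alpha> / 2) \<tau> * ?D \<tau>)"
    by (intro integral_mono int D_int le)
  show "has_bochner_integral lborel (\<lambda>a. indicator B a * (c * norm (a - y) powr (\<alpha> - real CARD('n))))
           (LINT \<tau>|lborel. power_weight (\<alpha> / 2) \<tau> * heat_mass B \<tau> y)"
  proof (rule has_bochner_integral_nn_integral)
    show "(\<integral>\<^sup>+a. ennreal (indicator B a * (c * norm (a - y) powr (\<alpha> - real CARD('n)))) \<partial>lborel) =
      ennreal (LINT \<tau>|lborel. power_weight (\<alpha> / 2) \<tau> * heat_mass B \<tau> y)"
    proof -
      have "ennreal (LINT \<tau>|lborel. power_weight (\<alpha> / 2) \<tau> * heat_mass B \<tau> y) =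
         (\<integral>\<^sup>+\<tau>. ennreal (power_weight (\<alpha> / 2) \<tau> * heat_mass B \<tau> y) \<partial>lborel)"
        using int nonneg by (intro nn_integral_eq_integral[symmetric]) auto
      also have "\<dots> = (\<integral>\<^sup>+a. indicator B a * (ennreal (norm (a - y) powr (\<alpha> - real CARD('n))) * ennreal c) \<partial>lborel)"
        unfolding nn_integral_heat_mass[OF B] c_eq by simp
      also have "\<dots> = (\<integral>\<^sup>+a. ennreal (indicator B a * (c * norm (a - y) powr (\<alpha> - real CARD('n)))) \<partial>lborel)"
        using c by (intro nn_integral_cong) (auto simp: indicator_def ennreal_mult[symmetric] mult.commute)
      finally show ?thesis ..
    qed
  qed (use c nonneg in auto)
qed

text \<open>The identity is tested on boxes: over a box it is \<open>subordination_integral\<close>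
  followed by Fubini, and the same Fubini argument gives absolute convergence of the potential at
  almost every point of the box. The constant is c / A, where A is the Gamma factor of the
  subordination and c the constant of the superposition.\<close>

lemma riesz_representation:
  fixes u g :: "real ^ 'n \<Rightarrow> complex"
  assumes u: "integrable lborel u" and g: "integrable lborel g" and \<alpha>: "0 < \<alpha>" "\<alpha> < real CARD('n)"
    and star: "\<And>t a. t > 0 \<Longrightarrow> (LINT y|lborel. g y * of_real (heat_kernel t (a - y))) =
      (LINT \<xi>|lborel. of_real (norm \<xi> powr \<alpha>) * fourier u \<xi> * modulated_gaussian t a \<xi>)"
  shows "\<exists>C>0. (AE x in lborel. integrable lborel (\<lambda>y. g y * of_real (norm (x - y) powr (\<alpha> - real CARD('n)))) \<and>
    u x = of_real C * (LINT y|lborel. g y * of_real (norm (x - y) powr (\<alpha> - real CARD('n)))))"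
proof -
  obtain c where c: "c > 0" and c_eq:
    "(\<integral>\<^sup>+\<tau>. ennreal (power_weight (\<alpha> / 2) \<tau> * (\<tau> powr (- (real CARD('n) / 2)) * exp (- (pi / \<tau>)))) \<partial>lborel) = ennreal c"
    using riesz_constant[OF \<alpha>] by blast
  have [measurable]: "g \<in> borel_measurable borel" "u \<in> borel_measurable borel" using u g by (auto dest: borel_measurable_integrable)
  define A where "A = Gamma (\<alpha> / 2) * pi powr (- (\<alpha> / 2))"
  have A: "A > 0" using \<alpha> by (simp add: A_def Gamma_real_pos)
  define k where "k = (\<lambda>z :: real ^ 'n. c * norm z powr (\<alpha> - real CARD('n)))"
  have k_eq: "c * norm z powr (\<alpha> - real CARD('n)) = k z" for z by (simp add: k_def)
  have [measurable]: "k \<in> borel_measurable borel" unfolding k_def by measurable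
  define R where "R = (\<lambda>x. LINT y|lborel. g y * of_real (k (x - y)))"
  have main: "integrable lborel (\<lambda>x. indicator B x *\<^sub>R (of_real A * u x - R x))"
     "(LINT x|lborel. indicator B x *\<^sub>R (of_real A * u x - R x)) = 0"
     "AE x in lborel. x \<in> B \<longrightarrow> integrable lborel (\<lambda>y. g y * of_real (k (x - y)))"
    if B: "B \<in> sets borel" "emeasure lborel B < \<infinity>" and fr: "AE y in lborel. y \<notin> frontier B" for B
  proof -
    have [measurable]: "B \<in> sets borel" by fact
    let ?D = "\<lambda>\<tau>. min 1 (measure lborel B * \<tau> powr (- (real CARD('n) / 2)))"
    let ?h = "\<lambda>y. LINT \<tau>|lborel. power_weight (\<alpha> / 2) \<tau> * heat_mass B \<tau> y"
    note sup = heat_mass_superposition[OF \<alpha> c c_eq B, unfolded k_eq]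
    define F where "F = (\<lambda>y a. g y * complex_of_real (indicator B a * k (a - y)))"
    have F_meas [measurable]: "(\<lambda>(y, a). F y a) \<in> borel_measurable (borel \<Otimes>\<^sub>M borel)"
      unfolding F_def by measurable
    have F_int1: "integrable lborel (F y)" for y
      unfolding F_def using sup(1)[of y, THEN integrable.intros]
      by (intro integrable_mult_right) (simp only: complex_of_real_integrable_eq)
    have F_norm: "(LINT a|lborel. norm (F y a)) = norm (g y) * ?h y" for y
    proof -
      have "norm (F y a) = norm (g y) * (indicator B a * k (a - y))" for a
        using c by (simp add: F_def norm_mult k_def abs_mult)
      thus ?thesis by (simp add: has_bochner_integral_integral_eq[OF sup(1)])
    qed
    have F_pair: "integrable (lborel \<Otimes>\<^sub>M lborel) (\<lambda>(y, a). F y a)"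
    proof (rule lborel_pair.Fubini_integrable)
      have "integrable lborel (\<lambda>y. norm (g y) * ?h y)"
      proof (rule Bochner_Integration.integrable_bound)
        show "integrable lborel (\<lambda>y. norm (g y) * (LINT \<tau>|lborel. power_weight (\<alpha> / 2) \<tau> * ?D \<tau>))"
          using g by (intro integrable_mult_left integrable_norm)
        show "AE y in lborel. norm (norm (g y) * ?h y) \<le> norm (norm (g y) * (LINT \<tau>|lborel. power_weight (\<alpha> / 2) \<tau> * ?D \<tau>))"
        proof (intro AE_I2)
          fix y
          have "0 \<le> ?h y" by (intro integral_nonneg_AE AE_I2 mult_nonneg_nonneg power_weight_nonneg heat_mass_nonneg B)
          thus "norm (norm (g y) * ?h y) \<le> norm (norm (g y) * (LINT \<tau>|lborel. power_weight (\<alpha> / 2) \<tau> * ?D \<tau>))"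
            using sup(2)[of y] unfolding norm_mult by (intro mult_left_mono) auto
        qed
      qed measurable
      thus "integrable lborel (\<lambda>y. LINT a|lborel. norm (case (y, a) of (y, a) \<Rightarrow> F y a))"
        by (simp only: case_prod_conv F_norm)
      show "AE y in lborel. integrable lborel (\<lambda>a. case (y, a) of (y, a) \<Rightarrow> F y a)"
        using F_int1 by simp
    qed measurable
    have RF: "(LINT y|lborel. F y a) = indicator B a *\<^sub>R R a" for a
      unfolding F_def R_def by (auto simp: indicator_def)
    have int_R: "integrable lborel (\<lambda>a. indicator B a *\<^sub>R R a)"
      using lborel_pair.integrable_snd[OF F_pair] by (simp only: RF)
    have int_u: "integrable lborel (\<lambda>x. indicator B x *\<^sub>R (of_real A * u x))"
      by (rule integrable_mult_indicator) (use B u in auto)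
    show "integrable lborel (\<lambda>x. indicator B x *\<^sub>R (of_real A * u x - R x))"
      using Bochner_Integration.integrable_diff[OF int_u int_R] by (simp only: scaleR_diff_right)
    have "of_real A * (LINT y|lborel. u y * of_real (indicator B y)) =
       (LINT \<tau>|lborel. of_real (power_weight (\<alpha> / 2) \<tau>) * (LINT y|lborel. g y * of_real (heat_mass B \<tau> y)))"
      unfolding A_def by (intro subordination_integral u g \<alpha> B fr star)
    also have "\<dots> = (LINT \<tau>|lborel. LINT y|lborel. g y * of_real (power_weight (\<alpha> / 2) \<tau> * heat_mass B \<tau> y))"
      unfolding integral_mult_right_zero[symmetric] by (simp add: mult_ac)
    also have "\<dots> = (LINT y|lborel. LINT \<tau>|lborel. g y * of_real (power_weight (\<alpha> / 2) \<tau> * heat_mass B \<tau> y))"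
    proof (rule lborel_pair_dominated(2)[where ?h1.0 = "\<lambda>y. norm (g y)" and ?h2.0 = "\<lambda>\<tau>. power_weight (\<alpha> / 2) \<tau> * ?D \<tau>"])
      show "integrable lborel (\<lambda>y. norm (g y))" using g by simp
      show "integrable lborel (\<lambda>\<tau>. power_weight (\<alpha> / 2) \<tau> * ?D \<tau>)"
        using \<alpha> by (intro integrable_power_weight_min) auto
      show "norm (g y * of_real (power_weight (\<alpha> / 2) \<tau> * heat_mass B \<tau> y)) \<le> norm (g y) * (power_weight (\<alpha> / 2) \<tau> * ?D \<tau>)" for y \<tau>
      proof -
        have "\<bar>power_weight (\<alpha> / 2) \<tau> * heat_mass B \<tau> y\<bar> \<le> power_weight (\<alpha> / 2) \<tau> * ?D \<tau>"
          using heat_mass_le[OF B, of \<tau> y] power_weight_nonneg[of "\<alpha> / 2" \<tau>] heat_mass_nonneg[OF B, of \<tau> y]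
          by (cases "\<tau> \<le> 0") (auto simp: power_weight_eq_0 abs_mult intro!: mult_left_mono)
        thus ?thesis unfolding norm_mult norm_of_real by (intro mult_left_mono) auto
      qed
    qed measurable
    also have "\<dots> = (LINT y|lborel. LINT a|lborel. F y a)"
      unfolding F_def integral_mult_right_zero integral_complex_of_real has_bochner_integral_integral_eq[OF sup(1)] ..
    also have "\<dots> = (LINT a|lborel. indicator B a *\<^sub>R R a)"
      using lborel_pair.Fubini_integral[OF F_pair] by (simp only: RF)
    finally have eq: "of_real A * (LINT y|lborel. u y * of_real (indicator B y)) = (LINT a|lborel. indicator B a *\<^sub>R R a)" .
    have "(LINT x|lborel. indicator B x *\<^sub>R (of_real A * u x)) = of_real A * (LINT y|lborel. u y * of_real (indicator B y))"
      unfolding integral_mult_right_zero[symmetric] by (simp add: scaleR_conv_of_real mult_ac)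
    thus "(LINT x|lborel. indicator B x *\<^sub>R (of_real A * u x - R x)) = 0"
      by (simp only: scaleR_diff_right Bochner_Integration.integral_diff[OF int_u int_R] eq) simp
    have "AE a in lborel. integrable lborel (\<lambda>y. F y a)"
      using lborel_pair.AE_integrable_snd[OF F_pair] .
    thus "AE x in lborel. x \<in> B \<longrightarrow> integrable lborel (\<lambda>y. g y * of_real (k (x - y)))"
      by eventually_elim (auto simp: F_def)
  qed
  have box: "box a b \<in> sets borel" "emeasure lborel (box a b) < \<infinity>" "AE y in lborel. y \<notin> frontier (box a b)" for a b :: "real ^ 'n"
  proof -
    have "negligible (frontier (box a b))" by (intro negligible_convex_frontier convex_box)
    hence "frontier (box a b) \<in> null_sets lborel"
      by (simp add: negligible_iff_null_sets null_sets_completion_iff)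
    thus "AE y in lborel. y \<notin> frontier (box a b)" by (rule AE_not_in)
  qed (use emeasure_bounded_finite[OF bounded_box] in auto)
  have "AE x in lborel. of_real A * u x - R x = 0"
    by (rule AE_eq_0_if_box_integrals_0) (rule main box)+
  moreover have "AE x in lborel. \<forall>j::nat. x \<in> box (- (real j *\<^sub>R One)) (real j *\<^sub>R One) \<longrightarrow> integrable lborel (\<lambda>y. g y * of_real (k (x - y)))"
    unfolding AE_all_countable using main(3)[OF box] by blast
  ultimately have "AE x in lborel. integrable lborel (\<lambda>y. g y * of_real (norm (x - y) powr (\<alpha> - real CARD('n)))) \<and>
    u x = of_real (c / A) * (LINT y|lborel. g y * of_real (norm (x - y) powr (\<alpha> - real CARD('n))))"
  proof eventually_elim
    case (elim x)
    obtain j :: nat where j: "norm x < real j" using reals_Archimedean2 by blast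
    have "x \<in> box (- (real j *\<^sub>R One)) (real j *\<^sub>R One)"
      using j Basis_le_norm[of _ x] by (force simp: mem_box abs_less_iff)
    hence int: "integrable lborel (\<lambda>y. g y * of_real (k (x - y)))" using elim(2) by blast
    have eq: "g y * of_real (k (x - y)) = of_real c * (g y * of_real (norm (x - y) powr (\<alpha> - real CARD('n))))" for y
      by (simp add: k_def)
    have "integrable lborel (\<lambda>y. g y * of_real (norm (x - y) powr (\<alpha> - real CARD('n))))"
      using integrable_mult_right[OF int, of "of_real (1 / c)"] c unfolding eq by simp
    moreover have "R x = of_real c * (LINT y|lborel. g y * of_real (norm (x - y) powr (\<alpha> - real CARD('n))))"
      unfolding R_def eq by simp
    ultimately show ?case using elim(1) A by (simp add: field_simps)
  qed
  moreover have "c / A > 0" using c A by simp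
  ultimately show ?thesis by blast
qed

section \<open>Vanishing moments\<close>

text \<open>The term of order $k$ in $x$ of the expansion of $|x-y|^{-\beta}$; for $x = 0$ or $y = 0$ the junk value
  of the cosine is $0$.\<close>

definition zonal_term :: "real \<Rightarrow> nat \<Rightarrow> 'a::euclidean_space \<Rightarrow> 'a \<Rightarrow> real" where
  "zonal_term \<beta> k x y =
     gegenbauer (\<beta> / 2) ((x \<bullet> y) / (norm x * norm y)) k * norm x ^ k * norm y powr (- \<beta> - real k)"

lemma borel_measurable_zonal_term [measurable (raw)]:
  assumes [measurable]: "f \<in> borel_measurable M" "g \<in> borel_measurable M"
  shows "(\<lambda>w. zonal_term \<beta> k (f w) (g w)) \<in> borel_measurable M"
  unfolding zonal_term_def by measurable

lemma abs_cos_angle_le_1: "\<bar>(x \<bullet> y) / (norm x * norm y)\<bar> \<le> (1 :: real)"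
proof (cases "x = 0 \<or> y = 0")
  case False
  thus ?thesis using Cauchy_Schwarz_ineq2[of x y] by (simp add: abs_mult divide_le_eq_1)
qed auto

lemma abs_zonal_term_le:
  assumes "0 < \<beta>" "\<beta> \<le> 1"
  shows "\<bar>zonal_term \<beta> k x y\<bar> \<le> norm x ^ k * norm y powr (- \<beta> - real k)"
proof -
  have "\<bar>gegenbauer (\<beta> / 2) ((x \<bullet> y) / (norm x * norm y)) k\<bar> \<le> 1"
    using abs_gegenbauer_le[OF _ abs_cos_angle_le_1, of "\<beta> / 2" x y k] neg_binom_le_1[of \<beta> k] assms by simp
  hence "\<bar>gegenbauer (\<beta> / 2) ((x \<bullet> y) / (norm x * norm y)) k\<bar> * (norm x ^ k * norm y powr (- \<beta> - real k)) \<le>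
    1 * (norm x ^ k * norm y powr (- \<beta> - real k))"
    by (intro mult_right_mono) auto
  thus ?thesis by (simp add: zonal_term_def abs_mult mult.assoc)
qed

lemma zonal_term_scale:
  assumes "t > 0" shows "zonal_term \<beta> k (t *\<^sub>R x) y = t ^ k * zonal_term \<beta> k x y"
  using assms by (simp add: zonal_term_def power_mult_distrib)

text \<open>The constant \<open>20 * (3 + 2 / \<mu>)\<close> of \<open>gegenbauer_remainder\<close>
  at \<mu> = \<beta>/2.\<close>

definition zonal_const :: "real \<Rightarrow> real" where
  "zonal_const \<beta> = 20 * (3 + 4 / \<beta>)"

lemma zonal_const_pos: "0 < \<beta> \<Longrightarrow> 0 < zonal_const \<beta>"
  by (simp add: zonal_const_def add_pos_pos)

text \<open>Since |x - y|^2 = |y|^2 D with \<rho> = |x|/|y|, factoring out |x - y|^(-\<beta>) leaves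
  exactly the expression bounded in \<open>gegenbauer_remainder\<close>. The estimate covers |x| >
  |y| as well, where the series itself need not converge, and its right side has the kernel's own
  singularity at y = x.\<close>

lemma riesz_kernel_remainder:
  fixes x y :: "'a::euclidean_space"
  assumes \<beta>: "0 < \<beta>" "\<beta> \<le> 1" and y: "y \<noteq> 0" and xy: "x \<noteq> y"
  shows "\<bar>norm (x - y) powr (- \<beta>) - (\<Sum>k<m. zonal_term \<beta> k x y)\<bar> \<le>
     zonal_const \<beta> * (norm x / norm y) ^ m * norm (x - y) powr (- \<beta>)"
proof -
  define \<rho> where "\<rho> = norm x / norm y"
  define c where "c = (x \<bullet> y) / (norm x * norm y)"
  define S where "S = (\<Sum>k<m. gegenbauer (\<beta> / 2) c k * \<rho> ^ k)"
  define D where "D = 1 - 2 * \<rho> * c + \<rho>\<^sup>2"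
  have c1: "\<bar>c\<bar> \<le> 1" unfolding c_def by (rule abs_cos_angle_le_1)
  have ny: "norm y > 0" using y by simp
  have "x \<bullet> y = norm x * norm y * c" by (cases "x = 0") (use y in \<open>auto simp: c_def\<close>)
  hence "(norm (x - y))\<^sup>2 = (norm x)\<^sup>2 - 2 * (norm x * norm y * c) + (norm y)\<^sup>2"
    by (simp add: power2_norm_eq_inner inner_diff_left inner_diff_right inner_commute)
  also have "norm x = norm y * \<rho>" using ny by (simp add: \<rho>_def)
  finally have D_eq: "(norm (x - y))\<^sup>2 = (norm y)\<^sup>2 * D"
    by (simp add: D_def power2_eq_square algebra_simps)
  hence D_eq': "D = (norm (x - y) / norm y)\<^sup>2" using ny by (simp add: power_divide)
  have D_powr: "D powr (\<beta> / 2) = (norm (x - y) / norm y) powr \<beta>"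
    using xy ny unfolding D_eq' by (simp add: powr_powr flip: powr_numeral)
  have zt: "zonal_term \<beta> k x y = norm y powr (- \<beta>) * (gegenbauer (\<beta> / 2) c k * \<rho> ^ k)" for k
  proof -
    have "norm y powr (- \<beta> - real k) = norm y powr (- \<beta>) / norm y ^ k"
      using ny by (simp add: powr_diff powr_realpow)
    thus ?thesis by (simp add: zonal_term_def c_def \<rho>_def power_divide)
  qed
  have "norm y powr (- \<beta>) = norm (x - y) powr (- \<beta>) * D powr (\<beta> / 2)"
    using xy ny unfolding D_powr by (simp add: powr_divide powr_minus field_simps)
  hence "(\<Sum>k<m. zonal_term \<beta> k x y) = norm (x - y) powr (- \<beta>) * (D powr (\<beta> / 2) * S)"
    unfolding zt S_def sum_distrib_left[symmetric] by (simp only: mult.assoc)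
  hence "norm (x - y) powr (- \<beta>) - (\<Sum>k<m. zonal_term \<beta> k x y) = norm (x - y) powr (- \<beta>) * (1 - D powr (\<beta> / 2) * S)"
    by (simp add: right_diff_distrib)
  hence "\<bar>norm (x - y) powr (- \<beta>) - (\<Sum>k<m. zonal_term \<beta> k x y)\<bar> = norm (x - y) powr (- \<beta>) * \<bar>1 - D powr (\<beta> / 2) * S\<bar>"
    by (simp add: abs_mult)
  also have "\<dots> \<le> norm (x - y) powr (- \<beta>) * (20 * (3 + 2 / (\<beta> / 2)) * \<rho> ^ m)"
    unfolding D_def S_def using \<beta> c1 by (intro mult_left_mono gegenbauer_remainder) (auto simp: \<rho>_def)
  finally show ?thesis by (simp add: zonal_const_def \<rho>_def mult_ac)
qed

lemma AE_on_open_ex: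
  fixes U :: "'a::euclidean_space set"
  assumes "AE x in lborel. x \<in> U \<longrightarrow> P x" "open U" "U \<noteq> {}"
  shows "\<exists>x\<in>U. P x"
proof (rule ccontr)
  assume "\<not> ?thesis"
  hence "AE x in lborel. x \<notin> U" using assms(1) by (auto elim!: eventually_mono)
  hence "emeasure lborel U = 0"
    using assms(2) by (subst (asm) AE_iff_measurable[of U]) auto
  moreover obtain x e where e: "e > 0" "ball x e \<subseteq> U" using assms(2,3) openE by blast
  have "emeasure lborel (ball x e) \<le> emeasure lborel U" using e assms by (intro emeasure_mono) auto
  ultimately have "emeasure lborel (ball x e) = 0" by simp
  thus False using content_ball_pos[OF e(1), of x] by (simp add: measure_def)
qed

text \<open>Isolates the input of the moment argument: u is present only through its Riesz
  potential, and \<beta> stands for n - \<alpha>.\<close>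

locale riesz_potential_vanishing =
  fixes g :: "real ^ 'n \<Rightarrow> complex" and \<beta> \<epsilon> :: real and p :: "real ^ 'n"
  assumes g: "integrable lborel g" and \<beta>: "0 < \<beta>" "\<beta> \<le> 1" and \<epsilon>: "\<epsilon> > 0"
    and g_zero: "AE y in lborel. y \<in> ball p \<epsilon> \<longrightarrow> g y = 0"
    and R_zero: "AE x in lborel. x \<in> ball p \<epsilon> \<longrightarrow> (LINT y|lborel. g y * of_real (norm (x - y) powr (- \<beta>))) = 0"
begin

lemma g_measurable [measurable]: "g \<in> borel_measurable borel"
  using g by (auto dest: borel_measurable_integrable)

text \<open>The mass of g stays at distance at least \<epsilon> from p, so the potential is
  continuous on the half-size ball and zero almost everywhere becomes zero everywhere. The moment
  argument needs this because it follows single rays, which are null sets.\<close>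

lemma potential_zero:
  assumes x: "dist p x < \<epsilon> / 2"
  shows "(LINT y|lborel. g y * of_real (norm (x - y) powr (- \<beta>))) = 0"
proof -
  let ?R = "\<lambda>x. LINT y|lborel. g y * of_real (norm (x - y) powr (- \<beta>))"
  have "\<exists>z\<in>ball p (\<epsilon> / 2) \<inter> ball x (1 / real (Suc k)). ?R z = 0" for k
  proof (rule AE_on_open_ex)
    show "AE z in lborel. z \<in> ball p (\<epsilon> / 2) \<inter> ball x (1 / real (Suc k)) \<longrightarrow> ?R z = 0"
      using R_zero by eventually_elim (use \<epsilon> in auto)
    have "x \<in> ball p (\<epsilon> / 2) \<inter> ball x (1 / real (Suc k))" using x by (simp add: dist_commute)
    thus "ball p (\<epsilon> / 2) \<inter> ball x (1 / real (Suc k)) \<noteq> {}" by blast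
  qed auto
  hence "\<forall>k. \<exists>z. z \<in> ball p (\<epsilon> / 2) \<inter> ball x (1 / real (Suc k)) \<and> ?R z = 0" by blast
  from choice[OF this] obtain z where
    z': "\<forall>k. z k \<in> ball p (\<epsilon> / 2) \<inter> ball x (1 / real (Suc k)) \<and> ?R (z k) = 0" by blast
  have z: "z k \<in> ball p (\<epsilon> / 2)" "dist x (z k) < 1 / real (Suc k)" "?R (z k) = 0" for k
    using z'[rule_format, of k] by (simp_all only: Int_iff mem_ball)
  have z_lim: "z \<longlonglongrightarrow> x"
  proof (rule metric_tendsto_imp_tendsto)
    show "(\<lambda>k. 1 / real (Suc k)) \<longlonglongrightarrow> 0" by (rule LIMSEQ_Suc[OF lim_1_over_n])
    show "eventually (\<lambda>k. dist (z k) x \<le> dist (1 / real (Suc k)) 0) sequentially"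
      using z(2) by (intro always_eventually allI) (simp add: dist_commute less_imp_le del: of_nat_Suc)
  qed
  have far: "\<epsilon> / 2 \<le> norm (w - y)" if "dist p w < \<epsilon> / 2" "y \<notin> ball p \<epsilon>" for w y
    using that dist_triangle[of p y w] by (simp add: dist_norm)
  have "(\<lambda>k. ?R (z k)) \<longlonglongrightarrow> ?R x"
  proof (rule integral_dominated_convergence[where w = "\<lambda>y. norm (g y) * (\<epsilon> / 2) powr (- \<beta>)"])
    show "integrable lborel (\<lambda>y. norm (g y) * (\<epsilon> / 2) powr (- \<beta>))"
      using g by (intro integrable_mult_left integrable_norm)
    show "AE y in lborel. (\<lambda>k. g y * complex_of_real (norm (z k - y) powr (- \<beta>))) \<longlonglongrightarrow> g y * of_real (norm (x - y) powr (- \<beta>))"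
      using g_zero
    proof eventually_elim
      case (elim y)
      show ?case
      proof (cases "y \<in> ball p \<epsilon>")
        case False
        have "norm (x - y) \<noteq> 0" using far[OF x False] \<epsilon> by linarith
        thus ?thesis
          by (intro tendsto_mult tendsto_const tendsto_of_real tendsto_powr tendsto_norm tendsto_diff z_lim)
      qed (use elim in simp)
    qed
    show "AE y in lborel. norm (g y * complex_of_real (norm (z k - y) powr (- \<beta>))) \<le> norm (g y) * (\<epsilon> / 2) powr (- \<beta>)" for k
      using g_zero
    proof eventually_elim
      case (elim y)
      show ?case
      proof (cases "y \<in> ball p \<epsilon>")
        case False
        have "norm (z k - y) powr (- \<beta>) \<le> (\<epsilon> / 2) powr (- \<beta>)"
          using far[OF _ False, of "z k"] z(1)[of k] \<epsilon> \<beta> by (intro powr_mono2') auto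
        thus ?thesis by (simp add: norm_mult mult_left_mono)
      qed (use elim in simp)
    qed
  qed measurable
  thus ?thesis using z(3) by (simp add: LIMSEQ_const_iff)
qed

lemma integrable_zonal_term: "integrable lborel (\<lambda>y. g y * of_real (zonal_term \<beta> k (x - p) (y - p)))"
proof (rule Bochner_Integration.integrable_bound)
  show "integrable lborel (\<lambda>y. norm (g y) * (norm (x - p) ^ k * \<epsilon> powr (- \<beta> - real k)))"
    using g by (intro integrable_mult_left integrable_norm)
  show "AE y in lborel. norm (g y * complex_of_real (zonal_term \<beta> k (x - p) (y - p))) \<le>
     norm (norm (g y) * (norm (x - p) ^ k * \<epsilon> powr (- \<beta> - real k)))"
    using g_zero
  proof eventually_elim
    case (elim y)
    show ?case
    proof (cases "y \<in> ball p \<epsilon>")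
      case False
      have "\<bar>zonal_term \<beta> k (x - p) (y - p)\<bar> \<le> norm (x - p) ^ k * norm (y - p) powr (- \<beta> - real k)"
        by (rule abs_zonal_term_le[OF \<beta>])
      also have "\<dots> \<le> norm (x - p) ^ k * \<epsilon> powr (- \<beta> - real k)"
        using False \<epsilon> \<beta> by (intro mult_left_mono powr_mono2') (auto simp: dist_norm norm_minus_commute)
      finally show ?thesis by (simp add: norm_mult mult_left_mono)
    qed (use elim in simp)
  qed
qed measurable

text \<open>Off \<open>ball p \<epsilon>\<close> the weight |y - p|^(-m) is at most \<epsilon>^(-m),
  so integrability is inherited from the potential at x. The point x is not confined to
  \<open>ball p \<epsilon>\<close>, since the estimate is later applied throughout a ball whose
  radius is unrelated to \<epsilon>.\<close>

lemma remainder_bound: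
  assumes int: "integrable lborel (\<lambda>y. g y * of_real (norm (x - y) powr (- \<beta>)))"
  shows "integrable lborel (\<lambda>y. norm (g y) * ((norm (x - p) / norm (y - p)) ^ m * norm (x - y) powr (- \<beta>)))"
    and "norm ((LINT y|lborel. g y * of_real (norm (x - y) powr (- \<beta>))) -
         (\<Sum>k<m. LINT y|lborel. g y * of_real (zonal_term \<beta> k (x - p) (y - p)))) \<le>
      zonal_const \<beta> * (LINT y|lborel. norm (g y) * ((norm (x - p) / norm (y - p)) ^ m * norm (x - y) powr (- \<beta>)))"
proof -
  let ?K = "zonal_const \<beta>"
  let ?f = "\<lambda>y. norm (g y) * ((norm (x - p) / norm (y - p)) ^ m * norm (x - y) powr (- \<beta>))"
  show f_int: "integrable lborel ?f"
  proof (rule Bochner_Integration.integrable_bound)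
    show "integrable lborel (\<lambda>y. (norm (x - p) / \<epsilon>) ^ m * norm (g y * of_real (norm (x - y) powr (- \<beta>))))"
      using int by (intro integrable_mult_right integrable_norm)
    show "AE y in lborel. norm (?f y) \<le> norm ((norm (x - p) / \<epsilon>) ^ m * norm (g y * of_real (norm (x - y) powr (- \<beta>))))"
      using g_zero
    proof eventually_elim
      case (elim y)
      show ?case
      proof (cases "y \<in> ball p \<epsilon>")
        case False
        have "(norm (x - p) / norm (y - p)) ^ m \<le> (norm (x - p) / \<epsilon>) ^ m"
          using False \<epsilon> by (intro power_mono divide_left_mono) (auto simp: dist_norm norm_minus_commute intro!: mult_pos_pos)
        hence "(norm (x - p) / norm (y - p)) ^ m * (norm (g y) * norm (x - y) powr (- \<beta>)) \<le>
           (norm (x - p) / \<epsilon>) ^ m * (norm (g y) * norm (x - y) powr (- \<beta>))"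
          by (intro mult_right_mono) auto
        thus ?thesis using \<epsilon> by (simp add: norm_mult abs_mult mult_ac)
      qed (use elim in simp)
    qed
  qed measurable
  let ?z = "\<lambda>k y. g y * complex_of_real (zonal_term \<beta> k (x - p) (y - p))"
  have sum_int: "integrable lborel (\<lambda>y. \<Sum>k<m. ?z k y)"
    by (intro Bochner_Integration.integrable_sum integrable_zonal_term)
  have diff_int: "integrable lborel (\<lambda>y. g y * of_real (norm (x - y) powr (- \<beta>)) - (\<Sum>k<m. ?z k y))"
    by (rule Bochner_Integration.integrable_diff[OF int sum_int])
  have "(LINT y|lborel. (\<Sum>k<m. ?z k y)) = (\<Sum>k<m. LINT y|lborel. ?z k y)"
    by (rule Bochner_Integration.integral_sum) (rule integrable_zonal_term)
  hence "(LINT y|lborel. g y * of_real (norm (x - y) powr (- \<beta>))) - (\<Sum>k<m. LINT y|lborel. ?z k y) =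
    (LINT y|lborel. g y * of_real (norm (x - y) powr (- \<beta>)) - (\<Sum>k<m. ?z k y))"
    by (subst Bochner_Integration.integral_diff[OF int sum_int]) simp
  also have "norm \<dots> \<le> (LINT y|lborel. norm (g y * of_real (norm (x - y) powr (- \<beta>)) - (\<Sum>k<m. ?z k y)))"
    by (rule integral_norm_bound)
  also have "\<dots> \<le> (LINT y|lborel. ?K * ?f y)"
  proof (rule integral_mono_AE)
    have "AE y in lborel. y \<noteq> x" "AE y in lborel. y \<noteq> p" by (rule AE_lborel_singleton)+
    thus "AE y in lborel. norm (g y * of_real (norm (x - y) powr (- \<beta>)) - (\<Sum>k<m. ?z k y)) \<le> ?K * ?f y"
    proof eventually_elim
      case (elim y)
      have "g y * of_real (norm (x - y) powr (- \<beta>)) - (\<Sum>k<m. ?z k y) =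
         g y * of_real (norm ((x - p) - (y - p)) powr (- \<beta>) - (\<Sum>k<m. zonal_term \<beta> k (x - p) (y - p)))"
        by (simp add: sum_distrib_left right_diff_distrib)
      hence "norm (g y * of_real (norm (x - y) powr (- \<beta>)) - (\<Sum>k<m. ?z k y)) =
         norm (g y) * \<bar>norm ((x - p) - (y - p)) powr (- \<beta>) - (\<Sum>k<m. zonal_term \<beta> k (x - p) (y - p))\<bar>"
        by (simp only: norm_mult norm_of_real)
      also have "\<dots> \<le> norm (g y) * (?K * (norm (x - p) / norm (y - p)) ^ m * norm ((x - p) - (y - p)) powr (- \<beta>))"
        using elim by (intro mult_left_mono riesz_kernel_remainder \<beta>) auto
      also have "\<dots> = ?K * ?f y" by simp
      finally show ?case .
    qed
  qed (use diff_int f_int in \<open>auto intro: integrable_norm\<close>)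
  also have "\<dots> = ?K * (LINT y|lborel. ?f y)" by simp
  finally show "norm ((LINT y|lborel. g y * of_real (norm (x - y) powr (- \<beta>))) - (\<Sum>k<m. LINT y|lborel. ?z k y)) \<le> ?K * (LINT y|lborel. ?f y)" .
qed

lemma near_kernel_bound:
  assumes "dist p x < \<epsilon> / 2" "y \<notin> ball p \<epsilon>"
  shows "norm (x - y) powr (- \<beta>) \<le> (\<epsilon> / 2) powr (- \<beta>)"
proof -
  have "\<epsilon> / 2 \<le> norm (x - y)"
    using assms dist_triangle[of p y x] by (simp add: dist_norm)
  thus ?thesis using \<epsilon> \<beta> by (intro powr_mono2') auto
qed

text \<open>Comparing the orders in $t$ of the potential at $p + t w$ as $t \to 0$.\<close>

lemma moments_zero: "(LINT y|lborel. g y * of_real (zonal_term \<beta> m (x - p) (y - p))) = 0"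
proof (induction m arbitrary: x rule: less_induct)
  case (less m)
  define w where "w = x - p"
  define T where "T = (\<lambda>z. LINT y|lborel. g y * complex_of_real (zonal_term \<beta> m (z - p) (y - p)))"
  \<comment> \<open>The remainder after degree m is of order t^(m + 1), one order above the
    homogeneity of the moment. \<open>M\<close> collects what is left after extracting that
    power.\<close>
  define M where "M = zonal_const \<beta> * ((norm w / \<epsilon>) ^ Suc m * (\<epsilon> / 2) powr (- \<beta>)) * (LINT y|lborel. norm (g y))"
  have bound: "norm (T x) \<le> t * M" if t: "0 < t" "t * norm w < \<epsilon> / 2" for t
  proof -
    define z where "z = p + t *\<^sub>R w"
    have z: "dist p z < \<epsilon> / 2" using t by (simp add: z_def dist_norm)
    have zp: "z - p = t *\<^sub>R w" by (simp add: z_def)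
    have int: "integrable lborel (\<lambda>y. g y * of_real (norm (z - y) powr (- \<beta>)))"
    proof (rule Bochner_Integration.integrable_bound)
      show "integrable lborel (\<lambda>y. norm (g y) * (\<epsilon> / 2) powr (- \<beta>))"
        using g by (intro integrable_mult_left integrable_norm)
      show "AE y in lborel. norm (g y * complex_of_real (norm (z - y) powr (- \<beta>))) \<le> norm (norm (g y) * (\<epsilon> / 2) powr (- \<beta>))"
        using g_zero
      proof eventually_elim
        case (elim y)
        show ?case
        proof (cases "y \<in> ball p \<epsilon>")
          case False
          have "norm (g y) * norm (z - y) powr (- \<beta>) \<le> norm (g y) * (\<epsilon> / 2) powr (- \<beta>)"
            by (intro mult_left_mono near_kernel_bound z False) auto
          thus ?thesis by (simp add: norm_mult)
        qed (use elim in simp)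
      qed
    qed measurable
    \<comment> \<open>The lower moments are needed at the moved point \<open>z\<close>, which is why
      the induction quantifies over x.\<close>
    have "(\<Sum>k<Suc m. LINT y|lborel. g y * complex_of_real (zonal_term \<beta> k (z - p) (y - p))) = T z"
      using less.IH by (simp add: T_def)
    hence "norm (T z) \<le> zonal_const \<beta> * (LINT y|lborel. norm (g y) * ((norm (z - p) / norm (y - p)) ^ Suc m * norm (z - y) powr (- \<beta>)))"
      using remainder_bound(2)[OF int, of "Suc m"] by (simp only: potential_zero[OF z]) simp
    also have "\<dots> \<le> zonal_const \<beta> * (LINT y|lborel. norm (g y) * ((t * norm w / \<epsilon>) ^ Suc m * (\<epsilon> / 2) powr (- \<beta>)))"
    proof (intro mult_left_mono integral_mono_AE remainder_bound(1) int)
      show "integrable lborel (\<lambda>y. norm (g y) * ((t * norm w / \<epsilon>) ^ Suc m * (\<epsilon> / 2) powr (- \<beta>)))"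
        using g by (intro integrable_mult_left integrable_norm)
      show "AE y in lborel. norm (g y) * ((norm (z - p) / norm (y - p)) ^ Suc m * norm (z - y) powr (- \<beta>)) \<le>
          norm (g y) * ((t * norm w / \<epsilon>) ^ Suc m * (\<epsilon> / 2) powr (- \<beta>))"
        using g_zero
      proof eventually_elim
        case (elim y)
        show ?case
        proof (cases "y \<in> ball p \<epsilon>")
          case False
          have "norm (z - p) / norm (y - p) \<le> t * norm w / \<epsilon>"
            unfolding zp using False \<epsilon> t
            by (simp, intro divide_left_mono) (auto simp: dist_norm norm_minus_commute intro!: mult_pos_pos)
          thus ?thesis using \<epsilon> t
            by (intro mult_left_mono mult_mono power_mono near_kernel_bound z False) auto
        qed (use elim in simp)
      qed
    qed (use zonal_const_pos \<beta> in \<open>auto intro: less_imp_le\<close>)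
    also have "\<dots> = t ^ m * (t * M)"
      by (simp add: M_def power_mult_distrib power_divide)
    finally have "norm (T z) \<le> t ^ m * (t * M)" .
    moreover have "T z = of_real (t ^ m) * T x"
      unfolding T_def zp w_def[symmetric] zonal_term_scale[OF t(1)] integral_mult_right_zero[symmetric]
      by (simp add: mult_ac)
    ultimately have "t ^ m * norm (T x) \<le> t ^ m * (t * M)"
      using t by (simp add: norm_mult norm_power)
    thus ?thesis using t by simp
  qed
  have M0: "0 \<le> M"
    unfolding M_def using zonal_const_pos[OF \<beta>(1)] \<epsilon> by (intro mult_nonneg_nonneg) auto
  have "norm (T x) \<le> 0"
  proof (rule field_le_epsilon)
    fix e :: real assume e: "e > 0"
    \<comment> \<open>The first entry makes t M at most e; the second keeps t |w| \<le>
      \<epsilon>/4, inside the ball where the potential vanishes. The added 1s avoid division by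
      0.\<close>
    define t where "t = min (e / (M + 1)) (\<epsilon> / (4 * (norm w + 1)))"
    have t: "t > 0" "t \<le> e / (M + 1)" "t \<le> \<epsilon> / (4 * (norm w + 1))"
      using e \<epsilon> M0 by (auto simp: t_def add_nonneg_pos intro!: divide_pos_pos)
    have "t * norm w \<le> \<epsilon> / (4 * (norm w + 1)) * (norm w + 1)"
      using t by (intro mult_mono) auto
    also have "\<dots> = \<epsilon> / 4"
    proof -
      have "\<epsilon> / (4 * n) * n = \<epsilon> / 4" if "n \<noteq> 0" for n :: real using that by simp
      moreover have "norm w + 1 \<noteq> 0" using norm_ge_zero[of w] by linarith
      ultimately show ?thesis by blast
    qed
    finally have "norm (T x) \<le> t * M" using t \<epsilon> by (intro bound) auto
    also have "\<dots> \<le> e / (M + 1) * (M + 1)" using t M0 e by (intro mult_mono) auto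
    also have "\<dots> = e" using M0 by simp
    finally show "norm (T x) \<le> 0 + e" by simp
  qed
  thus ?case by (simp add: T_def)
qed

lemma potential_decay:
  assumes int: "integrable lborel (\<lambda>y. g y * of_real (norm (x - y) powr (- \<beta>)))"
  shows "norm (LINT y|lborel. g y * of_real (norm (x - y) powr (- \<beta>))) \<le>
      zonal_const \<beta> * (LINT y|lborel. norm (g y) * ((norm (x - p) / norm (y - p)) ^ m * norm (x - y) powr (- \<beta>)))"
  using remainder_bound(2)[OF int, of m] by (simp add: moments_zero)

end

section \<open>Propagation of zeros\<close>

text \<open>Around any q in the ball of a good centre p a small ball is already covered, and
  \<open>step\<close> enlarges it to the full radius r again. Hence good centres form an open set
  whose complement is open too, and a countable dense set of centres merges the exceptional null
  sets.\<close>

lemma AE_if_uniformly_propagating: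
  fixes P :: "'a::euclidean_space \<Rightarrow> bool"
  assumes r: "r > 0"
    and step: "\<And>p \<epsilon>. \<epsilon> > 0 \<Longrightarrow> AE x in lborel. x \<in> ball p \<epsilon> \<longrightarrow> P x \<Longrightarrow> AE x in lborel. x \<in> ball p r \<longrightarrow> P x"
    and init: "\<epsilon>0 > 0" "AE x in lborel. x \<in> ball p0 \<epsilon>0 \<longrightarrow> P x"
  shows "AE x in lborel. P x"
proof -
  define Z where "Z = {p. AE x in lborel. x \<in> ball p r \<longrightarrow> P x}"
  have near: "q \<in> Z" if p: "p \<in> Z" and d: "dist p q < r" for p q
  proof -
    have "AE x in lborel. x \<in> ball p r \<longrightarrow> P x" using p by (simp add: Z_def)
    hence "AE x in lborel. x \<in> ball q (r - dist p q) \<longrightarrow> P x"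
    proof eventually_elim
      case (elim x)
      show ?case
      proof
        assume "x \<in> ball q (r - dist p q)"
        hence "x \<in> ball p r" using dist_triangle[of p x q] by (simp add: dist_commute)
        thus "P x" using elim by blast
      qed
    qed
    thus ?thesis using step[of "r - dist p q" q] d by (simp add: Z_def)
  qed
  have "open Z" unfolding open_contains_ball using near r by (intro ballI exI[of _ r]) auto
  moreover have "open (- Z)"
    unfolding open_contains_ball
  proof (intro ballI exI[of _ r] conjI subsetI r)
    fix p q assume "p \<in> - Z" "q \<in> ball p r"
    thus "q \<in> - Z" using near[of q p] by (auto simp: dist_commute)
  qed
  hence "closed Z" by (simp add: closed_def)
  moreover have "p0 \<in> Z" using step[OF init] by (simp add: Z_def)
  ultimately have Z: "Z = UNIV" using clopen[of Z] by auto
  obtain D :: "'a set" where D: "countable D" "\<And>X. open X \<Longrightarrow> X \<noteq> {} \<Longrightarrow> \<exists>d\<in>D. d \<in> X"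
    using countable_dense_exists by blast
  have "AE x in lborel. \<forall>d\<in>D. x \<in> ball d r \<longrightarrow> P x"
    using Z D(1) by (subst AE_ball_countable) (auto simp: Z_def)
  thus ?thesis
  proof eventually_elim
    case (elim x)
    obtain d where "d \<in> D" "d \<in> ball x r" using D(2)[of "ball x r"] r by auto
    thus ?case using elim by (auto simp: dist_commute)
  qed
qed

text \<open>If y is within 2 r of p, then \<open>ball p r\<close> lies in
  \<open>ball y (3 * r)\<close>. Otherwise each x in \<open>ball p r\<close> is closer to p than to
  y, so the kernel centred at p dominates. This explains the radius 3 r in the hypothesis.\<close>

lemma kato_bound_other_center:
  fixes V :: "real ^ 'n \<Rightarrow> complex"
  assumes [measurable]: "V \<in> borel_measurable borel" and \<beta>: "0 < \<beta>" and r: "r > 0"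
    and kato: "\<And>y. (\<integral>\<^sup>+x. ennreal (norm (V x) * norm (x - y) powr (- \<beta>)) * indicator (ball y (3 * r)) x \<partial>lborel) \<le> \<kappa>"
  shows "(\<integral>\<^sup>+x. ennreal (norm (V x) * norm (x - y) powr (- \<beta>)) * indicator (ball p r) x \<partial>lborel) \<le> \<kappa>"
proof (cases "dist y p < 2 * r")
  case True
  have "x \<in> ball y (3 * r)" if "x \<in> ball p r" for x
    using that True dist_triangle[of y x p] by simp
  hence "(\<integral>\<^sup>+x. ennreal (norm (V x) * norm (x - y) powr (- \<beta>)) * indicator (ball p r) x \<partial>lborel) \<le>
     (\<integral>\<^sup>+x. ennreal (norm (V x) * norm (x - y) powr (- \<beta>)) * indicator (ball y (3 * r)) x \<partial>lborel)"
    by (intro nn_integral_mono mult_left_mono) (auto simp: indicator_def)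
  also have "\<dots> \<le> \<kappa>" by (rule kato)
  finally show ?thesis .
next
  case False
  have "AE x in lborel. x \<noteq> p" by (rule AE_lborel_singleton)
  hence "(\<integral>\<^sup>+x. ennreal (norm (V x) * norm (x - y) powr (- \<beta>)) * indicator (ball p r) x \<partial>lborel) \<le>
     (\<integral>\<^sup>+x. ennreal (norm (V x) * norm (x - p) powr (- \<beta>)) * indicator (ball p (3 * r)) x \<partial>lborel)"
  proof (intro nn_integral_mono_AE, eventually_elim)
    case (elim x)
    show ?case
    proof (cases "x \<in> ball p r")
      case True
      have "norm (x - p) \<le> norm (x - y)"
        using True False dist_triangle[of y p x] by (simp add: dist_norm norm_minus_commute)
      hence "norm (x - y) powr (- \<beta>) \<le> norm (x - p) powr (- \<beta>)"
        using elim \<beta> by (intro powr_mono2') auto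
      moreover have "x \<in> ball p (3 * r)" using True r by simp
      ultimately show ?thesis using True by (simp add: ennreal_leI mult_left_mono)
    qed simp
  qed
  also have "\<dots> \<le> \<kappa>" by (rule kato)
  finally show ?thesis .
qed

lemma power_seq_le_imp_zero:
  fixes a q M :: real
  assumes "0 \<le> q" "q < 1" "\<And>m. a \<le> q ^ m * M" shows "a \<le> 0"
proof -
  have "(\<lambda>m. q ^ m * M) \<longlonglongrightarrow> 0 * M"
    using assms by (intro tendsto_mult_right LIMSEQ_power_zero) auto
  thus ?thesis using assms(3) by (intro LIMSEQ_le_const[of _ 0]) auto
qed

lemma vanishing_propagates:
  fixes u g V :: "real ^ 'n \<Rightarrow> complex"
  assumes u_meas: "u \<in> borel_measurable borel" and g: "integrable lborel g" and V [measurable]: "V \<in> borel_measurable borel"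
    and \<beta>: "0 < \<beta>" "\<beta> \<le> 1" and C: "C > 0"
    and rep: "AE x in lborel. integrable lborel (\<lambda>y. g y * of_real (norm (x - y) powr (- \<beta>))) \<and>
      u x = of_real C * (LINT y|lborel. g y * of_real (norm (x - y) powr (- \<beta>)))"
    and ineq: "AE x in lborel. norm (g x) \<le> norm (V x * u x)"
    and r: "r > 0" and \<kappa>: "0 \<le> \<kappa>" "C * zonal_const \<beta> * \<kappa> \<le> 1 / 2"
    and kato: "\<And>y. (\<integral>\<^sup>+x. ennreal (norm (V x) * norm (x - y) powr (- \<beta>)) * indicator (ball y (3 * r)) x \<partial>lborel) \<le> ennreal \<kappa>"
    and \<epsilon>: "\<epsilon> > 0" and u_zero: "AE x in lborel. x \<in> ball p \<epsilon> \<longrightarrow> u x = 0"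
  shows "AE x in lborel. x \<in> ball p r \<longrightarrow> u x = 0"
proof -
  have g_meas [measurable]: "g \<in> borel_measurable borel" using g by (auto dest: borel_measurable_integrable)
  interpret riesz_potential_vanishing g \<beta> \<epsilon> p
  proof
    show "AE y in lborel. y \<in> ball p \<epsilon> \<longrightarrow> g y = 0"
      using u_zero ineq by eventually_elim auto
    show "AE x in lborel. x \<in> ball p \<epsilon> \<longrightarrow> (LINT y|lborel. g y * of_real (norm (x - y) powr (- \<beta>))) = 0"
      using u_zero rep by eventually_elim (use C in auto)
  qed (use g \<beta> \<epsilon> in auto)
  define K where "K = C * zonal_const \<beta>"
  have K: "K > 0" using C zonal_const_pos[OF \<beta>(1)] by (simp add: K_def)
  define N where "N = (LINT y|lborel. norm (g y))"
  have N: "(\<integral>\<^sup>+y. ennreal (norm (g y)) \<partial>lborel) = ennreal N"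
    unfolding N_def using g by (intro nn_integral_eq_integral) auto
  have N0: "N \<ge> 0" by (simp add: N_def)
  define G where "G = (\<lambda>m y. ennreal (norm (g y) * (1 / norm (y - p)) ^ m))"
  have G_meas [measurable]: "G m \<in> borel_measurable borel" for m unfolding G_def by measurable
  have ball_meas [measurable]: "ball p r \<in> sets borel" by simp
  define I where "I = (\<lambda>m. \<integral>\<^sup>+x. G m x * indicator (ball p r) x \<partial>lborel)"
  have neq: "AE x in lborel. x \<noteq> p" by (rule AE_lborel_singleton)
  have decay: "AE x in lborel. \<forall>m. norm (u x) \<le> K * (LINT y|lborel. norm (g y) * ((norm (x - p) / norm (y - p)) ^ m * norm (x - y) powr (- \<beta>)))"
    using rep
  proof eventually_elim
    case (elim x)
    show ?case
    proof
      fix m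
      have "norm (u x) = C * norm (LINT y|lborel. g y * of_real (norm (x - y) powr (- \<beta>)))"
        using elim C by (simp add: norm_mult)
      also have "\<dots> \<le> C * (zonal_const \<beta> * (LINT y|lborel. norm (g y) * ((norm (x - p) / norm (y - p)) ^ m * norm (x - y) powr (- \<beta>))))"
        using elim C by (intro mult_left_mono potential_decay) auto
      finally show "norm (u x) \<le> K * (LINT y|lborel. norm (g y) * ((norm (x - p) / norm (y - p)) ^ m * norm (x - y) powr (- \<beta>)))"
        by (simp add: K_def)
    qed
  qed
  \<comment> \<open>Multiplying the decay of u by |V(x)| |x - p|^(-m) cancels the powers of |x - p|,
    and the differential inequality turns the left side into \<open>G m x\<close>. The result
    involves g alone.\<close>
  have pointwise: "AE x in lborel. \<forall>m. G m x \<le> ennreal K * (\<integral>\<^sup>+y. G m y * ennreal (norm (V x) * norm (x - y) powr (- \<beta>)) \<partial>lborel)"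
    using decay rep ineq neq
  proof eventually_elim
    case (elim x)
    show ?case
    proof
      fix m
      let ?f = "\<lambda>y. norm (g y) * ((norm (x - p) / norm (y - p)) ^ m * norm (x - y) powr (- \<beta>))"
      let ?a = "norm (V x) * (1 / norm (x - p)) ^ m"
      have "integrable lborel ?f" using elim by (intro remainder_bound(1)) auto
      hence f: "ennreal (LINT y|lborel. ?f y) = (\<integral>\<^sup>+y. ennreal (?f y) \<partial>lborel)"
        by (intro nn_integral_eq_integral[symmetric]) auto
      have "norm (g x) * (1 / norm (x - p)) ^ m \<le> (norm (V x) * norm (u x)) * (1 / norm (x - p)) ^ m"
        using elim by (intro mult_right_mono) (auto simp: norm_mult)
      also have "\<dots> = ?a * norm (u x)" by simp
      also have "\<dots> \<le> ?a * (K * (LINT y|lborel. ?f y))"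
        using elim by (intro mult_left_mono) auto
      finally have "G m x \<le> ennreal (?a * (K * (LINT y|lborel. ?f y)))"
        unfolding G_def by (rule ennreal_leI)
      also have "\<dots> = ennreal K * (ennreal ?a * ennreal (LINT y|lborel. ?f y))"
        using K by (simp add: ennreal_mult' mult_ac)
      also have "ennreal ?a * ennreal (LINT y|lborel. ?f y) = (\<integral>\<^sup>+y. ennreal ?a * ennreal (?f y) \<partial>lborel)"
        unfolding f by (rule nn_integral_cmult[symmetric]) measurable
      also have "\<dots> = (\<integral>\<^sup>+y. G m y * ennreal (norm (V x) * norm (x - y) powr (- \<beta>)) \<partial>lborel)"
      proof (intro nn_integral_cong)
        fix y
        have "(1 / norm (x - p)) ^ m * (norm (x - p) / norm (y - p)) ^ m = (1 / norm (y - p)) ^ m"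
          using elim by (simp flip: power_mult_distrib)
        moreover have "?a * ?f y = norm (V x) * norm (g y) * norm (x - y) powr (- \<beta>) *
            ((1 / norm (x - p)) ^ m * (norm (x - p) / norm (y - p)) ^ m)"
          by (simp only: mult_ac)
        ultimately have "?a * ?f y = (norm (g y) * (1 / norm (y - p)) ^ m) * (norm (V x) * norm (x - y) powr (- \<beta>))"
          by (simp only: mult_ac)
        thus "ennreal ?a * ennreal (?f y) = G m y * ennreal (norm (V x) * norm (x - y) powr (- \<beta>))"
          unfolding G_def by (subst (1 2) ennreal_mult[symmetric]) auto
      qed
      finally show "G m x \<le> ennreal K * (\<integral>\<^sup>+y. G m y * ennreal (norm (V x) * norm (x - y) powr (- \<beta>)) \<partial>lborel)" .
    qed
  qed
  \<comment> \<open>Kato condition: at most half of the integral over the ball returns on the right-hand side.\<close>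
  have I_le1: "I m \<le> ennreal (1 / 2) * (\<integral>\<^sup>+y. G m y \<partial>lborel)" for m
  proof -
    let ?w = "\<lambda>x y. ennreal (norm (V x) * norm (x - y) powr (- \<beta>))"
    have "I m \<le> (\<integral>\<^sup>+x. (ennreal K * (\<integral>\<^sup>+y. G m y * ?w x y \<partial>lborel)) * indicator (ball p r) x \<partial>lborel)"
      unfolding I_def using pointwise
      by (intro nn_integral_mono_AE, eventually_elim) (auto intro: mult_right_mono)
    also have "\<dots> = (\<integral>\<^sup>+x. ennreal K * (\<integral>\<^sup>+y. G m y * (?w x y * indicator (ball p r) x) \<partial>lborel) \<partial>lborel)"
    proof (intro nn_integral_cong)
      fix x
      have "(\<integral>\<^sup>+y. G m y * ?w x y \<partial>lborel) * indicator (ball p r) x = (\<integral>\<^sup>+y. G m y * ?w x y * indicator (ball p r) x \<partial>lborel)"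
        by (rule nn_integral_multc[symmetric]) measurable
      thus "(ennreal K * (\<integral>\<^sup>+y. G m y * ?w x y \<partial>lborel)) * indicator (ball p r) x =
          ennreal K * (\<integral>\<^sup>+y. G m y * (?w x y * indicator (ball p r) x) \<partial>lborel)"
        by (simp only: mult.assoc)
    qed
    also have "\<dots> = ennreal K * (\<integral>\<^sup>+x. \<integral>\<^sup>+y. G m y * (?w x y * indicator (ball p r) x) \<partial>lborel \<partial>lborel)"
      by (rule nn_integral_cmult) measurable
    also have "(\<integral>\<^sup>+x. \<integral>\<^sup>+y. G m y * (?w x y * indicator (ball p r) x) \<partial>lborel \<partial>lborel) =
       (\<integral>\<^sup>+y. \<integral>\<^sup>+x. G m y * (?w x y * indicator (ball p r) x) \<partial>lborel \<partial>lborel)"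
      by (rule lborel_pair.Fubini') measurable
    also have "\<dots> = (\<integral>\<^sup>+y. G m y * (\<integral>\<^sup>+x. ?w x y * indicator (ball p r) x \<partial>lborel) \<partial>lborel)"
      by (intro nn_integral_cong nn_integral_cmult) measurable
    also have "ennreal K * \<dots> \<le> ennreal K * (\<integral>\<^sup>+y. G m y * ennreal \<kappa> \<partial>lborel)"
      using kato_bound_other_center[OF V \<beta>(1) r kato] by (intro mult_left_mono nn_integral_mono) auto
    also have "(\<integral>\<^sup>+y. G m y * ennreal \<kappa> \<partial>lborel) = (\<integral>\<^sup>+y. G m y \<partial>lborel) * ennreal \<kappa>"
      by (rule nn_integral_multc) measurable
    also have "ennreal K * ((\<integral>\<^sup>+y. G m y \<partial>lborel) * ennreal \<kappa>) = ennreal (K * \<kappa>) * (\<integral>\<^sup>+y. G m y \<partial>lborel)"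
      using K by (simp add: ennreal_mult' mult_ac)
    also have "\<dots> \<le> ennreal (1 / 2) * (\<integral>\<^sup>+y. G m y \<partial>lborel)"
      using \<kappa> by (intro mult_right_mono ennreal_leI) (auto simp: K_def)
    finally show ?thesis .
  qed
  \<comment> \<open>Half of \<open>I m\<close> can be subtracted only if it is finite, which holds
    since g vanishes on \<open>ball p \<epsilon>\<close>.\<close>
  have I_fin: "I m < \<infinity>" for m
  proof -
    have "I m \<le> (\<integral>\<^sup>+y. ennreal ((1 / \<epsilon>) ^ m) * ennreal (norm (g y)) \<partial>lborel)"
      unfolding I_def using g_zero
    proof (intro nn_integral_mono_AE, eventually_elim)
      case (elim y)
      show ?case
      proof (cases "y \<in> ball p \<epsilon>")
        case False
        hence "(1 / norm (y - p)) ^ m \<le> (1 / \<epsilon>) ^ m"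
          using \<epsilon> by (intro power_mono divide_left_mono) (auto simp: dist_norm norm_minus_commute intro!: mult_pos_pos)
        hence "norm (g y) * (1 / norm (y - p)) ^ m \<le> (1 / \<epsilon>) ^ m * norm (g y)"
          by (subst mult.commute) (intro mult_right_mono, auto)
        hence "G m y \<le> ennreal ((1 / \<epsilon>) ^ m) * ennreal (norm (g y))"
          unfolding G_def using \<epsilon> by (subst ennreal_mult[symmetric]) (auto intro: ennreal_leI)
        thus ?thesis by (auto simp: indicator_def)
      qed (use elim in \<open>simp add: G_def\<close>)
    qed
    also have "\<dots> = ennreal ((1 / \<epsilon>) ^ m) * ennreal N" by (simp add: nn_integral_cmult N)
    also have "\<dots> < \<infinity>" by (simp add: ennreal_mult_less_top)
    finally show ?thesis .
  qed
  have outside: "(\<integral>\<^sup>+y. G m y * indicator (- ball p r) y \<partial>lborel) \<le> ennreal ((1 / r) ^ m * N)" for m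
  proof -
    have "(\<integral>\<^sup>+y. G m y * indicator (- ball p r) y \<partial>lborel) \<le> (\<integral>\<^sup>+y. ennreal ((1 / r) ^ m) * ennreal (norm (g y)) \<partial>lborel)"
    proof (intro nn_integral_mono)
      fix y
      show "G m y * indicator (- ball p r) y \<le> ennreal ((1 / r) ^ m) * ennreal (norm (g y))"
      proof (cases "y \<in> ball p r")
        case False
        hence "(1 / norm (y - p)) ^ m \<le> (1 / r) ^ m"
          using r by (intro power_mono divide_left_mono) (auto simp: dist_norm norm_minus_commute intro!: mult_pos_pos)
        hence "norm (g y) * (1 / norm (y - p)) ^ m \<le> (1 / r) ^ m * norm (g y)"
          by (subst mult.commute) (intro mult_right_mono, auto)
        hence "G m y \<le> ennreal ((1 / r) ^ m) * ennreal (norm (g y))"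
          unfolding G_def using r by (subst ennreal_mult[symmetric]) (auto intro: ennreal_leI)
        thus ?thesis using False by simp
      qed simp
    qed
    also have "\<dots> = ennreal ((1 / r) ^ m * N)" using r N0 by (simp add: nn_integral_cmult N ennreal_mult'')
    finally show ?thesis .
  qed
  have I_le: "I m \<le> ennreal ((1 / r) ^ m * N)" for m
  proof -
    have "(\<integral>\<^sup>+y. G m y \<partial>lborel) = I m + (\<integral>\<^sup>+y. G m y * indicator (- ball p r) y \<partial>lborel)"
      unfolding I_def by (subst nn_integral_add[symmetric]) (auto intro!: nn_integral_cong simp: indicator_def)
    hence "I m \<le> ennreal (1 / 2) * (I m + (\<integral>\<^sup>+y. G m y * indicator (- ball p r) y \<partial>lborel))"
      using I_le1[of m] by simp
    also have "\<dots> \<le> ennreal (1 / 2) * (I m + ennreal ((1 / r) ^ m * N))"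
      by (intro mult_left_mono add_left_mono outside) simp
    finally have *: "I m \<le> ennreal (1 / 2) * (I m + ennreal ((1 / r) ^ m * N))" .
    obtain i where i: "I m = ennreal i" "i \<ge> 0" using I_fin[of m] by (cases "I m") auto
    have n0: "(1 / r) ^ m * N \<ge> 0" using r N0 by simp
    have "ennreal (1 / 2) * ennreal (i + (1 / r) ^ m * N) = ennreal (1 / 2 * (i + (1 / r) ^ m * N))"
      by (rule ennreal_mult'[symmetric]) simp
    hence "ennreal i \<le> ennreal (1 / 2 * (i + (1 / r) ^ m * N))"
      using * unfolding i(1) ennreal_plus[OF i(2) n0, symmetric] by (simp only:)
    hence "i \<le> 1 / 2 * (i + (1 / r) ^ m * N)" using i n0 by (subst (asm) ennreal_le_iff) auto
    thus ?thesis using i by (simp add: ennreal_leI)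
  qed
  have g_zero_r: "AE x in lborel. x \<in> ball p r \<longrightarrow> g x = 0"
  proof -
    \<comment> \<open>On a strictly smaller closed ball the weight is at least q^(-m), against
      r^(-m) on the right, so the mass of g there is bounded by N (q/r)^m for every m.\<close>
    have Q: "AE x in lborel. x \<in> cball p q \<longrightarrow> g x = 0" if q: "0 < q" "q < r" for q
    proof -
      have [measurable]: "cball p q \<in> sets borel" by simp
      let ?L = "\<integral>\<^sup>+x. ennreal (norm (g x)) * indicator (cball p q) x \<partial>lborel"
      have "?L \<le> ennreal N" unfolding N[symmetric] by (intro nn_integral_mono) (auto simp: indicator_def)
      then obtain l where l: "?L = ennreal l" "l \<ge> 0" by (cases ?L) (auto simp: top_unique)
      have "l \<le> (q / r) ^ m * N" for m
      proof -
        have "ennreal ((1 / q) ^ m) * ?L = (\<integral>\<^sup>+x. ennreal ((1 / q) ^ m) * (ennreal (norm (g x)) * indicator (cball p q) x) \<partial>lborel)"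
          by (rule nn_integral_cmult[symmetric]) measurable
        also have "\<dots> \<le> I m"
          unfolding I_def using neq
        proof (intro nn_integral_mono_AE, eventually_elim)
          case (elim x)
          show ?case
          proof (cases "x \<in> cball p q")
            case True
            hence "(1 / q) ^ m \<le> (1 / norm (x - p)) ^ m"
              using q elim by (intro power_mono divide_left_mono) (auto simp: dist_norm norm_minus_commute intro!: mult_pos_pos)
            hence "(1 / q) ^ m * norm (g x) \<le> norm (g x) * (1 / norm (x - p)) ^ m"
              by (subst mult.commute) (intro mult_left_mono, auto)
            hence "ennreal ((1 / q) ^ m) * ennreal (norm (g x)) \<le> G m x"
              unfolding G_def using q by (subst ennreal_mult[symmetric]) (auto intro: ennreal_leI)
            moreover have "x \<in> ball p r" using True q by simp
            ultimately show ?thesis using True by simp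
          qed simp
        qed
        also have "\<dots> \<le> ennreal ((1 / r) ^ m * N)" by (rule I_le)
        finally have "ennreal ((1 / q) ^ m * l) \<le> ennreal ((1 / r) ^ m * N)"
          using q l by (simp add: ennreal_mult')
        hence "(1 / q) ^ m * l \<le> (1 / r) ^ m * N" using r N0 by (subst (asm) ennreal_le_iff) auto
        hence "q ^ m * ((1 / q) ^ m * l) \<le> q ^ m * ((1 / r) ^ m * N)" using q by (intro mult_left_mono) auto
        moreover have "q ^ m * ((1 / q) ^ m * l) = l" using q by (simp add: power_divide)
        moreover have "q ^ m * ((1 / r) ^ m * N) = (q / r) ^ m * N" by (simp add: power_divide)
        ultimately show ?thesis by simp
      qed
      hence "l \<le> 0" using q by (intro power_seq_le_imp_zero[of "q / r" l N]) auto
      hence "?L = 0" using l by simp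
      hence "AE x in lborel. ennreal (norm (g x)) * indicator (cball p q) x = 0"
        by (subst (asm) nn_integral_0_iff_AE) auto
      thus ?thesis by eventually_elim (auto simp: indicator_def ennreal_eq_0_iff)
    qed
    \<comment> \<open>The denominator k + 2 makes every radius positive, including the one for k =
      0.\<close>
    have "AE x in lborel. \<forall>k::nat. x \<in> cball p (r * (1 - 1 / real (k + 2))) \<longrightarrow> g x = 0"
      unfolding AE_all_countable using r by (intro allI Q) (auto simp: field_simps add_pos_nonneg)
    thus ?thesis
    proof eventually_elim
      case (elim x)
      show ?case
      proof
        assume x: "x \<in> ball p r"
        hence "1 - dist p x / r > 0" using r by simp
        then obtain k :: nat where k: "1 / real (Suc k) < 1 - dist p x / r" using nat_approx_posE by blast
        have "1 / real (k + 2) \<le> 1 / real (Suc k)" by (simp add: field_simps)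
        hence "dist p x / r \<le> 1 - 1 / real (k + 2)" using k by linarith
        hence "dist p x \<le> (1 - 1 / real (k + 2)) * r" using r by (subst (asm) pos_divide_le_eq) auto
        hence "x \<in> cball p (r * (1 - 1 / real (k + 2)))" by (simp add: mult.commute)
        thus "g x = 0" using elim by blast
      qed
    qed
  qed
  \<comment> \<open>The decay estimate is applied once more, now with g known to vanish on all of
    \<open>ball p r\<close>: the ratio |x - p|/|y - p| is at most the fixed q < 1 on the remaining
    mass of g, so its m-th power forces u(x) = 0.\<close>
  show ?thesis
    using decay rep
  proof eventually_elim
    case (elim x)
    show ?case
    proof
      assume x: "x \<in> ball p r"
      define q where "q = norm (x - p) / r"
      have q: "0 \<le> q" "q < 1" using x r by (auto simp: q_def dist_norm norm_minus_commute)
      let ?M = "LINT y|lborel. norm (g y * of_real (norm (x - y) powr (- \<beta>)))"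
      have "norm (u x) \<le> q ^ m * (K * ?M)" for m
      proof -
        have "(LINT y|lborel. norm (g y) * ((norm (x - p) / norm (y - p)) ^ m * norm (x - y) powr (- \<beta>))) \<le>
            (LINT y|lborel. q ^ m * norm (g y * of_real (norm (x - y) powr (- \<beta>))))"
        proof (rule integral_mono_AE)
          show "AE y in lborel. norm (g y) * ((norm (x - p) / norm (y - p)) ^ m * norm (x - y) powr (- \<beta>)) \<le>
             q ^ m * norm (g y * of_real (norm (x - y) powr (- \<beta>)))"
            using g_zero_r
          proof eventually_elim
            case (elim y)
            show ?case
            proof (cases "y \<in> ball p r")
              case False
              hence "(norm (x - p) / norm (y - p)) ^ m \<le> q ^ m"
                unfolding q_def using r
                by (intro power_mono divide_left_mono) (auto simp: dist_norm norm_minus_commute intro!: mult_pos_pos)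
              hence "(norm (x - p) / norm (y - p)) ^ m * (norm (g y) * norm (x - y) powr (- \<beta>)) \<le> q ^ m * (norm (g y) * norm (x - y) powr (- \<beta>))"
                by (intro mult_right_mono) auto
              thus ?thesis by (simp add: norm_mult mult_ac)
            qed (use elim in simp)
          qed
        qed (use elim in \<open>auto intro!: remainder_bound(1) integrable_mult_right integrable_norm\<close>)
        hence "K * (LINT y|lborel. norm (g y) * ((norm (x - p) / norm (y - p)) ^ m * norm (x - y) powr (- \<beta>))) \<le> K * (q ^ m * ?M)"
          using K by (intro mult_left_mono) auto
        thus ?thesis using elim(1)[rule_format, of m] by (simp add: mult.left_commute)
      qed
      hence "norm (u x) \<le> 0" by (rule power_seq_le_imp_zero[OF q])
      thus "u x = 0" by simp
    qed
  qed
qed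

section \<open>Borel representatives and the conclusion\<close>

lemma lebesgue_measurable_complex_AE_borel:
  fixes f :: "'a::euclidean_space \<Rightarrow> complex"
  assumes [measurable]: "f \<in> borel_measurable lebesgue"
  obtains f' where "f' \<in> borel_measurable borel" "AE x in lborel. f x = f' x"
proof -
  have "(\<lambda>x. Re (f x)) \<in> borel_measurable (completion lborel)" "(\<lambda>x. Im (f x)) \<in> borel_measurable (completion lborel)"
    by measurable
  then obtain a b where ab: "a \<in> borel_measurable lborel" "AE x in lborel. Re (f x) = a x"
     "b \<in> borel_measurable lborel" "AE x in lborel. Im (f x) = b x"
    by (metis completion_ex_borel_measurable_real)
  have "AE x in lborel. f x = Complex (a x) (b x)"
    using ab(2,4) by eventually_elim (simp add: complex_eq_iff)
  moreover have "(\<lambda>x. Complex (a x) (b x)) \<in> borel_measurable borel"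
  proof -
    have "(\<lambda>x. complex_of_real (a x) + \<i> * complex_of_real (b x)) \<in> borel_measurable borel"
      using ab(1,3) by measurable
    thus ?thesis by (simp only: Complex_eq)
  qed
  ultimately show thesis using that by blast
qed

lemma integrable_lebesgue_AE_borel:
  fixes f f' :: "'a::euclidean_space \<Rightarrow> complex"
  assumes "integrable lebesgue f" "f' \<in> borel_measurable borel" "AE x in lborel. f x = f' x"
  shows "integrable lborel f'"
proof -
  have f': "f' \<in> borel_measurable lebesgue" using assms(2) by (intro measurable_completion) simp
  have "integrable lebesgue f'"
    using assms f' AE_completion[OF assms(3)]
    by (subst integrable_cong_AE[of f' lebesgue f]) (auto elim!: eventually_mono)
  thus ?thesis using assms(2) by (subst (asm) integrable_completion) auto
qed

lemma kato_class_borel_bound: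
  fixes V V' :: "real ^ 'n \<Rightarrow> complex"
  assumes V: "V \<in> kato_class \<alpha>" and V': "V' \<in> borel_measurable borel" "AE x in lborel. V x = V' x"
    and \<kappa>: "\<kappa> > 0"
  obtains r where "r > 0"
    "\<And>y. (\<integral>\<^sup>+x. ennreal (norm (V' x) * norm (x - y) powr (- (real CARD('n) - \<alpha>))) * indicator (ball y (3 * r)) x \<partial>lborel) \<le> ennreal \<kappa>"
proof -
  let ?N = "\<lambda>r. SUP x. \<integral>\<^sup>+y\<in>ball x r. ennreal (norm (V y) / norm (x - y) powr (real CARD('n) - \<alpha>)) \<partial>lebesgue"
  have "(?N \<longlongrightarrow> 0) (at_right 0)" using V by (simp add: kato_class_def)
  moreover have "0 < ennreal \<kappa>" using \<kappa> by simp
  ultimately have "eventually (\<lambda>r. ?N r < ennreal \<kappa>) (at_right 0)"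
    by (rule order_tendstoD(2))
  then obtain b where b: "b > 0" "\<And>r. 0 < r \<Longrightarrow> r < b \<Longrightarrow> ?N r < ennreal \<kappa>"
    by (auto simp: eventually_at_right_field)
  \<comment> \<open>The condition is required at radius 3 r, and 3 (b/6) = b/2 lies below the
    threshold b.\<close>
  show thesis
  proof (rule that[of "b / 6"])
    fix y :: "real ^ 'n"
    have "(\<integral>\<^sup>+x. ennreal (norm (V' x) * norm (x - y) powr (- (real CARD('n) - \<alpha>))) * indicator (ball y (3 * (b / 6))) x \<partial>lborel) =
      (\<integral>\<^sup>+x. ennreal (norm (V x) / norm (y - x) powr (real CARD('n) - \<alpha>)) * indicator (ball y (b / 2)) x \<partial>lborel)"
    proof (rule nn_integral_cong_AE)
      show "AE x in lborel. ennreal (norm (V' x) * norm (x - y) powr (- (real CARD('n) - \<alpha>))) * indicator (ball y (3 * (b / 6))) x =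
        ennreal (norm (V x) / norm (y - x) powr (real CARD('n) - \<alpha>)) * indicator (ball y (b / 2)) x"
        using V'(2)
      proof eventually_elim
        case (elim x)
        have "norm (x - y) powr (- (real CARD('n) - \<alpha>)) = 1 / norm (y - x) powr (real CARD('n) - \<alpha>)"
          by (simp only: norm_minus_commute[of x y] powr_minus_divide)
        thus ?case using elim by simp
      qed
    qed
    also have "\<dots> = (\<integral>\<^sup>+x\<in>ball y (b / 2). ennreal (norm (V x) / norm (y - x) powr (real CARD('n) - \<alpha>)) \<partial>lebesgue)"
      by (simp add: nn_integral_completion)
    also have "\<dots> \<le> ?N (b / 2)" by (rule SUP_upper) simp
    also have "\<dots> \<le> ennreal \<kappa>" using b(2)[of "b / 2"] b(1) by simp
    finally show "(\<integral>\<^sup>+x. ennreal (norm (V' x) * norm (x - y) powr (- (real CARD('n) - \<alpha>))) * indicator (ball y (3 * (b / 6))) x \<partial>lborel) \<le> ennreal \<kappa>" .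
  qed (use b in simp)
qed

text \<open>Modulated Gaussians are Schwartz functions with translated heat kernels as transforms,
  so the distributional identity tested on them becomes an equation of ordinary integrals for all t
  > 0 and a. Null-set changes do not affect these integrals, which allows the Borel
  representatives.\<close>

lemma frac_laplacian_heat_pairing:
  fixes u g u' g' :: "real ^ 'n \<Rightarrow> complex"
  assumes lap: "is_frac_laplacian \<alpha> u (distribution_of g)"
    and u: "u \<in> borel_measurable lebesgue" "u' \<in> borel_measurable borel" "AE x in lborel. u x = u' x"
    and g: "g \<in> borel_measurable lebesgue" "g' \<in> borel_measurable borel" "AE x in lborel. g x = g' x"
    and t: "t > 0"
  shows "(LINT y|lborel. g' y * of_real (heat_kernel t (a - y))) =
      (LINT \<xi>|lborel. of_real (norm \<xi> powr \<alpha>) * fourier u' \<xi> * modulated_gaussian t a \<xi>)"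
proof -
  note [measurable] = u(2) g(2)
  note [measurable] = borel_measurable_fourier[OF u(2)]
  have leb: "f \<in> borel_measurable lebesgue" if "f \<in> borel_measurable borel" for f :: "real ^ 'n \<Rightarrow> complex"
    using that by (intro measurable_completion) simp
  have four: "fourier u = fourier u'"
  proof
    fix \<xi>
    show "fourier u \<xi> = fourier u' \<xi>"
      unfolding fourier_def
    proof (rule integral_cong_AE)
      have e: "(\<lambda>x. exp (- (2 * of_real pi * \<i> * of_real (x \<bullet> \<xi>)))) \<in> borel_measurable lebesgue"
        by (rule leb) measurable
      show "(\<lambda>x. exp (- (2 * of_real pi * \<i> * of_real (x \<bullet> \<xi>))) * u x) \<in> borel_measurable lebesgue"
        by (intro borel_measurable_times e u(1))
      show "(\<lambda>x. exp (- (2 * of_real pi * \<i> * of_real (x \<bullet> \<xi>))) * u' x) \<in> borel_measurable lebesgue"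
        by (intro borel_measurable_times e leb u(2))
      show "AE x in lebesgue. exp (- (2 * of_real pi * \<i> * of_real (x \<bullet> \<xi>))) * u x = exp (- (2 * of_real pi * \<i> * of_real (x \<bullet> \<xi>))) * u' x"
        using AE_completion[OF u(3)] by eventually_elim simp
    qed
  qed
  have hk: "(\<lambda>y. complex_of_real (heat_kernel t (a - y))) \<in> borel_measurable borel" by measurable
  have "(LINT y|lborel. g' y * of_real (heat_kernel t (a - y))) = (LINT y|lebesgue. g' y * of_real (heat_kernel t (a - y)))"
    by (rule integral_completion[symmetric]) measurable
  also have "\<dots> = (LINT y|lebesgue. g y * of_real (heat_kernel t (a - y)))"
  proof (rule integral_cong_AE)
    show "(\<lambda>y. g' y * of_real (heat_kernel t (a - y))) \<in> borel_measurable lebesgue"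
      by (rule leb) measurable
    show "(\<lambda>y. g y * of_real (heat_kernel t (a - y))) \<in> borel_measurable lebesgue"
      by (intro borel_measurable_times g(1) leb hk)
    show "AE y in lebesgue. g' y * of_real (heat_kernel t (a - y)) = g y * of_real (heat_kernel t (a - y))"
      using AE_completion[OF g(3)] by eventually_elim simp
  qed
  also have "\<dots> = fourier_distribution (distribution_of g) (modulated_gaussian t a)"
    by (simp add: fourier_distribution_def distribution_of_def fourier_modulated_gaussian[OF t])
  also have "\<dots> = distribution_of (\<lambda>\<xi>. of_real (norm \<xi> powr \<alpha>) * fourier u \<xi>) (modulated_gaussian t a)"
    using lap modulated_gaussian_schwartz[OF t] unfolding is_frac_laplacian_def by blast
  also have "\<dots> = (LINT \<xi>|lborel. of_real (norm \<xi> powr \<alpha>) * fourier u' \<xi> * modulated_gaussian t a \<xi>)"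
    unfolding distribution_of_def four by (rule integral_completion) measurable
  finally show ?thesis .
qed

theorem theorem1p1:
  fixes \<alpha> :: real and V u g :: "real ^ 'n \<Rightarrow> complex"
  assumes "CARD('n) \<ge> 2"
    and "real CARD('n) - 1 \<le> \<alpha>" and "\<alpha> < real CARD('n)"
    and "V \<in> kato_class \<alpha>"
    and "integrable lebesgue u"
    and "\<not> (AE x in lebesgue. u x = 0)"
    and "integrable lebesgue g"
    and "is_frac_laplacian \<alpha> u (distribution_of g)"
    and "AE x in lebesgue. norm (g x) \<le> norm (V x * u x)"
  shows "\<not> (\<exists>\<Omega>. open \<Omega> \<and> \<Omega> \<noteq> {} \<and> (AE x in lebesgue. x \<in> \<Omega> \<longrightarrow> u x = 0))"
proof
  assume "\<exists>\<Omega>. open \<Omega> \<and> \<Omega> \<noteq> {} \<and> (AE x in lebesgue. x \<in> \<Omega> \<longrightarrow> u x = 0)"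
  then obtain \<Omega> where \<Omega>: "open \<Omega>" "\<Omega> \<noteq> {}" "AE x in lborel. x \<in> \<Omega> \<longrightarrow> u x = 0"
    by (auto simp: AE_completion_iff)
  have meas: "u \<in> borel_measurable lebesgue" "g \<in> borel_measurable lebesgue" "V \<in> borel_measurable lebesgue"
    using assms(4,5,7) by (auto simp: kato_class_def dest: borel_measurable_integrable)
  obtain u' where u': "u' \<in> borel_measurable borel" "AE x in lborel. u x = u' x"
    using lebesgue_measurable_complex_AE_borel[OF meas(1)] .
  obtain g' where g': "g' \<in> borel_measurable borel" "AE x in lborel. g x = g' x"
    using lebesgue_measurable_complex_AE_borel[OF meas(2)] .
  obtain V' where V': "V' \<in> borel_measurable borel" "AE x in lborel. V x = V' x"
    using lebesgue_measurable_complex_AE_borel[OF meas(3)] .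
  have u'_int: "integrable lborel u'" and g'_int: "integrable lborel g'"
    using integrable_lebesgue_AE_borel assms u' g' by blast+
  define \<beta> where "\<beta> = real CARD('n) - \<alpha>"
  \<comment> \<open>Here \<beta> \<le> 1 restates n - 1 \<le> \<alpha>, and n \<ge> 2 gives \<alpha>
    > 0.\<close>
  have \<beta>: "0 < \<beta>" "\<beta> \<le> 1" and \<alpha>: "0 < \<alpha>" using assms(1-3) by (auto simp: \<beta>_def)
  obtain C where C: "C > 0" and rep:
    "AE x in lborel. integrable lborel (\<lambda>y. g' y * of_real (norm (x - y) powr (- \<beta>))) \<and>
      u' x = of_real C * (LINT y|lborel. g' y * of_real (norm (x - y) powr (- \<beta>)))"
    using riesz_representation[OF u'_int g'_int \<alpha> assms(3)
        frac_laplacian_heat_pairing[OF assms(8) meas(1) u' meas(2) g']]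
    unfolding \<beta>_def by auto
  have ineq: "AE x in lborel. norm (g' x) \<le> norm (V' x * u' x)"
  proof -
    have "AE x in lborel. norm (g x) \<le> norm (V x * u x)" using assms(9) by (simp add: AE_completion_iff)
    thus ?thesis using u'(2) g'(2) V'(2) by eventually_elim simp
  qed
  \<comment> \<open>Chosen so that the absorbed fraction C * \<open>zonal_const \<beta>\<close> *
    \<kappa> is exactly 1/2. It depends on \<alpha> and n only through C and \<beta>, so the radius
    obtained from it is the same for all centres.\<close>
  define \<kappa> where "\<kappa> = 1 / (2 * (C * zonal_const \<beta>))"
  have \<kappa>: "\<kappa> > 0" "C * zonal_const \<beta> * \<kappa> \<le> 1 / 2"
    using C zonal_const_pos[OF \<beta>(1)] by (auto simp: \<kappa>_def)
  obtain r where r: "r > 0" and kato: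
    "\<And>y. (\<integral>\<^sup>+x. ennreal (norm (V' x) * norm (x - y) powr (- \<beta>)) * indicator (ball y (3 * r)) x \<partial>lborel) \<le> ennreal \<kappa>"
    using kato_class_borel_bound[OF assms(4) V' \<kappa>(1)] unfolding \<beta>_def by blast
  obtain p0 \<epsilon>0 where init: "\<epsilon>0 > 0" "ball p0 \<epsilon>0 \<subseteq> \<Omega>" using \<Omega>(1,2) openE by blast
  have start: "AE x in lborel. x \<in> ball p0 \<epsilon>0 \<longrightarrow> u' x = 0"
    using \<Omega>(3) u'(2) by eventually_elim (use init in auto)
  have "AE x in lborel. u' x = 0"
  proof (rule AE_if_uniformly_propagating[OF r _ init(1) start])
    fix p and \<epsilon> :: real
    assume "\<epsilon> > 0" "AE x in lborel. x \<in> ball p \<epsilon> \<longrightarrow> u' x = 0"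
    thus "AE x in lborel. x \<in> ball p r \<longrightarrow> u' x = 0"
      by (rule vanishing_propagates[OF u'(1) g'_int V'(1) \<beta> C rep ineq r less_imp_le[OF \<kappa>(1)] \<kappa>(2) kato])
  qed
  hence "AE x in lborel. u x = 0" using u'(2) by eventually_elim simp
  thus False using assms(6) by (simp add: AE_completion_iff)
qed

end
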